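(* Let $\alpha,\beta\ge 1$ be integers, let $N>\max\{2\alpha,2\beta\}$, let $p,q>0$ with $pq>1$, and let $B_1$ be the open unit ball of $\mathbb{R}^N$. Consider the problem \[ \begin{cases} (-\Delta)^{\alpha} u=|v|^q & \text{in } B_1,\\ (-\Delta)^{\beta} v=|u|^p & \text{in } B_1,\\ \frac{\partial^{r} u}{\partial \nu^{r}}=0,\quad r=0,\dots,\alpha-1, & \text{on } \partial B_1,\\ \frac{\partial^{r} v}{\partial \nu^{r}}=0,\quad r=0,\dots,\beta-1, & \text{on } \partial B_1, \end{cases} \] with solutions $(u,v)\in C^{2\alpha}(\bar B_1)\times C^{2\beta}(\bar B_1)$. If the only solution of this problem is the trivial one $(u,v)=(0,0)$, then there exists a classical, nontrivial, radially symmetric solution $(u,v)\in C^{2\alpha}(\mathbb{R}^N)\times C^{2\beta}(\mathbb{R}^N)$ of \[ \begin{cases} (-\Delta)^{\alpha} u=|v|^q\\ (-\Delta)^{\beta} v=|u|^p \end{cases} \quad\text{in } \mathbb{R}^N . \]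
   Context: $(-\Delta)^{\alpha}=-\Delta\big((-\Delta)^{\alpha-1}\big)$ is the polyharmonic operator, and $\nu$ is the outward pointing normal on $\partial B_1$. Nontrivial means $(u,v)\neq(0,0)$; radially symmetric means that both $u$ and $v$ depend only on $|x|$. *)

theory Defs
  imports "HOL-Analysis.Analysis"
begin

text \<open>
  Derivatives are taken relative to a set \<open>S\<close>, which is either open or a closed ball.  On an open
  set they are the ordinary derivatives.  On a closed ball they are one-sided at boundary points,
  where the Frechet derivative within \<open>S\<close> is still unique; they only depend on the values on \<open>S\<close>.
\<close>

definition dir_deriv :: "'a::euclidean_space set \<Rightarrow> 'a \<Rightarrow> ('a \<Rightarrow> real) \<Rightarrow> 'a \<Rightarrow> real" where
  "dir_deriv S w f x = frechet_derivative f (at x within S) w"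

text \<open>
  For \<open>S\<close> the closed unit ball, \<open>Ck_on k f S\<close> says that \<open>f\<close> is continuous on \<open>S\<close>, is k times
  continuously differentiable in the interior, and that all its partial derivatives of order at
  most \<open>k\<close> extend continuously to \<open>S\<close> (the extensions being the one-sided derivatives).
\<close>

primrec Ck_on :: "nat \<Rightarrow> ('a::euclidean_space \<Rightarrow> real) \<Rightarrow> 'a set \<Rightarrow> bool" where
  "Ck_on 0 f S \<longleftrightarrow> continuous_on S f"
| "Ck_on (Suc k) f S \<longleftrightarrow> f differentiable_on S \<and> (\<forall>b\<in>Basis. Ck_on k (dir_deriv S b f) S)"

definition laplacian :: "'a::euclidean_space set \<Rightarrow> ('a \<Rightarrow> real) \<Rightarrow> 'a \<Rightarrow> real" where
  "laplacian S f x = (\<Sum>b\<in>Basis. dir_deriv S b (dir_deriv S b f) x)"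

primrec polyharmonic :: "'a::euclidean_space set \<Rightarrow> nat \<Rightarrow> ('a \<Rightarrow> real) \<Rightarrow> 'a \<Rightarrow> real" where
  "polyharmonic S 0 f = f"
| "polyharmonic S (Suc k) f = (\<lambda>x. - laplacian S (polyharmonic S k f) x)"

text \<open>
  The outward unit normal of the unit ball at a boundary point \<open>x\<close> is \<open>x\<close> itself.  The direction is
  frozen at \<open>x\<close> while differentiating, so this is the r-th derivative of \<open>f\<close> at \<open>x\<close> applied
  to \<open>r\<close> copies of the normal, i.e. the r-th derivative of \<open>f\<close> along the normal line through \<open>x\<close>.
\<close>

definition normal_deriv :: "nat \<Rightarrow> ('a::euclidean_space \<Rightarrow> real) \<Rightarrow> 'a \<Rightarrow> real" where
  "normal_deriv r f x = (dir_deriv (cball 0 1) x ^^ r) f x"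

definition system_on ::
  "'a::euclidean_space set \<Rightarrow> nat \<Rightarrow> nat \<Rightarrow> real \<Rightarrow> real \<Rightarrow> ('a \<Rightarrow> real) \<Rightarrow> ('a \<Rightarrow> real) \<Rightarrow> bool" where
  "system_on S \<alpha> \<beta> p q u v \<longleftrightarrow>
     (\<forall>x\<in>S. polyharmonic S \<alpha> u x = \<bar>v x\<bar> powr q \<and> polyharmonic S \<beta> v x = \<bar>u x\<bar> powr p)"

definition dirichlet_solution ::
  "nat \<Rightarrow> nat \<Rightarrow> real \<Rightarrow> real \<Rightarrow> ('a::euclidean_space \<Rightarrow> real) \<Rightarrow> ('a \<Rightarrow> real) \<Rightarrow> bool" where
  "dirichlet_solution \<alpha> \<beta> p q u v \<longleftrightarrow>
     Ck_on (2 * \<alpha>) u (cball 0 1) \<and> Ck_on (2 * \<beta>) v (cball 0 1) \<and>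
     system_on (ball 0 1) \<alpha> \<beta> p q u v \<and>
     (\<forall>x\<in>sphere 0 1. \<forall>r<\<alpha>. normal_deriv r u x = 0) \<and>
     (\<forall>x\<in>sphere 0 1. \<forall>r<\<beta>. normal_deriv r v x = 0)"

definition entire_solution ::
  "nat \<Rightarrow> nat \<Rightarrow> real \<Rightarrow> real \<Rightarrow> ('a::euclidean_space \<Rightarrow> real) \<Rightarrow> ('a \<Rightarrow> real) \<Rightarrow> bool" where
  "entire_solution \<alpha> \<beta> p q u v \<longleftrightarrow>
     Ck_on (2 * \<alpha>) u UNIV \<and> Ck_on (2 * \<beta>) v UNIV \<and> system_on UNIV \<alpha> \<beta> p q u v"

definition radially_symmetric :: "('a::real_normed_vector \<Rightarrow> real) \<Rightarrow> bool" where
  "radially_symmetric f \<longleftrightarrow> (\<forall>x y. norm x = norm y \<longrightarrow> f x = f y)"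

end

theory Submission
  imports Defs "HOL-Complex_Analysis.Great_Picard"
begin

text \<open>
  Everything is radial: with \<open>s = |x|\<^sup>2 / 2\<close> the operator \<open>- \<Delta>\<close> is inverted by integrating averages over
  balls, and since averages commute past integrations (with a shift of the weight), the Dirichlet
  solution of \<open>(- \<Delta>)\<^sup>k u = f\<close> on the unit ball is a \<open>k\<close>-fold backward integral from \<open>s = 1/2\<close> of a
  \<open>k\<close>-fold average of \<open>f\<close>.  Hence it is nonnegative and radially decreasing for \<open>f \<ge> 0\<close>, and no Green
  function is needed.

  For \<open>t > 0\<close>, Schauder's theorem yields \<open>u\<close> with maximum \<open>u(0) = 1\<close> and
  \<open>(- \<Delta>)\<^sup>\<alpha> u = \<mu> (v\<^sup>q + t)\<close>, \<open>(- \<Delta>)\<^sup>\<beta> v = u\<^sup>p\<close> under Dirichlet conditions, where \<open>\<mu> > 0\<close> is a normalising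
  factor.  Let \<open>t \<rightarrow> 0\<close>.  If \<open>\<mu>\<close> stays bounded along a subsequence, a limit exists and, because \<open>p q \<noteq> 1\<close>,
  multiplying \<open>u\<close> and \<open>v\<close> by constants removes \<open>\<mu>\<close>: a nontrivial Dirichlet solution, which is excluded.  So
  \<open>\<mu> \<rightarrow> \<infinity>\<close>, and blowing up around the origin at the scale that absorbs \<open>\<mu>\<close> gives a system on growing
  balls with right-hand sides tending to those of the problem and with \<open>u(0) = 1\<close>.  The rescaled \<open>v\<close>
  are bounded, so that a subsequence converges to an entire solution.
\<close>

section \<open>Averages and iterated integrals\<close>

text \<open>At u = 0 the unperturbed map, divided by its value at the centre, would be 0/0. The term
  \<open>t\<close> bounds that value below by \<open>t\<close> times the central value of the
  solution with right-hand side 1. At a fixed point the same bound says that \<mu> t stays bounded,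
  so that the perturbation disappears in the blow-up. Since the central value is the maximum, it can
  serve as the norm, and u(0) = 1 passes to pointwise limits of the u's, which keeps them
  nontrivial.

  The right-hand sides are only known to be continuous, and for merely continuous data the Laplacian
  does not in general give two classical derivatives. For radial data it does: a solution is a
  polynomial in s plus iterated integrals of iterated averages, and each average gains one
  derivative s d/ds. This formula also replaces elliptic estimates: local bounds on the right-hand
  side control the integral part, pointwise bounds on the solution then control the finitely many
  coefficients, and the fact that a bounded polynomial is constant plays the role of a Liouville
  theorem.\<close>

text \<open>
  If \<open>g\<close> represents a radial function on \<open>\<real>\<^sup>m\<^sup>+\<^sup>1\<close> in the variable \<open>s = |x|\<^sup>2 / 2\<close>, then \<open>(m + 1) avg m g\<close> is its mean
  over the ball through \<open>x\<close>.
\<close>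

definition avg :: "nat \<Rightarrow> (real \<Rightarrow> real) \<Rightarrow> real \<Rightarrow> real" where
  "avg m g s = integral {0..1} (\<lambda>t. t ^ m * g (t\<^sup>2 * s))"

lemma avg_integrand_continuous:
  assumes "continuous_on UNIV (g::real \<Rightarrow> real)"
  shows "continuous_on A (\<lambda>t::real. t ^ m * g (t\<^sup>2 * s))"
  by (intro continuous_intros continuous_on_compose2[OF assms]) auto

lemma avg_integrable:
  assumes "continuous_on UNIV (g::real \<Rightarrow> real)"
  shows "(\<lambda>t::real. t ^ m * g (t\<^sup>2 * s)) integrable_on {0..1}"
  by (intro integrable_continuous_real avg_integrand_continuous assms)

lemma avg_continuous [continuous_intros]:
  assumes "continuous_on UNIV g"
  shows "continuous_on A (avg m g)"
proof -
  have "continuous_on A (\<lambda>s. integral (cbox 0 1) (\<lambda>t. t ^ m * g (t\<^sup>2 * s)))"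
    by (intro integral_continuous_on_param)
       (auto simp: case_prod_beta intro!: continuous_intros continuous_on_compose2[OF assms])
  then show ?thesis by (simp add: avg_def[abs_def])
qed

lemma square_mult_in_interval:
  fixes s t :: real
  assumes "0 \<le> s" "t \<in> {0..1}"
  shows "t\<^sup>2 * s \<in> {0..s}"
  using assms by (auto simp: power_le_one mult_left_le_one_le)

lemma avg_mono:
  assumes "continuous_on UNIV f" "continuous_on UNIV g" "0 \<le> s" "\<And>r. r \<in> {0..s} \<Longrightarrow> f r \<le> g r"
  shows "avg m f s \<le> avg m g s"
  unfolding avg_def
  using square_mult_in_interval[OF \<open>0 \<le> s\<close>]
  by (intro integral_le avg_integrable assms mult_left_mono) (auto intro!: assms(4))

lemma avg_cong:
  assumes "0 \<le> s" "\<And>r. r \<in> {0..s} \<Longrightarrow> f r = g r"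
  shows "avg m f s = avg m g s"
  unfolding avg_def
  using square_mult_in_interval[OF \<open>0 \<le> s\<close>] assms(2) by (intro integral_cong) auto

lemma integral_power_unit: "integral {0..1} (\<lambda>t::real. t ^ m) = 1 / (real m + 1)"
proof -
  have "((\<lambda>t::real. t ^ m) has_integral (1 ^ (m+1) / (m+1) - 0 ^ (m+1) / (m+1))) {0..1}"
    by (rule fundamental_theorem_of_calculus)
       (auto intro!: derivative_eq_intros simp: has_real_derivative_iff_has_vector_derivative[symmetric] simp del: of_nat_Suc power_Suc)
  then show ?thesis by (simp add: integral_unique)
qed

lemma avg_const [simp]: "avg m (\<lambda>_. c) s = c / (real m + 1)"
  unfolding avg_def using integral_power_unit[of m] by simp

lemma avg_monomial: "avg m (\<lambda>s. c * s ^ k) s = c / (real m + 2 * real k + 1) * s ^ k"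
proof -
  have "avg m (\<lambda>s. c * s ^ k) s = integral {0..1} (\<lambda>t. t ^ (m + 2 * k) * (c * s ^ k))"
    unfolding avg_def
    by (intro integral_cong) (simp add: power_mult_distrib power_add mult_ac flip: power_mult)
  then show ?thesis using integral_power_unit[of "m + 2 * k"] by simp
qed

lemma avg_at_0 [simp]: "avg m g 0 = g 0 / (real m + 1)"
  unfolding avg_def using integral_power_unit[of m] by simp

lemma avg_add:
  assumes "continuous_on UNIV f" "continuous_on UNIV g"
  shows "avg m (\<lambda>s. f s + g s) s = avg m f s + avg m g s"
  unfolding avg_def using integral_add[OF avg_integrable[OF assms(1)] avg_integrable[OF assms(2)]]
  by (simp add: distrib_left)

lemma avg_cmult: "avg m (\<lambda>s. c * f s) s = c * avg m f s"
proof -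
  have "avg m (\<lambda>s. c * f s) s = integral {0..1} (\<lambda>t. c * (t ^ m * f (t\<^sup>2 * s)))"
    unfolding avg_def by (simp add: mult_ac)
  then show ?thesis unfolding avg_def by simp
qed

lemma avg_scale: "avg m (\<lambda>s. g (s / c)) s = avg m g (s / c)"
  unfolding avg_def by simp

lemma avg_abs_le:
  assumes "continuous_on UNIV f" "0 \<le> s" "\<And>r. r \<in> {0..s} \<Longrightarrow> \<bar>f r\<bar> \<le> C"
  shows "\<bar>avg m f s\<bar> \<le> C"
proof -
  have C: "0 \<le> C" using assms(3)[of 0] assms(2) by auto
  have "avg m f s \<le> avg m (\<lambda>_. C) s"
    using assms by (intro avg_mono) (auto intro!: continuous_intros simp: abs_le_iff)
  moreover have "avg m (\<lambda>_. - C) s \<le> avg m f s"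
    using assms by (intro avg_mono) (auto intro!: continuous_intros simp: abs_le_iff minus_le_iff)
  moreover have "C / (real m + 1) \<le> C" using C by (simp add: divide_le_eq mult_left_le algebra_simps)
  ultimately show ?thesis by (auto simp: abs_le_iff)
qed

lemma avg_convergence:
  assumes "\<And>n. continuous_on UNIV (f n)" "0 \<le> s"
    and "\<And>n r. r \<in> {0..s} \<Longrightarrow> \<bar>f n r\<bar> \<le> C"
    and "\<And>r. r \<in> {0..s} \<Longrightarrow> (\<lambda>n. f n r) \<longlonglongrightarrow> g r"
  shows "(\<lambda>n. avg m (f n) s) \<longlonglongrightarrow> avg m g s"
  unfolding avg_def
proof (rule dominated_convergence(2))
  show "(\<lambda>t. t ^ m * f n (t\<^sup>2 * s)) integrable_on {0..1}" for n
    by (rule avg_integrable) fact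
  show "(\<lambda>_. C) integrable_on {0..1::real}" by (rule integrable_const_ivl)
  fix t :: real assume t: "t \<in> {0..1}"
  have in_s: "t\<^sup>2 * s \<in> {0..s}" by (rule square_mult_in_interval) fact+
  show "norm (t ^ m * f n (t\<^sup>2 * s)) \<le> C" for n
  proof -
    have "\<bar>t ^ m\<bar> \<le> 1" using t by (simp add: power_le_one)
    then have "\<bar>t ^ m\<bar> * \<bar>f n (t\<^sup>2 * s)\<bar> \<le> 1 * C" using assms(3)[OF in_s] by (intro mult_mono) auto
    then show ?thesis by (simp add: abs_mult)
  qed
  show "(\<lambda>n. t ^ m * f n (t\<^sup>2 * s)) \<longlonglongrightarrow> t ^ m * g (t\<^sup>2 * s)"
    by (intro tendsto_intros assms in_s)
qed

text \<open>With r = sqrt s, r^(m+1) times the average is the integral of t^m g(t^2) over [0, r], so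
  the fundamental theorem and the quotient rule apply. The resulting identity 2 s A' + (m + 1) A = g
  for A = \<open>avg m g\<close> is both the radial Poisson equation for F' = A and the source of
  the gain of one derivative s d/ds.\<close>

lemma avg_deriv:
  assumes g: "continuous_on UNIV g" and s: "0 < s"
  shows "(avg m g has_real_derivative (g s - (real m + 1) * avg m g s) / 2 / s) (at s)"
proof -
  define M where "M r = integral {0..r} (\<lambda>t. t ^ m * g (t\<^sup>2))" for r
  have cont: "continuous_on A (\<lambda>t::real. t ^ m * g (t\<^sup>2))" for A
    using avg_integrand_continuous[OF g, of _ m 1] by simp
  have M: "M r = r ^ (m + 1) * avg m g (r\<^sup>2)" if r: "0 < r" for r
  proof -
    have "((\<lambda>t. t ^ m * g (t\<^sup>2)) has_integral M r) {0..r}"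
      unfolding M_def by (intro integrable_integral integrable_continuous_real cont)
    then have "((\<lambda>t. t ^ m * g (t\<^sup>2)) has_integral M r) (cbox 0 r)" by simp
    from has_integral_affinity[OF this, of r 0] r
    have "((\<lambda>x. (r * x) ^ m * g ((r * x)\<^sup>2)) has_integral M r / r) ((\<lambda>x. x / r) ` {0..r})"
      by (simp add: divide_inverse mult_ac)
    moreover have "(\<lambda>x. x / r) ` {0..r} = {0..1}"
      using r by (auto simp: image_iff intro!: bexI[of _ "x * r" for x] mult_right_le_one_le mult_left_le_one_le)
    ultimately have "integral {0..1} (\<lambda>x. (r * x) ^ m * g ((r * x)\<^sup>2)) = M r / r"
      by (simp add: integral_unique)
    moreover have "integral {0..1} (\<lambda>x. (r * x) ^ m * g ((r * x)\<^sup>2)) = r ^ m * avg m g (r\<^sup>2)"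
      unfolding avg_def by (subst integral_mult_right[symmetric]) (simp add: power_mult_distrib mult_ac)
    ultimately show ?thesis using r by (simp add: field_simps)
  qed
  have dM: "(M has_real_derivative r ^ m * g (r\<^sup>2)) (at r)" if r: "0 < r" for r
  proof -
    have "(M has_real_derivative r ^ m * g (r\<^sup>2)) (at r within {0..r+1})"
      unfolding M_def by (rule integral_has_real_derivative) (use r in \<open>auto intro: cont\<close>)
    moreover have "at r within {0..r+1} = at r"
      by (rule at_within_interior) (use r in auto)
    ultimately show ?thesis by simp
  qed
  have sq: "0 < sqrt s" using s by simp
  have dpow: "((\<lambda>s. sqrt s ^ (m+1)) has_real_derivative
      real (m+1) * sqrt s ^ m * (inverse (sqrt s) / 2)) (at s)"
    using DERIV_power_Suc[OF DERIV_real_sqrt[OF s], of m] by (simp add: mult_ac add_ac del: power_Suc)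
  have dMs: "((\<lambda>s. M (sqrt s)) has_real_derivative
      (sqrt s ^ m * g ((sqrt s)\<^sup>2)) * (inverse (sqrt s) / 2)) (at s)"
    by (rule DERIV_chain2[OF dM[OF sq] DERIV_real_sqrt[OF s]])
  have "((\<lambda>s. M (sqrt s) / sqrt s ^ (m+1)) has_real_derivative
      ((sqrt s ^ m * g ((sqrt s)\<^sup>2)) * (inverse (sqrt s) / 2) * sqrt s ^ (m+1)
        - M (sqrt s) * (real (m+1) * sqrt s ^ m * (inverse (sqrt s) / 2))) / (sqrt s ^ (m+1))\<^sup>2) (at s)"
    using DERIV_divide[OF dMs dpow] sq by (simp add: power2_eq_square del: power_Suc)
  also have "((sqrt s ^ m * g ((sqrt s)\<^sup>2)) * (inverse (sqrt s) / 2) * sqrt s ^ (m+1)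
        - M (sqrt s) * (real (m+1) * sqrt s ^ m * (inverse (sqrt s) / 2))) / (sqrt s ^ (m+1))\<^sup>2
       = (g s - (real m + 1) * avg m g s) / 2 / s"
  proof -
    define r where "r = sqrt s"
    have r: "0 < r" "s = r\<^sup>2" using s by (auto simp: r_def)
    have "r ^ m \<noteq> 0" using r by simp
    then show ?thesis unfolding r_def[symmetric] using r M[OF r(1)]
      by (simp add: power2_eq_square divide_simps) (simp add: algebra_simps)
  qed
  finally show ?thesis
    by (rule has_field_derivative_transform_within_open[where S = "{0<..}"]) (use s in \<open>auto simp: M\<close>)
qed

text \<open>Substituting \<tau> = t^2 s identifies this with the integral of \<open>g\<close> from 0
  to \<open>s\<close>. Written through \<open>avg\<close>, it makes sense with the right sign for
  negative \<open>s\<close> too, and linearity, scaling and dominated convergence are inherited from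
  \<open>avg\<close>.\<close>

definition antideriv :: "(real \<Rightarrow> real) \<Rightarrow> real \<Rightarrow> real" where
  "antideriv g s = 2 * s * avg 1 g s"

lemma antideriv_continuous [continuous_intros]:
  "continuous_on UNIV g \<Longrightarrow> continuous_on A (antideriv g)"
  unfolding antideriv_def[abs_def] by (intro continuous_intros)

lemma antideriv_0 [simp]: "antideriv g 0 = 0"
  by (simp add: antideriv_def)

text \<open>For s > 0 this is the product rule with the identity for the derivative of
  \<open>avg 1 g\<close>. At 0 the difference quotient is 2 \<open>avg 1 g h\<close> itself, which
  tends to \<open>g 0\<close> from both sides because \<open>g\<close> is continuous on the whole
  line.\<close>

lemma antideriv_deriv:
  assumes g: "continuous_on UNIV g" and s: "0 \<le> s"
  shows "(antideriv g has_real_derivative g s) (at s)"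
proof (cases "s = 0")
  case True
  have "(avg 1 g \<longlongrightarrow> avg 1 g 0) (at 0)"
    using avg_continuous[OF g, of UNIV 1] unfolding continuous_on_eq_continuous_at[OF open_UNIV] isCont_def by blast
  then have "((\<lambda>h. 2 * avg 1 g h) \<longlongrightarrow> 2 * avg 1 g 0) (at 0)"
    by (intro tendsto_intros)
  then have lim: "((\<lambda>h. 2 * avg 1 g h) \<longlongrightarrow> g 0) (at 0)" by simp
  have "((\<lambda>h. (antideriv g (0 + h) - antideriv g 0) / h) \<longlongrightarrow> g 0) (at 0)"
    by (rule Lim_transform_eventually[OF lim]) (auto simp: eventually_at_filter antideriv_def)
  then show ?thesis using True by (simp add: DERIV_def)
next
  case False
  then have s: "0 < s" using s by simp
  have "((\<lambda>s. 2 * s * avg 1 g s) has_real_derivative g s) (at s)"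
    using s by (auto intro!: derivative_eq_intros avg_deriv[OF g s] simp: field_simps)
  then show ?thesis by (simp add: antideriv_def[abs_def])
qed

text \<open>Fubini: both sides equal 2 s times the integral of t^(m+2) w g(t^2 w^2 s) over the unit
  square. Moving an average inside an integration raises its weight by 2.\<close>

lemma avg_antideriv:
  assumes g: "continuous_on UNIV g"
  shows "avg m (antideriv g) s = antideriv (avg (m + 2) g) s"
proof -
  have "integral (cbox 0 1) (\<lambda>t. integral (cbox 0 1) (\<lambda>w. t ^ m * (2 * (t\<^sup>2 * s) * (w * g (w\<^sup>2 * (t\<^sup>2 * s))))))
      = integral (cbox 0 1) (\<lambda>w. integral (cbox 0 1) (\<lambda>t. t ^ m * (2 * (t\<^sup>2 * s) * (w * g (w\<^sup>2 * (t\<^sup>2 * s))))))"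
    by (rule integral_swap_continuous)
       (auto simp: case_prod_beta intro!: continuous_intros continuous_on_compose2[OF g])
  then have "avg m (antideriv g) s
      = integral {0..1} (\<lambda>w. integral {0..1} (\<lambda>t. t ^ m * (2 * (t\<^sup>2 * s) * (w * g (w\<^sup>2 * (t\<^sup>2 * s))))))"
    by (simp add: avg_def antideriv_def mult.assoc)
  also have "\<dots> = integral {0..1} (\<lambda>w. 2 * s * (w * integral {0..1} (\<lambda>t. t ^ (m + 2) * g (t\<^sup>2 * (w\<^sup>2 * s)))))"
    by (intro integral_cong) (simp add: integral_mult_right[symmetric] power_add power2_eq_square mult_ac del: integral_mult_right)
  also have "\<dots> = antideriv (avg (m + 2) g) s"
    by (simp add: avg_def antideriv_def mult.assoc)
  finally show ?thesis .
qed

lemma antideriv_cong: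
  assumes "0 \<le> s" "\<And>r. r \<in> {0..s} \<Longrightarrow> f r = g r"
  shows "antideriv f s = antideriv g s"
  unfolding antideriv_def using avg_cong[OF assms] by simp

lemma antideriv_add:
  assumes "continuous_on UNIV f" "continuous_on UNIV g"
  shows "antideriv (\<lambda>s. f s + g s) s = antideriv f s + antideriv g s"
  unfolding antideriv_def by (simp add: avg_add[OF assms] algebra_simps)

lemma antideriv_cmult: "antideriv (\<lambda>s. c * f s) s = c * antideriv f s"
  unfolding antideriv_def by (simp add: avg_cmult)

lemma antideriv_scale:
  assumes "c \<noteq> 0"
  shows "antideriv (\<lambda>s. g (s / c)) s = c * antideriv g (s / c)"
  unfolding antideriv_def using assms by (simp add: avg_scale)

lemma antideriv_lipschitz:
  assumes "continuous_on UNIV g" "\<And>r. r \<in> {0..\<rho>} \<Longrightarrow> \<bar>g r\<bar> \<le> C" "r \<in> {0..\<rho>}" "s \<in> {0..\<rho>}"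
  shows "\<bar>antideriv g r - antideriv g s\<bar> \<le> C * \<bar>r - s\<bar>"
  using field_differentiable_bound[of "{0..\<rho>}" "antideriv g" g C s r] assms
  by (auto intro: has_field_derivative_at_within antideriv_deriv simp: abs_minus_commute)

lemma antideriv_mono:
  assumes "continuous_on UNIV g" "\<And>r. r \<in> {0..b} \<Longrightarrow> 0 \<le> g r" "0 \<le> r" "r \<le> s" "s \<le> b"
  shows "antideriv g r \<le> antideriv g s"
proof (rule DERIV_nonneg_imp_nondecreasing[OF \<open>r \<le> s\<close>])
  fix x assume "r \<le> x" "x \<le> s"
  then show "\<exists>y. (antideriv g has_real_derivative y) (at x) \<and> 0 \<le> y"
    using assms by (intro exI[of _ "g x"] conjI antideriv_deriv) auto
qed

lemma antideriv_strict_mono: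
  assumes "continuous_on UNIV g" "\<And>r. r \<in> {0..<b} \<Longrightarrow> 0 < g r" "0 \<le> s" "s < b"
  shows "antideriv g s < antideriv g b"
proof (rule DERIV_pos_imp_increasing_open[OF \<open>s < b\<close>])
  fix x assume "s < x" "x < b"
  then show "\<exists>y. (antideriv g has_real_derivative y) (at x) \<and> 0 < y"
    using assms by (intro exI[of _ "g x"] conjI antideriv_deriv) auto
qed (intro continuous_intros assms)

lemma antideriv_convergence:
  assumes "\<And>n. continuous_on UNIV (f n)" "0 \<le> s"
    and "\<And>n r. r \<in> {0..s} \<Longrightarrow> \<bar>f n r\<bar> \<le> C"
    and "\<And>r. r \<in> {0..s} \<Longrightarrow> (\<lambda>n. f n r) \<longlonglongrightarrow> g r"
  shows "(\<lambda>n. antideriv (f n) s) \<longlonglongrightarrow> antideriv g s"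
  unfolding antideriv_def by (intro tendsto_intros avg_convergence[OF assms])

lemma antideriv_monomial: "antideriv (\<lambda>s. c * s ^ k) s = c / (real k + 1) * s ^ Suc k"
proof -
  have "(2::real) + 2 * real k = 2 * (1 + real k)" by simp
  then show ?thesis unfolding antideriv_def by (simp add: avg_monomial add_ac del: distrib_left_numeral)
qed

lemma antideriv_polynomial:
  "\<exists>c'. \<forall>s. antideriv (\<lambda>s. \<Sum>i<k. c i * s ^ i) s = (\<Sum>i<Suc k. c' i * s ^ i)"
proof (induction k)
  case 0
  show ?case by (rule exI[of _ "\<lambda>_. 0"]) (simp add: antideriv_def)
next
  case (Suc k)
  then obtain c' where c': "\<And>s. antideriv (\<lambda>s. \<Sum>i<k. c i * s ^ i) s = (\<Sum>i<Suc k. c' i * s ^ i)"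
    by blast
  show ?case
  proof (intro exI[of _ "c'(Suc k := c k / (real k + 1))"] allI)
    fix s
    have "antideriv (\<lambda>s. \<Sum>i<Suc k. c i * s ^ i) s
        = antideriv (\<lambda>s. \<Sum>i<k. c i * s ^ i) s + antideriv (\<lambda>s. c k * s ^ k) s"
      by (subst antideriv_add[symmetric]) (auto intro!: continuous_intros)
    also have "\<dots> = (\<Sum>i<Suc k. (c'(Suc k := c k / (real k + 1))) i * s ^ i) + c k / (real k + 1) * s ^ Suc k"
      unfolding c' antideriv_monomial by simp
    finally show "antideriv (\<lambda>s. \<Sum>i<Suc k. c i * s ^ i) s
        = (\<Sum>i<Suc (Suc k). (c'(Suc k := c k / (real k + 1))) i * s ^ i)"
      by (simp only: sum.lessThan_Suc[of _ "Suc k"] fun_upd_same)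
  qed
qed

text \<open>
  A radial function on \<open>\<real>\<^sup>d\<^sup>+\<^sup>1\<close> is written \<open>F (|x|\<^sup>2 / 2)\<close>; its Laplacian is \<open>(d + 1) F' + 2 s F''\<close>
  at \<open>s = |x|\<^sup>2 / 2\<close>.
\<close>

definition inv_lap :: "nat \<Rightarrow> (real \<Rightarrow> real) \<Rightarrow> real \<Rightarrow> real" where
  "inv_lap d g s = - antideriv (avg d g) s"

lemma inv_lap_continuous [continuous_intros]:
  "continuous_on UNIV g \<Longrightarrow> continuous_on A (inv_lap d g)"
  unfolding inv_lap_def[abs_def] by (intro continuous_intros)

lemma inv_lap_pow_continuous [continuous_intros]:
  assumes "continuous_on UNIV g"
  shows "continuous_on A ((inv_lap d ^^ k) g)"
proof -
  have "continuous_on UNIV ((inv_lap d ^^ k) g)"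
    by (induction k) (use assms in \<open>auto intro: continuous_intros\<close>)
  then show ?thesis by (rule continuous_on_subset) simp
qed

lemma inv_lap_cong:
  assumes "0 \<le> s" "\<And>r. r \<in> {0..s} \<Longrightarrow> f r = g r"
  shows "inv_lap d f s = inv_lap d g s"
proof -
  have "antideriv (avg d f) s = antideriv (avg d g) s"
    using assms by (intro antideriv_cong avg_cong) auto
  then show ?thesis by (simp add: inv_lap_def)
qed

lemma inv_lap_pow_cong:
  assumes "0 \<le> s" "\<And>r. r \<in> {0..s} \<Longrightarrow> f r = g r"
  shows "(inv_lap d ^^ k) f s = (inv_lap d ^^ k) g s"
proof -
  have "\<forall>r\<in>{0..s}. (inv_lap d ^^ k) f r = (inv_lap d ^^ k) g r"
    by (induction k) (use assms in \<open>auto intro!: inv_lap_cong\<close>)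
  then show ?thesis using assms(1) by auto
qed

lemma inv_lap_cmult: "inv_lap d (\<lambda>s. c * f s) = (\<lambda>s. c * inv_lap d f s)"
  by (simp add: fun_eq_iff inv_lap_def avg_cmult[abs_def] antideriv_cmult)

lemma inv_lap_pow_cmult: "(inv_lap d ^^ k) (\<lambda>s. c * f s) = (\<lambda>s. c * (inv_lap d ^^ k) f s)"
  by (induction k) (simp_all add: inv_lap_cmult)

lemma inv_lap_scale: "c \<noteq> 0 \<Longrightarrow> inv_lap d (\<lambda>s. g (s / c)) = (\<lambda>s. c * inv_lap d g (s / c))"
  by (simp add: fun_eq_iff inv_lap_def avg_scale[abs_def] antideriv_scale)

lemma inv_lap_pow_scale:
  "c \<noteq> 0 \<Longrightarrow> (inv_lap d ^^ k) (\<lambda>s. g (s / c)) = (\<lambda>s. c ^ k * (inv_lap d ^^ k) g (s / c))"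
proof (induction k)
  case (Suc k)
  have "inv_lap d (\<lambda>s. c ^ k * (inv_lap d ^^ k) g (s / c))
      = (\<lambda>s. c ^ k * inv_lap d (\<lambda>s. (inv_lap d ^^ k) g (s / c)) s)"
    by (rule inv_lap_cmult)
  then show ?case using Suc inv_lap_scale[OF Suc.prems, of d "(inv_lap d ^^ k) g"] by (simp add: mult_ac)
qed auto

lemma inv_lap_lipschitz:
  assumes "continuous_on UNIV g" "\<And>r. r \<in> {0..\<rho>} \<Longrightarrow> \<bar>g r\<bar> \<le> C" "r \<in> {0..\<rho>}" "s \<in> {0..\<rho>}"
  shows "\<bar>inv_lap d g r - inv_lap d g s\<bar> \<le> C * \<bar>r - s\<bar>"
proof -
  have "\<bar>antideriv (avg d g) r - antideriv (avg d g) s\<bar> \<le> C * \<bar>r - s\<bar>"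
    using assms by (intro antideriv_lipschitz[where \<rho> = \<rho>] avg_abs_le continuous_intros) auto
  then show ?thesis by (simp add: inv_lap_def)
qed

lemma inv_lap_0 [simp]: "inv_lap d g 0 = 0"
  by (simp add: inv_lap_def)

lemma inv_lap_abs_le:
  assumes "continuous_on UNIV g" "\<And>r. r \<in> {0..\<rho>} \<Longrightarrow> \<bar>g r\<bar> \<le> C" "r \<in> {0..\<rho>}"
  shows "\<bar>inv_lap d g r\<bar> \<le> C * \<rho>"
proof -
  have "\<bar>inv_lap d g r\<bar> \<le> C * \<bar>r\<bar>" using inv_lap_lipschitz[OF assms(1,2), of \<rho> r 0] assms(3) by simp
  also have "\<dots> \<le> C * \<rho>" using assms(2)[OF assms(3)] assms(3) by (intro mult_left_mono) auto
  finally show ?thesis .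
qed

lemma inv_lap_pow_abs_le:
  assumes "continuous_on UNIV g" "\<And>r. r \<in> {0..\<rho>} \<Longrightarrow> \<bar>g r\<bar> \<le> C" "r \<in> {0..\<rho>}"
  shows "\<bar>(inv_lap d ^^ k) g r\<bar> \<le> C * \<rho> ^ k"
  using assms(3)
proof (induction k arbitrary: r)
  case (Suc k)
  show ?case
    using inv_lap_abs_le[OF inv_lap_pow_continuous[OF assms(1)] Suc.IH Suc.prems] by (simp add: mult_ac)
qed (use assms in auto)

lemma inv_lap_pow_lipschitz:
  assumes "continuous_on UNIV g" "\<And>r. r \<in> {0..\<rho>} \<Longrightarrow> \<bar>g r\<bar> \<le> C" "r \<in> {0..\<rho>}" "s \<in> {0..\<rho>}"
  shows "\<bar>(inv_lap d ^^ Suc k) g r - (inv_lap d ^^ Suc k) g s\<bar> \<le> C * \<rho> ^ k * \<bar>r - s\<bar>"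
  using inv_lap_lipschitz[OF inv_lap_pow_continuous[OF assms(1)]
      inv_lap_pow_abs_le[OF assms(1,2)] assms(3,4)] by simp

lemma inv_lap_convergence:
  assumes f: "\<And>n. continuous_on UNIV (f n)" and "0 \<le> s"
    and bd: "\<And>n r. r \<in> {0..s} \<Longrightarrow> \<bar>f n r\<bar> \<le> C"
    and lim: "\<And>r. r \<in> {0..s} \<Longrightarrow> (\<lambda>n. f n r) \<longlonglongrightarrow> g r"
  shows "(\<lambda>n. inv_lap d (f n) s) \<longlonglongrightarrow> inv_lap d g s"
  unfolding inv_lap_def
proof (intro tendsto_minus antideriv_convergence[where C = C])
  fix r assume "r \<in> {0..s}"
  then show "\<bar>avg d (f n) r\<bar> \<le> C" "(\<lambda>n. avg d (f n) r) \<longlonglongrightarrow> avg d g r" for n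
    using bd lim by (auto intro!: avg_abs_le avg_convergence[where C = C] f)
qed (use f \<open>0 \<le> s\<close> in \<open>auto intro: continuous_intros\<close>)

lemma inv_lap_pow_convergence:
  assumes f: "\<And>n. continuous_on UNIV (f n)"
    and bd: "\<And>n r. r \<in> {0..\<rho>} \<Longrightarrow> \<bar>f n r\<bar> \<le> C"
    and lim: "\<And>r. r \<in> {0..\<rho>} \<Longrightarrow> (\<lambda>n. f n r) \<longlonglongrightarrow> g r"
    and s: "s \<in> {0..\<rho>}"
  shows "(\<lambda>n. (inv_lap d ^^ k) (f n) s) \<longlonglongrightarrow> (inv_lap d ^^ k) g s"
  using s
proof (induction k arbitrary: s)
  case (Suc k)
  have "(\<lambda>n. inv_lap d ((inv_lap d ^^ k) (f n)) s) \<longlonglongrightarrow> inv_lap d ((inv_lap d ^^ k) g) s"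
  proof (rule inv_lap_convergence[where C = "C * \<rho> ^ k"])
    fix n r assume "r \<in> {0..s}"
    then have r: "r \<in> {0..\<rho>}" using Suc.prems by auto
    show "\<bar>(inv_lap d ^^ k) (f n) r\<bar> \<le> C * \<rho> ^ k" by (rule inv_lap_pow_abs_le[OF f bd r])
    show "(\<lambda>n. (inv_lap d ^^ k) (f n) r) \<longlonglongrightarrow> (inv_lap d ^^ k) g r" by (rule Suc.IH[OF r])
  qed (use f Suc.prems in \<open>auto intro: continuous_intros\<close>)
  then show ?case by simp
qed (use lim in auto)

text \<open>Each application multiplies by a nonzero number and raises the power by one. Since c is
  nonzero, the result is not a polynomial of degree below \<open>k\<close>; this is what will
  exclude the right-hand side 1 for the zero function.\<close>

lemma inv_lap_pow_one:
  obtains c where "c \<noteq> 0" "(inv_lap d ^^ k) (\<lambda>_. 1) = (\<lambda>s. c * s ^ k)"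
proof -
  have "\<exists>c. c \<noteq> 0 \<and> (inv_lap d ^^ k) (\<lambda>_. 1) = (\<lambda>s. c * s ^ k)"
  proof (induction k)
    case 0
    then show ?case by (auto intro: exI[of _ 1])
  next
    case (Suc k)
    then obtain c where c: "c \<noteq> 0" "(inv_lap d ^^ k) (\<lambda>_. 1) = (\<lambda>s. c * s ^ k)" by auto
    have "inv_lap d (\<lambda>s. c * s ^ k) s = - (c / (real d + 2 * real k + 1) / (real k + 1)) * s ^ Suc k" for s
      unfolding inv_lap_def avg_monomial[abs_def] antideriv_monomial by simp
    moreover have "- (c / (real d + 2 * real k + 1) / (real k + 1)) \<noteq> 0"
    proof -
      have "real d + 2 * real k + 1 \<noteq> 0" "real k + 1 \<noteq> 0" by (auto simp: add_nonneg_eq_0_iff)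
      then show ?thesis using c(1) by simp
    qed
    ultimately show ?case
      by (intro exI[of _ "- (c / (real d + 2 * real k + 1) / (real k + 1))"]) (simp add: c(2) fun_eq_iff)
  qed
  then show ?thesis using that by blast
qed

section \<open>Averages gathered inside the integrations\<close>

primrec avg_iter :: "nat \<Rightarrow> nat \<Rightarrow> (real \<Rightarrow> real) \<Rightarrow> real \<Rightarrow> real" where
  "avg_iter d 0 f = f"
| "avg_iter d (Suc k) f = avg (d + 2 * k) (avg_iter d k f)"

lemma avg_iter_continuous [continuous_intros]:
  assumes "continuous_on UNIV f"
  shows "continuous_on A (avg_iter d k f)"
proof -
  have "continuous_on UNIV (avg_iter d k f)"
    by (induction k) (use assms in \<open>auto intro: continuous_intros\<close>)
  then show ?thesis by (rule continuous_on_subset) simp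
qed

lemma antideriv_pow_continuous [continuous_intros]:
  assumes "continuous_on UNIV f"
  shows "continuous_on A ((antideriv ^^ k) f)"
proof -
  have "continuous_on UNIV ((antideriv ^^ k) f)"
    by (induction k) (use assms in \<open>auto intro: continuous_intros\<close>)
  then show ?thesis by (rule continuous_on_subset) simp
qed

lemma avg_antideriv_pow:
  assumes "continuous_on UNIV g"
  shows "avg m ((antideriv ^^ k) g) = (antideriv ^^ k) (avg (m + 2 * k) g)"
proof (induction k arbitrary: m)
  case (Suc k)
  have "avg m ((antideriv ^^ Suc k) g) = antideriv (avg (m + 2) ((antideriv ^^ k) g))"
    using avg_antideriv[OF antideriv_pow_continuous[OF assms]] by (simp add: fun_eq_iff)
  also have "\<dots> = (antideriv ^^ Suc k) (avg (m + 2 * Suc k) g)"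
    by (simp add: Suc)
  finally show ?case .
qed simp

text \<open>One more \<open>inv_lap d\<close> places \<open>avg d\<close> outside \<open>k\<close>
  integrations; moved inside, it acquires the weight d + 2 k, which explains the recursion of
  \<open>avg_iter\<close>. After this the number of integrations and the averaged function can be
  treated separately, so the integrations can be started at another point.\<close>

lemma inv_lap_pow_eq:
  assumes "continuous_on UNIV f"
  shows "(inv_lap d ^^ k) f = (\<lambda>s. (-1) ^ k * (antideriv ^^ k) (avg_iter d k f) s)"
proof (induction k)
  case (Suc k)
  have "(inv_lap d ^^ Suc k) f = inv_lap d (\<lambda>s. (-1) ^ k * (antideriv ^^ k) (avg_iter d k f) s)"
    by (simp add: Suc)
  also have "\<dots> = (\<lambda>s. - ((-1) ^ k * antideriv (avg d ((antideriv ^^ k) (avg_iter d k f))) s))"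
    unfolding inv_lap_cmult by (simp add: inv_lap_def fun_eq_iff)
  also have "avg d ((antideriv ^^ k) (avg_iter d k f)) = (antideriv ^^ k) (avg_iter d (Suc k) f)"
    by (simp add: avg_antideriv_pow avg_iter_continuous assms)
  finally show ?case by (simp add: fun_eq_iff)
qed simp

lemma avg_iter_nonneg:
  assumes f: "continuous_on UNIV f" and nn: "\<And>r. r \<in> {0..b} \<Longrightarrow> 0 \<le> f r" and s: "s \<in> {0..b}"
  shows "0 \<le> avg_iter d k f s"
  using s
proof (induction k arbitrary: s)
  case (Suc k)
  have "avg (d + 2 * k) (\<lambda>_. 0) s \<le> avg (d + 2 * k) (avg_iter d k f) s"
    using Suc by (intro avg_mono) (auto intro!: continuous_intros f)
  then show ?case by simp
qed (use nn in auto)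

lemma avg_iter_pos:
  assumes f: "continuous_on UNIV f" and c: "0 < c" and le: "\<And>r. r \<in> {0..b} \<Longrightarrow> c \<le> f r" and s: "s \<in> {0..b}"
  shows "0 < avg_iter d k f s"
proof -
  have "\<exists>c>0. \<forall>r\<in>{0..b}. c \<le> avg_iter d k f r"
  proof (induction k)
    case 0
    then show ?case using c le by auto
  next
    case (Suc k)
    then obtain c where c: "c > 0" "\<forall>r\<in>{0..b}. c \<le> avg_iter d k f r" by auto
    have "c / (real (d + 2 * k) + 1) \<le> avg_iter d (Suc k) f r" if "r \<in> {0..b}" for r
    proof -
      have "avg (d + 2 * k) (\<lambda>_. c) r \<le> avg (d + 2 * k) (avg_iter d k f) r"
        using c that by (intro avg_mono) (auto intro!: continuous_intros f)
      then show ?thesis by simp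
    qed
    moreover have "c / (real (d + 2 * k) + 1) > 0" using c by (auto intro!: divide_pos_pos add_nonneg_pos)
    ultimately show ?case by blast
  qed
  then show ?thesis using s by force
qed

lemma avg_iter_abs_le:
  assumes f: "continuous_on UNIV f" and le: "\<And>r. r \<in> {0..b} \<Longrightarrow> \<bar>f r\<bar> \<le> C" and s: "s \<in> {0..b}"
  shows "\<bar>avg_iter d k f s\<bar> \<le> C"
  using s
proof (induction k arbitrary: s)
  case (Suc k)
  then show ?case by (auto intro!: avg_abs_le continuous_intros f)
qed (use le in auto)

lemma avg_iter_convergence:
  assumes f: "\<And>n. continuous_on UNIV (f n)"
    and bd: "\<And>n r. r \<in> {0..b} \<Longrightarrow> \<bar>f n r\<bar> \<le> C"
    and lim: "\<And>r. r \<in> {0..b} \<Longrightarrow> (\<lambda>n. f n r) \<longlonglongrightarrow> g r"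
    and s: "s \<in> {0..b}"
  shows "(\<lambda>n. avg_iter d k (f n) s) \<longlonglongrightarrow> avg_iter d k g s"
  using s
proof (induction k arbitrary: s)
  case (Suc k)
  have "(\<lambda>n. avg (d + 2 * k) (avg_iter d k (f n)) s) \<longlonglongrightarrow> avg (d + 2 * k) (avg_iter d k g) s"
  proof (rule avg_convergence[where C = C])
    fix n r assume "r \<in> {0..s}"
    then have r: "r \<in> {0..b}" using Suc.prems by auto
    show "\<bar>avg_iter d k (f n) r\<bar> \<le> C" by (rule avg_iter_abs_le[OF f bd r])
    show "(\<lambda>n. avg_iter d k (f n) r) \<longlonglongrightarrow> avg_iter d k g r" by (rule Suc.IH[OF r])
  qed (use f Suc.prems in \<open>auto intro: continuous_intros\<close>)
  then show ?case by simp
qed (use lim in auto)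

lemma avg_iter_cmult: "avg_iter d k (\<lambda>s. c * f s) = (\<lambda>s. c * avg_iter d k f s)"
  by (induction k) (simp_all add: avg_cmult[abs_def])

section \<open>The polyharmonic Dirichlet problem on a ball\<close>

definition backint :: "real \<Rightarrow> (real \<Rightarrow> real) \<Rightarrow> real \<Rightarrow> real" where
  "backint b g s = antideriv g b - antideriv g s"

lemma backint_continuous [continuous_intros]:
  "continuous_on UNIV g \<Longrightarrow> continuous_on A (backint b g)"
  unfolding backint_def[abs_def] by (intro continuous_intros)

lemma backint_end [simp]: "backint b g b = 0"
  by (simp add: backint_def)

lemma backint_deriv:
  "continuous_on UNIV g \<Longrightarrow> 0 \<le> s \<Longrightarrow> (backint b g has_real_derivative - g s) (at s)"
  unfolding backint_def[abs_def] by (auto intro!: derivative_eq_intros antideriv_deriv)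

lemma backint_pow_continuous [continuous_intros]:
  assumes "continuous_on UNIV f"
  shows "continuous_on A ((backint b ^^ k) f)"
proof -
  have "continuous_on UNIV ((backint b ^^ k) f)"
    by (induction k) (use assms in \<open>auto intro: continuous_intros\<close>)
  then show ?thesis by (rule continuous_on_subset) simp
qed

text \<open>A backward integration is a constant minus a forward one, and a forward integral raises
  the degree of a polynomial by at most one. Polynomials of degree below \<open>k\<close> in s are
  k-harmonic, so going from forward to backward integrals preserves the equation and changes only
  the boundary data.\<close>

lemma backint_pow_eq:
  assumes "continuous_on UNIV g"
  shows "\<exists>c. \<forall>s. (backint b ^^ k) g s = (\<Sum>i<k. c i * s ^ i) + (-1) ^ k * (antideriv ^^ k) g s"
proof (induction k)
  case (Suc k)
  then obtain c where c: "(backint b ^^ k) g = (\<lambda>s. (\<Sum>i<k. c i * s ^ i) + (-1) ^ k * (antideriv ^^ k) g s)"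
    by auto
  obtain c' where c': "\<And>s. antideriv (\<lambda>s. \<Sum>i<k. c i * s ^ i) s = (\<Sum>i<Suc k. c' i * s ^ i)"
    using antideriv_polynomial by blast
  have "antideriv ((backint b ^^ k) g) s = (\<Sum>i<Suc k. c' i * s ^ i) + (-1) ^ k * (antideriv ^^ Suc k) g s" for s
    unfolding c by (subst antideriv_add) (auto intro!: continuous_intros assms simp: c' antideriv_cmult simp del: sum.lessThan_Suc)
  then have eq: "(backint b ^^ Suc k) g s = antideriv ((backint b ^^ k) g) b - (\<Sum>i<Suc k. c' i * s ^ i)
      + (-1) ^ Suc k * (antideriv ^^ Suc k) g s" for s
    by (simp add: backint_def del: sum.lessThan_Suc)
  \<comment> \<open>The integral up to \<open>b\<close> is a constant of integration; it joins the
    coefficient of s^0.\<close>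
  define K where "K = antideriv ((backint b ^^ k) g) b"
  show ?case
  proof (intro exI[of _ "\<lambda>i. (if i = 0 then K else 0) - c' i"] allI)
    fix s
    have "(\<Sum>i<Suc k. (if i = 0 then K else 0) * s ^ i) = K"
      by (subst sum.lessThan_Suc_shift) simp
    then show "(backint b ^^ Suc k) g s = (\<Sum>i<Suc k. ((if i = 0 then K else 0) - c' i) * s ^ i)
      + (-1) ^ Suc k * (antideriv ^^ Suc k) g s"
      unfolding eq K_def[symmetric] left_diff_distrib sum_subtractf by simp
  qed
qed auto

lemma backint_pow_nonneg:
  assumes g: "continuous_on UNIV g" and nn: "\<And>r. r \<in> {0..b} \<Longrightarrow> 0 \<le> g r" and s: "s \<in> {0..b}"
  shows "0 \<le> (backint b ^^ k) g s"
  using s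
proof (induction k arbitrary: s)
  case (Suc k)
  have "antideriv ((backint b ^^ k) g) s \<le> antideriv ((backint b ^^ k) g) b"
    using Suc by (intro antideriv_mono[where b = b]) (auto intro!: continuous_intros g)
  then show ?case by (simp add: backint_def[of b "(backint b ^^ k) g"])
qed (use nn in auto)

lemma backint_pow_antimono:
  assumes g: "continuous_on UNIV g" and nn: "\<And>r. r \<in> {0..b} \<Longrightarrow> 0 \<le> g r"
    and k: "1 \<le> k" and s: "0 \<le> r" "r \<le> s" "s \<le> b"
  shows "(backint b ^^ k) g s \<le> (backint b ^^ k) g r"
proof -
  obtain j where k: "k = Suc j" using k by (cases k) auto
  have "antideriv ((backint b ^^ j) g) r \<le> antideriv ((backint b ^^ j) g) s"
    using s by (intro antideriv_mono[where b = b] backint_pow_nonneg) (auto intro!: continuous_intros g nn)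
  then show ?thesis by (simp add: backint_def[of b "(backint b ^^ j) g"] k)
qed

lemma backint_pow_pos:
  assumes g: "continuous_on UNIV g" and pos: "\<And>r. r \<in> {0..b} \<Longrightarrow> 0 < g r" and s: "s \<in> {0..<b}"
  shows "0 < (backint b ^^ k) g s"
  using s
proof (induction k arbitrary: s)
  case (Suc k)
  have "antideriv ((backint b ^^ k) g) s < antideriv ((backint b ^^ k) g) b"
    using Suc by (intro antideriv_strict_mono[where b = b]) (auto intro!: continuous_intros g)
  then show ?case by (simp add: backint_def[of b "(backint b ^^ k) g"])
qed (use pos in auto)

lemma backint_lipschitz:
  assumes "continuous_on UNIV g" "\<And>r. r \<in> {0..b} \<Longrightarrow> \<bar>g r\<bar> \<le> C" "r \<in> {0..b}" "s \<in> {0..b}"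
  shows "\<bar>backint b g r - backint b g s\<bar> \<le> C * \<bar>r - s\<bar>"
  using antideriv_lipschitz[OF assms(1,2,4,3)] by (simp add: backint_def abs_minus_commute)

lemma backint_pow_abs_le:
  assumes g: "continuous_on UNIV g" and le: "\<And>r. r \<in> {0..b} \<Longrightarrow> \<bar>g r\<bar> \<le> C" and s: "s \<in> {0..b}"
  shows "\<bar>(backint b ^^ k) g s\<bar> \<le> C * b ^ k"
  using s
proof (induction k arbitrary: s)
  case (Suc k)
  have nn: "0 \<le> C * b ^ k" using Suc.IH[OF Suc.prems] by simp
  have "\<bar>(backint b ^^ Suc k) g s - (backint b ^^ Suc k) g b\<bar> \<le> C * b ^ k * \<bar>s - b\<bar>"
    using Suc backint_lipschitz[of "(backint b ^^ k) g" b "C * b ^ k" s b]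
    by (auto intro: continuous_intros g)
  also have "\<dots> \<le> C * b ^ k * b" using Suc.prems nn by (intro mult_left_mono) auto
  finally show ?case by (simp add: mult_ac)
qed (use le in auto)

lemma backint_pow_convergence:
  assumes f: "\<And>n. continuous_on UNIV (f n)"
    and bd: "\<And>n r. r \<in> {0..b} \<Longrightarrow> \<bar>f n r\<bar> \<le> C"
    and lim: "\<And>r. r \<in> {0..b} \<Longrightarrow> (\<lambda>n. f n r) \<longlonglongrightarrow> g r"
    and s: "s \<in> {0..b}"
  shows "(\<lambda>n. (backint b ^^ k) (f n) s) \<longlonglongrightarrow> (backint b ^^ k) g s"
  using s
proof (induction k arbitrary: s)
  case (Suc k)
  have "(\<lambda>n. antideriv ((backint b ^^ k) (f n)) s') \<longlonglongrightarrow> antideriv ((backint b ^^ k) g) s'"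
    if s': "s' \<in> {0..b}" for s'
  proof (rule antideriv_convergence[where C = "C * b ^ k"])
    fix n r assume "r \<in> {0..s'}"
    then have r: "r \<in> {0..b}" using s' by auto
    show "\<bar>(backint b ^^ k) (f n) r\<bar> \<le> C * b ^ k" by (rule backint_pow_abs_le[OF f bd r])
    show "(\<lambda>n. (backint b ^^ k) (f n) r) \<longlonglongrightarrow> (backint b ^^ k) g r" by (rule Suc.IH[OF r])
  qed (use f s' in \<open>auto intro: continuous_intros\<close>)
  then show ?case using Suc.prems by (auto simp: backint_def[of b "(backint b ^^ k) h" for h] intro!: tendsto_intros)
qed (use lim in auto)

lemma backint_cmult: "backint b (\<lambda>s. c * f s) = (\<lambda>s. c * backint b f s)"
  by (simp add: fun_eq_iff backint_def antideriv_cmult right_diff_distrib)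

lemma backint_pow_cmult: "(backint b ^^ k) (\<lambda>s. c * f s) = (\<lambda>s. c * (backint b ^^ k) f s)"
  by (induction k) (simp_all add: backint_cmult)

text \<open>
  The radial solution of \<open>(- \<Delta>)\<^sup>k F = f\<close> vanishing to order \<open>k\<close> at \<open>s = b\<close>.  Its \<open>k\<close>-th derivative in \<open>s\<close> is
  \<open>(-1)\<^sup>k avg_iter d k f\<close>, like that of every other radial solution.
\<close>

definition green :: "nat \<Rightarrow> real \<Rightarrow> nat \<Rightarrow> (real \<Rightarrow> real) \<Rightarrow> real \<Rightarrow> real" where
  "green d b k f = (backint b ^^ k) (avg_iter d k f)"

lemma green_continuous [continuous_intros]:
  "continuous_on UNIV f \<Longrightarrow> continuous_on A (green d b k f)"
  unfolding green_def by (intro continuous_intros)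

lemma green_eq:
  assumes "continuous_on UNIV f"
  shows "\<exists>c. \<forall>s. green d b k f s = (\<Sum>i<k. c i * s ^ i) + (inv_lap d ^^ k) f s"
  using backint_pow_eq[OF avg_iter_continuous[OF assms]] inv_lap_pow_eq[OF assms]
  by (simp add: green_def)

lemma green_nonneg:
  assumes f: "continuous_on UNIV f" and nn: "\<And>r. r \<in> {0..b} \<Longrightarrow> 0 \<le> f r" and s: "s \<in> {0..b}"
  shows "0 \<le> green d b k f s"
  unfolding green_def
  by (rule backint_pow_nonneg[OF avg_iter_continuous[OF f] avg_iter_nonneg[OF f nn] s])

text \<open>For \<open>k\<close> \<ge> 1 the outermost operation is the integral from
  \<open>s\<close> to \<open>b\<close> of a nonnegative function. This puts the maximum at the
  centre, so that dividing by the central value gives a function with values in [0, 1].\<close>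

lemma green_antimono:
  assumes f: "continuous_on UNIV f" and nn: "\<And>r. r \<in> {0..b} \<Longrightarrow> 0 \<le> f r"
    and rs: "1 \<le> k" "0 \<le> r" "r \<le> s" "s \<le> b"
  shows "green d b k f s \<le> green d b k f r"
  unfolding green_def
  by (rule backint_pow_antimono[OF avg_iter_continuous[OF f] avg_iter_nonneg[OF f nn] rs])

text \<open>Averages keep a positive lower bound up to a factor, and backward integrals of positive
  functions are positive before \<open>b\<close>. Applied to the constant 1, this yields the number
  that bounds the normalising denominators from below.\<close>

lemma green_pos:
  assumes f: "continuous_on UNIV f" and c: "0 < c" "\<And>r. r \<in> {0..b} \<Longrightarrow> c \<le> f r" and s: "s \<in> {0..<b}"
  shows "0 < green d b k f s"
  unfolding green_def
  by (rule backint_pow_pos[OF avg_iter_continuous[OF f] avg_iter_pos[OF f c] s])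

lemma green_abs_le:
  assumes f: "continuous_on UNIV f" and le: "\<And>r. r \<in> {0..b} \<Longrightarrow> \<bar>f r\<bar> \<le> C" and s: "s \<in> {0..b}"
  shows "\<bar>green d b k f s\<bar> \<le> C * b ^ k"
  unfolding green_def
  by (rule backint_pow_abs_le[OF avg_iter_continuous[OF f] avg_iter_abs_le[OF f le] s])

lemma green_lipschitz:
  assumes f: "continuous_on UNIV f" and le: "\<And>r. r \<in> {0..b} \<Longrightarrow> \<bar>f r\<bar> \<le> C"
    and rs: "r \<in> {0..b}" "s \<in> {0..b}"
  shows "\<bar>green d b (Suc k) f r - green d b (Suc k) f s\<bar> \<le> C * b ^ k * \<bar>r - s\<bar>"
  unfolding green_def funpow.simps o_def
  by (rule backint_lipschitz[OF backint_pow_continuous[OF avg_iter_continuous[OF f]]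
        backint_pow_abs_le[OF avg_iter_continuous[OF f] avg_iter_abs_le[OF f le]] rs])

lemma green_convergence:
  assumes f: "\<And>n. continuous_on UNIV (f n)" and le: "\<And>n r. r \<in> {0..b} \<Longrightarrow> \<bar>f n r\<bar> \<le> C"
    and lim: "\<And>r. r \<in> {0..b} \<Longrightarrow> (\<lambda>n. f n r) \<longlonglongrightarrow> g r" and s: "s \<in> {0..b}"
  shows "(\<lambda>n. green d b k (f n) s) \<longlonglongrightarrow> green d b k g s"
  unfolding green_def
  by (rule backint_pow_convergence[OF avg_iter_continuous[OF f] avg_iter_abs_le[OF f le]
        avg_iter_convergence[OF f le lim] s])

lemma green_cmult: "green d b k (\<lambda>s. c * f s) = (\<lambda>s. c * green d b k f s)"
  unfolding green_def by (simp add: avg_iter_cmult backint_pow_cmult)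

section \<open>Smoothness of radial functions at the origin\<close>

text \<open>Homogeneous polynomials, generated by products with linear forms: enough for a growth
  bound |x|^a and for closure under directional derivatives. The zero function has every
  degree.\<close>

inductive hom_poly :: "nat \<Rightarrow> ('a::euclidean_space \<Rightarrow> real) \<Rightarrow> bool" where
  const: "hom_poly 0 (\<lambda>x. c)"
| mult: "hom_poly a p \<Longrightarrow> hom_poly (Suc a) (\<lambda>x. (x \<bullet> b) * p x)"
| add: "hom_poly a p \<Longrightarrow> hom_poly a q \<Longrightarrow> hom_poly a (\<lambda>x. p x + q x)"

lemma hom_poly_cmult: "hom_poly a p \<Longrightarrow> hom_poly a (\<lambda>x. c * p x)"
proof (induction rule: hom_poly.induct)
  case (mult a p b)
  then show ?case using hom_poly.mult[of a "\<lambda>x. c * p x" b] by (simp add: mult_ac)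
next
  case (add a p q)
  then show ?case using hom_poly.add[of a "\<lambda>x. c * p x" "\<lambda>x. c * q x"] by (simp add: distrib_left)
qed (rule hom_poly.const)

lemma hom_poly_zero: "hom_poly a (\<lambda>x. 0)"
proof (induction a)
  case (Suc a)
  from hom_poly.mult[OF this, of 0] show ?case by simp
qed (rule hom_poly.const)

lemma hom_poly_inner_mult: "hom_poly a p \<Longrightarrow> hom_poly (Suc a) (\<lambda>x. p x * (x \<bullet> w))"
  using hom_poly.mult[of a p w] by (simp add: mult.commute)

lemma hom_poly_continuous: "hom_poly a p \<Longrightarrow> continuous_on A p"
  by (induction rule: hom_poly.induct) (auto intro!: continuous_intros)

lemma hom_poly_bound: "hom_poly a p \<Longrightarrow> \<exists>C\<ge>0. \<forall>x. \<bar>p x\<bar> \<le> C * norm x ^ a"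
proof (induction rule: hom_poly.induct)
  case (const c)
  show ?case by (rule exI[of _ "\<bar>c\<bar>"]) auto
next
  case (mult a p b)
  then obtain C where C: "C \<ge> 0" "\<And>x. \<bar>p x\<bar> \<le> C * norm x ^ a" by auto
  have "\<bar>(x \<bullet> b) * p x\<bar> \<le> (norm b * C) * norm x ^ Suc a" for x
  proof -
    have "\<bar>x \<bullet> b\<bar> * \<bar>p x\<bar> \<le> (norm x * norm b) * (C * norm x ^ a)"
      by (intro mult_mono Cauchy_Schwarz_ineq2 C) auto
    then show ?thesis by (simp add: abs_mult mult_ac)
  qed
  then show ?case using C(1) by (intro exI[of _ "norm b * C"]) auto
next
  case (add a p q)
  then obtain C D where C: "C \<ge> 0" "\<And>x. \<bar>p x\<bar> \<le> C * norm x ^ a"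
    and D: "D \<ge> 0" "\<And>x. \<bar>q x\<bar> \<le> D * norm x ^ a" by auto
  have "\<bar>p x + q x\<bar> \<le> (C + D) * norm x ^ a" for x
    using C(2)[of x] D(2)[of x] abs_triangle_ineq[of "p x" "q x"] by (simp add: distrib_right)
  then show ?case using C(1) D(1) by (intro exI[of _ "C + D"]) auto
qed

lemma hom_poly_deriv:
  "hom_poly a p \<Longrightarrow>
    \<exists>p'. (\<forall>x. (p has_derivative p' x) (at x)) \<and> (\<forall>w. hom_poly (a - 1) (\<lambda>x. p' x w))"
proof (induction rule: hom_poly.induct)
  case (const c)
  show ?case by (rule exI[of _ "\<lambda>x w. 0"]) (auto intro: hom_poly_zero)
next
  case (mult a p b)
  then obtain p' where p': "\<And>x. (p has_derivative p' x) (at x)" "\<And>w. hom_poly (a - 1) (\<lambda>x. p' x w)"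
    by auto
  have "((\<lambda>x. (x \<bullet> b) * p x) has_derivative (\<lambda>w. (w \<bullet> b) * p x + (x \<bullet> b) * p' x w)) (at x)" for x
    by (auto intro!: derivative_eq_intros p')
  moreover have "hom_poly (Suc a - 1) (\<lambda>x. (w \<bullet> b) * p x + (x \<bullet> b) * p' x w)" for w
  proof (cases a)
    case 0
    have "hom_poly a p" by fact
    \<comment> \<open>In degree 0 truncated subtraction leaves \<open>p'\<close> with degree 0, so
      the product with x . b would have degree 1. It vanishes instead, because \<open>p\<close> is
      constant.\<close>
    moreover have "hom_poly 0 (\<lambda>x. (x \<bullet> b) * p' x w)"
    proof -
      obtain c where "p = (\<lambda>x. c)"
      proof -
        have "\<exists>c. p = (\<lambda>x. c)" if "hom_poly a p" "a = 0" for a p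
          using that by (induction rule: hom_poly.induct) (auto simp: fun_eq_iff)
        then show ?thesis using that \<open>hom_poly a p\<close> 0 by blast
      qed
      then have "p' x = (\<lambda>_. 0)" for x
        using has_derivative_unique[OF p'(1)[of x], of "\<lambda>_. 0"] by (simp add: has_derivative_const)
      then show ?thesis by (simp add: hom_poly_zero)
    qed
    ultimately show ?thesis using 0 by (auto intro!: hom_poly.add hom_poly_cmult)
  next
    case (Suc a')
    have "hom_poly a (\<lambda>x. (x \<bullet> b) * p' x w)"
      using hom_poly.mult[OF p'(2)[of w]] Suc by simp
    then show ?thesis using mult by (auto intro!: hom_poly.add hom_poly_cmult)
  qed
  ultimately show ?case by (intro exI[of _ "\<lambda>x w. (w \<bullet> b) * p x + (x \<bullet> b) * p' x w"]) blast
next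
  case (add a p q)
  then obtain p' q' where "\<And>x. (p has_derivative p' x) (at x)" "\<And>w. hom_poly (a - 1) (\<lambda>x. p' x w)"
    "\<And>x. (q has_derivative q' x) (at x)" "\<And>w. hom_poly (a - 1) (\<lambda>x. q' x w)" by auto
  then show ?case
    by (intro exI[of _ "\<lambda>x w. p' x w + q' x w"]) (auto intro!: hom_poly.add has_derivative_add)
qed

definition hsq :: "'a::euclidean_space \<Rightarrow> real" where
  "hsq x = (x \<bullet> x) / 2"

lemma hsq_nonneg [simp]: "0 \<le> hsq x"
  by (simp add: hsq_def)

lemma hsq_zero [simp]: "hsq 0 = 0"
  by (simp add: hsq_def)

lemma hsq_pos_iff [simp]: "0 < hsq x \<longleftrightarrow> x \<noteq> 0"
  by (simp add: hsq_def)

lemma hsq_eq_0_iff [simp]: "hsq x = 0 \<longleftrightarrow> x = 0"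
  by (simp add: hsq_def)

lemma hsq_norm: "hsq x = (norm x)\<^sup>2 / 2"
  by (simp add: hsq_def power2_norm_eq_inner)

lemma hsq_continuous [continuous_intros]: "continuous_on A hsq"
  unfolding hsq_def[abs_def] by (intro continuous_intros) auto

lemma hsq_deriv: "(hsq has_derivative (\<lambda>v. x \<bullet> v)) (at x within S)"
  unfolding hsq_def[abs_def] by (auto intro!: derivative_eq_intros simp: inner_commute)

lemma hsq_compose_deriv:
  assumes "(F has_real_derivative F') (at (hsq x))"
  shows "((\<lambda>x. F (hsq x)) has_derivative (\<lambda>v. F' * (x \<bullet> v))) (at x)"
  using has_derivative_compose[OF hsq_deriv, of F "(*) F'" x UNIV] assms
  by (simp add: has_field_derivative_def)

text \<open>
  All \<open>(s d/ds)\<^sup>i h\<close> with \<open>i \<le> m\<close> are continuous up to \<open>s = 0\<close>.  This is all that an \<open>m\<close>-fold average of a merely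
  continuous function satisfies, and it makes \<open>p(x) h(s) / s\<^sup>j\<close> of class \<open>C\<^sup>m\<close> when the
  homogeneous polynomial \<open>p\<close> has degree at least \<open>2 j + m\<close>.
\<close>

primrec euler_smooth :: "nat \<Rightarrow> (real \<Rightarrow> real) \<Rightarrow> bool" where
  "euler_smooth 0 h \<longleftrightarrow> continuous_on UNIV h"
| "euler_smooth (Suc m) h \<longleftrightarrow> continuous_on UNIV h \<and>
     (\<exists>d. d 0 = 0 \<and> (\<forall>s>0. (h has_real_derivative d s / s) (at s)) \<and> euler_smooth m d)"

lemma euler_smooth_continuous: "euler_smooth m h \<Longrightarrow> continuous_on UNIV h"
  by (cases m) auto

lemma euler_smooth_mono: "euler_smooth m h \<Longrightarrow> k \<le> m \<Longrightarrow> euler_smooth k h"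
proof (induction m arbitrary: k h)
  case (Suc m)
  then show ?case by (cases k) auto
qed simp

lemma euler_smooth_lincomb:
  "euler_smooth m f \<Longrightarrow> euler_smooth m g \<Longrightarrow> euler_smooth m (\<lambda>s. a * f s + b * g s)"
proof (induction m arbitrary: f g)
  case (Suc m)
  then obtain d e where
    d: "d 0 = 0" "\<And>s. s > 0 \<Longrightarrow> (f has_real_derivative d s / s) (at s)" "euler_smooth m d" and
    e: "e 0 = 0" "\<And>s. s > 0 \<Longrightarrow> (g has_real_derivative e s / s) (at s)" "euler_smooth m e"
    by auto
  have "((\<lambda>s. a * f s + b * g s) has_real_derivative (a * d s + b * e s) / s) (at s)" if "s > 0" for s
    by (auto intro!: derivative_eq_intros d(2) e(2) that simp: add_divide_distrib mult_ac)
  then show ?case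
    using Suc d e by (auto intro!: continuous_intros exI[of _ "\<lambda>s. a * d s + b * e s"])
qed (auto intro!: continuous_intros)

text \<open>The operator s d/ds sends \<open>avg n g\<close> to (g - (n + 1) avg n g) / 2, a
  combination of \<open>g\<close> and the average itself, and the induction hypothesis applies to
  the latter. The combination vanishes at 0 because the average there is g 0 / (n + 1).\<close>

lemma euler_smooth_avg: "euler_smooth m g \<Longrightarrow> euler_smooth (Suc m) (avg n g)"
proof (induction m arbitrary: g)
  case 0
  then show ?case
    by (auto intro!: continuous_intros exI[of _ "\<lambda>s. (g s - (real n + 1) * avg n g s) / 2"] avg_deriv
        simp: divide_simps)
next
  case (Suc m)
  note g = euler_smooth_continuous[OF Suc.prems]
  have "euler_smooth (Suc m) (\<lambda>s. 1/2 * g s + (- (real n + 1) / 2) * avg n g s)"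
    using Suc by (intro euler_smooth_lincomb Suc.prems Suc.IH) (rule euler_smooth_mono, auto simp del: euler_smooth.simps)
  moreover have "1/2 * g s + (- (real n + 1) / 2) * avg n g s = (g s - (real n + 1) * avg n g s) / 2" for s
    by (simp add: field_simps)
  ultimately have "euler_smooth (Suc m) (\<lambda>s. (g s - (real n + 1) * avg n g s) / 2)" by (simp only:)
  moreover have "(g 0 - (real n + 1) * avg n g 0) / 2 = 0" by (simp add: divide_simps)
  ultimately show ?case
    unfolding euler_smooth.simps(2)[of "Suc m"]
    using avg_deriv[OF g] avg_continuous[OF g]
    by (intro conjI exI[of _ "\<lambda>s. (g s - (real n + 1) * avg n g s) / 2"]) auto
qed

lemma has_derivative_zero_at_0:
  fixes f :: "'a::euclidean_space \<Rightarrow> real"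
  assumes le: "\<And>y. norm y \<le> 1 \<Longrightarrow> \<bar>f y\<bar> \<le> e y * norm y" and e: "(e \<longlongrightarrow> 0) (at 0)" and "f 0 = 0"
  shows "(f has_derivative (\<lambda>_. 0)) (at 0)"
  unfolding has_derivative_at
proof (intro conjI)
  show "(\<lambda>h. norm (f (0 + h) - f 0 - 0) / norm h) \<midarrow>0\<rightarrow> 0"
  proof (rule Lim_null_comparison[OF _ e])
    show "\<forall>\<^sub>F h in at 0. norm (norm (f (0 + h) - f 0 - 0) / norm h) \<le> e h"
      unfolding eventually_at
      by (rule exI[of _ 1]) (use le \<open>f 0 = 0\<close> in \<open>auto simp: dist_norm divide_le_eq\<close>)
  qed
qed (rule bounded_linear_zero)

lemma hom_poly_quotient_bound:
  fixes p :: "'a::euclidean_space \<Rightarrow> real"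
  assumes p: "hom_poly a p" and a: "2 * j + k \<le> a"
  shows "\<exists>C\<ge>0. \<forall>y. norm y \<le> 1 \<longrightarrow> \<bar>p y * t / hsq y ^ j\<bar> \<le> C * \<bar>t\<bar> * norm y ^ k"
proof -
  obtain C where C: "C \<ge> 0" "\<And>x. \<bar>p x\<bar> \<le> C * norm x ^ a" using hom_poly_bound[OF p] by auto
  have "\<bar>p y * t / hsq y ^ j\<bar> \<le> (2 ^ j * C) * \<bar>t\<bar> * norm y ^ k" if y: "norm y \<le> 1" for y
  proof (cases "y = 0")
    case True
    then show ?thesis using C(2)[of 0] a C(1) by (cases j) (auto simp: power_0_left abs_mult mult_right_mono split: if_splits)
  next
    case False
    have "norm y ^ a \<le> norm y ^ (2 * j + k)" using y a by (intro power_decreasing) auto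
    then have "\<bar>p y\<bar> \<le> C * norm y ^ (2 * j + k)"
      using C(2)[of y] C(1) by (meson mult_left_mono order_trans)
    also have "\<dots> = 2 ^ j * C * norm y ^ k * hsq y ^ j"
      by (simp add: hsq_norm power_divide power_add power_mult)
    finally have "\<bar>p y\<bar> / hsq y ^ j \<le> 2 ^ j * C * norm y ^ k"
      using False by (simp add: divide_le_eq)
    then have "\<bar>p y\<bar> / hsq y ^ j * \<bar>t\<bar> \<le> 2 ^ j * C * norm y ^ k * \<bar>t\<bar>"
      by (intro mult_right_mono) auto
    then show ?thesis by (simp add: abs_mult mult_ac power_abs)
  qed
  then show ?thesis using C(1) by (intro exI[of _ "2 ^ j * C"]) auto
qed

lemma tendsto_hsq_0:
  assumes "continuous_on UNIV (h::real \<Rightarrow> real)"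
  shows "((\<lambda>y::'a::euclidean_space. h (hsq y)) \<longlongrightarrow> h 0) (at 0)"
proof -
  have "continuous_on UNIV (\<lambda>y::'a. h (hsq y))"
    by (intro continuous_on_compose2[OF assms] continuous_intros) auto
  then have "isCont (\<lambda>y::'a. h (hsq y)) 0" by (simp add: continuous_on_eq_continuous_at)
  then show ?thesis by (simp add: isCont_def)
qed


text \<open>At \<open>x = 0\<close> the quotient by \<open>hsq x ^ j\<close> is \<open>0\<close> for \<open>j > 0\<close>, which is the right limit.\<close>

lemma singular_term_continuous:
  fixes p :: "'a::euclidean_space \<Rightarrow> real"
  assumes p: "hom_poly a p" and h: "continuous_on UNIV h" and a: "2 * j \<le> a" and h0: "j > 0 \<Longrightarrow> h 0 = 0"
  shows "continuous_on UNIV (\<lambda>x. p x * h (hsq x) / hsq x ^ j)"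
proof (cases "j = 0")
  case True
  then show ?thesis
    by (auto intro!: continuous_intros hom_poly_continuous[OF p] continuous_on_compose2[OF h])
next
  case False
  let ?w = "\<lambda>x. p x * h (hsq x) / hsq x ^ j"
  have "isCont ?w x" for x
  proof (cases "x = 0")
    case x: True
    obtain C where C: "C \<ge> 0" "\<And>y. norm y \<le> 1 \<Longrightarrow> \<bar>p y * h (hsq y) / hsq y ^ j\<bar> \<le> C * \<bar>h (hsq y)\<bar>"
    proof -
      obtain C where C: "C \<ge> 0" "\<And>y. norm y \<le> 1 \<Longrightarrow> \<bar>p y * 1 / hsq y ^ j\<bar> \<le> C"
        using hom_poly_quotient_bound[OF p, of j 0 1] a by auto
      have "\<bar>p y * h (hsq y) / hsq y ^ j\<bar> \<le> C * \<bar>h (hsq y)\<bar>" if "norm y \<le> 1" for y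
        using mult_right_mono[OF C(2)[OF that], of "\<bar>h (hsq y)\<bar>"] by (simp add: abs_mult mult_ac)
      then show ?thesis using that C(1) by blast
    qed
    have "((\<lambda>y. C * \<bar>h (hsq y)\<bar>) \<longlongrightarrow> C * \<bar>h 0\<bar>) (at (0::'a))"
      by (intro tendsto_intros tendsto_hsq_0 h)
    then have lim: "((\<lambda>y. C * \<bar>h (hsq y)\<bar>) \<longlongrightarrow> 0) (at (0::'a))" using h0 False by simp
    have "(?w \<longlongrightarrow> 0) (at 0)"
      by (rule Lim_null_comparison[OF _ lim])
         (use C(2) in \<open>auto simp: eventually_at dist_norm intro!: exI[of _ 1]\<close>)
    then show ?thesis using x h0 False by (simp add: isCont_def)
  next
    case x: False
    have "continuous_on (- {0}) ?w"
      by (auto intro!: continuous_intros hom_poly_continuous[OF p] continuous_on_compose2[OF h] simp: hsq_def)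
    then show ?thesis using x by (simp add: continuous_on_eq_continuous_at open_Compl)
  qed
  then show ?thesis by (simp add: continuous_on_eq_continuous_at)
qed

text \<open>Away from the origin this is the product rule. At the origin \<open>h\<close> is split
  into h 0 and h - h 0. Since p / hsq^j is O(|x|), the second part contributes o(|x|); the first is
  present only for j = 0 and is then differentiated as a multiple of \<open>p\<close>. The formula
  remains correct at 0 under division by zero, because \<open>p\<close> vanishes there.\<close>

lemma singular_term_deriv:
  fixes p :: "'a::euclidean_space \<Rightarrow> real"
  assumes p: "hom_poly a p" and p': "\<And>x. (p has_derivative p' x) (at x)"
    and h: "continuous_on UNIV h" and d: "\<And>s. s > 0 \<Longrightarrow> (h has_real_derivative d s / s) (at s)"
    and a: "2 * j + 1 \<le> a" and h0: "j > 0 \<Longrightarrow> h 0 = 0"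
  shows "((\<lambda>x. p x * h (hsq x) / hsq x ^ j) has_derivative
    (\<lambda>v. p' x v * h (hsq x) / hsq x ^ j + p x * (x \<bullet> v) * (d (hsq x) - real j * h (hsq x)) / hsq x ^ Suc j)) (at x)"
proof (cases "x = 0")
  case False
  then have s: "hsq x > 0" by simp
  have "((\<lambda>s. h s / s ^ j) has_real_derivative (d (hsq x) - real j * h (hsq x)) / hsq x ^ Suc j) (at (hsq x))"
  proof -
    have "((\<lambda>s. h s / s ^ j) has_real_derivative
        (d (hsq x) / hsq x * hsq x ^ j - h (hsq x) * (real j * hsq x ^ (j - 1))) / (hsq x ^ j * hsq x ^ j)) (at (hsq x))"
      using s by (auto intro!: derivative_eq_intros d)
    moreover have "(d (hsq x) / hsq x * hsq x ^ j - h (hsq x) * (real j * hsq x ^ (j - 1))) / (hsq x ^ j * hsq x ^ j)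
        = (d (hsq x) - real j * h (hsq x)) / hsq x ^ Suc j"
      using s by (cases j) (auto simp: divide_simps, simp_all add: algebra_simps)
    ultimately show ?thesis by simp
  qed
  from has_derivative_mult[OF p' hsq_compose_deriv[OF this]]
  show ?thesis
    unfolding times_divide_eq_right by (rule has_derivative_eq_rhs) (auto simp: fun_eq_iff algebra_simps)
next
  case True
  define D where "D = (\<lambda>v. p' 0 v * (if j = 0 then h 0 else 0))"
  have p0: "p 0 = 0"
  proof -
    obtain C where "\<And>x. \<bar>p x\<bar> \<le> C * norm x ^ a" using hom_poly_bound[OF p] by auto
    from this[of 0] show ?thesis using a by (simp add: power_0_left split: if_splits)
  qed
  let ?k = "\<lambda>s. h s - h 0"
  have k: "continuous_on UNIV ?k" by (intro continuous_intros h)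
  obtain C where C: "C \<ge> 0" "\<And>y. norm y \<le> 1 \<Longrightarrow> \<bar>p y * 1 / hsq y ^ j\<bar> \<le> C * norm y"
    using hom_poly_quotient_bound[OF p a, of 1] by auto
  have "((\<lambda>y. C * \<bar>?k (hsq y)\<bar>) \<longlongrightarrow> C * \<bar>?k 0\<bar>) (at (0::'a))"
    by (intro tendsto_intros tendsto_hsq_0 h)
  then have lim: "((\<lambda>y. C * \<bar>?k (hsq y)\<bar>) \<longlongrightarrow> 0) (at (0::'a))" by simp
  have 1: "((\<lambda>x. p x * ?k (hsq x) / hsq x ^ j) has_derivative (\<lambda>_. 0)) (at 0)"
  proof (rule has_derivative_zero_at_0[OF _ lim])
    fix y :: 'a assume "norm y \<le> 1"
    from mult_right_mono[OF C(2)[OF this], of "\<bar>?k (hsq y)\<bar>"]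
    show "\<bar>p y * ?k (hsq y) / hsq y ^ j\<bar> \<le> C * \<bar>?k (hsq y)\<bar> * norm y"
      by (simp add: abs_mult mult_ac)
  qed simp
  have "((\<lambda>x. p x * h (hsq x) / hsq x ^ j) has_derivative D) (at 0)"
  proof (cases "j = 0")
    case j: True
    have "((\<lambda>x. p x * ?k (hsq x) / hsq x ^ j + p x * h 0) has_derivative (\<lambda>v. 0 + p' 0 v * h 0)) (at 0)"
      by (intro has_derivative_add 1 has_derivative_mult_left p')
    then show ?thesis using j by (simp add: D_def algebra_simps)
  next
    case j: False
    then show ?thesis using 1 h0 by (simp add: D_def)
  qed
  moreover have "D = (\<lambda>v. p' x v * h (hsq x) / hsq x ^ j + p x * (x \<bullet> v) * (d (hsq x) - real j * h (hsq x)) / hsq x ^ Suc j)"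
    using True p0 h0 by (auto simp: D_def fun_eq_iff power_0_left)
  ultimately show ?thesis using True by simp
qed

section \<open>Class C^k on the whole space\<close>

lemma dir_deriv_UNIV:
  assumes "(f has_derivative f') (at x)"
  shows "dir_deriv UNIV w f x = f' w"
  using frechet_derivative_at[OF assms] by (simp add: dir_deriv_def)

lemma dir_deriv_UNIV_eq:
  assumes "\<And>x. (f has_derivative f' x) (at x)"
  shows "dir_deriv UNIV w f = (\<lambda>x. f' x w)"
  using dir_deriv_UNIV[OF assms] by (rule ext)

lemma Ck_on_SucI:
  assumes "\<And>x. (f has_derivative f' x) (at x)" "\<And>b. Ck_on k (\<lambda>x. f' x b) UNIV"
  shows "Ck_on (Suc k) f UNIV"
  using assms dir_deriv_UNIV_eq[OF assms(1)]
  by (auto simp: differentiable_on_def differentiable_def)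

lemma Ck_on_add: "Ck_on k f UNIV \<Longrightarrow> Ck_on k g UNIV \<Longrightarrow> Ck_on k (\<lambda>x. f x + g x) UNIV"
proof (induction k arbitrary: f g)
  case (Suc k)
  have deriv: "(h has_derivative frechet_derivative h (at x)) (at x)" if "Ck_on (Suc k) h UNIV" for h :: "'a \<Rightarrow> real" and x
    using that by (auto simp: differentiable_on_def frechet_derivative_works)
  have sum: "((\<lambda>x. f x + g x) has_derivative (\<lambda>v. frechet_derivative f (at x) v + frechet_derivative g (at x) v)) (at x)" for x
    by (intro has_derivative_add deriv Suc)
  have "dir_deriv UNIV b (\<lambda>x. f x + g x) = (\<lambda>x. dir_deriv UNIV b f x + dir_deriv UNIV b g x)" for b
    using dir_deriv_UNIV_eq[OF sum] by (simp add: dir_deriv_def)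
  moreover have "(\<lambda>x. f x + g x) differentiable_on UNIV"
    using sum by (auto simp: differentiable_on_def differentiable_def)
  ultimately show ?case using Suc by simp
qed (auto intro: continuous_intros)

text \<open>A derivative of such a term is a sum of two terms of the same kind: one of degree a - 1
  with the same j, one of degree a + 1 with j + 1 and with s h' - j h in place of h. Both satisfy
  the degree condition for k lowered by one, and s h' - j h vanishes at 0, as the larger power of
  \<open>hsq\<close> requires.\<close>

lemma Ck_on_singular_term:
  fixes p :: "'a::euclidean_space \<Rightarrow> real"
  assumes "hom_poly a p" "euler_smooth k h" "2 * j + k \<le> a" "j > 0 \<Longrightarrow> h 0 = 0"
  shows "Ck_on k (\<lambda>x. p x * h (hsq x) / hsq x ^ j) UNIV"
  using assms
proof (induction k arbitrary: a p h j)
  case 0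
  then show ?case using singular_term_continuous[of a p h j] by simp
next
  case (Suc k)
  obtain p' where p': "\<And>x. (p has_derivative p' x) (at x)" "\<And>w. hom_poly (a - 1) (\<lambda>x. p' x w)"
    using hom_poly_deriv[OF Suc.prems(1)] by auto
  obtain d where d: "d 0 = 0" "\<And>s. s > 0 \<Longrightarrow> (h has_real_derivative d s / s) (at s)" "euler_smooth k d"
    using Suc.prems(2) by auto
  have lower: "euler_smooth k h"
    by (rule euler_smooth_mono[OF Suc.prems(2)]) simp
  have ek: "euler_smooth k (\<lambda>s. d s - real j * h s)"
    using euler_smooth_lincomb[OF d(3) lower, of 1 "- real j"] by simp
  show ?case
  proof (rule Ck_on_SucI)
    show "((\<lambda>x. p x * h (hsq x) / hsq x ^ j) has_derivative (\<lambda>v. p' x v * h (hsq x) / hsq x ^ j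
        + p x * (x \<bullet> v) * (d (hsq x) - real j * h (hsq x)) / hsq x ^ Suc j)) (at x)" for x
      using Suc.prems by (intro singular_term_deriv p'(1) d euler_smooth_continuous[OF Suc.prems(2)]) auto
    show "Ck_on k (\<lambda>x. p' x b * h (hsq x) / hsq x ^ j
        + p x * (x \<bullet> b) * (d (hsq x) - real j * h (hsq x)) / hsq x ^ Suc j) UNIV" for b
    proof (intro Ck_on_add)
      show "Ck_on k (\<lambda>x. p' x b * h (hsq x) / hsq x ^ j) UNIV"
        using Suc.prems(3,4) by (intro Suc.IH[OF p'(2) lower]) auto
      show "Ck_on k (\<lambda>x. p x * (x \<bullet> b) * (d (hsq x) - real j * h (hsq x)) / hsq x ^ Suc j) UNIV"
        using Suc.prems(3,4) d(1)
        by (intro Suc.IH[OF hom_poly_inner_mult[OF Suc.prems(1)] ek]) (cases "j = 0", auto)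
    qed
  qed
qed

text \<open>The regularity of \<open>n\<close> integrations applied to an \<open>m\<close>-fold
  average: \<open>n\<close> classical derivatives on s \<ge> 0, the last of which is only smooth
  with respect to s d/ds.\<close>

primrec radially_smooth :: "nat \<Rightarrow> nat \<Rightarrow> (real \<Rightarrow> real) \<Rightarrow> bool" where
  "radially_smooth 0 m F \<longleftrightarrow> euler_smooth m F"
| "radially_smooth (Suc n) m F \<longleftrightarrow>
     (\<exists>F'. (\<forall>s\<ge>0. (F has_real_derivative F' s) (at s)) \<and> radially_smooth n m F')"

lemma radially_smooth_continuous: "radially_smooth n m F \<Longrightarrow> continuous_on {0..} F"
  by (cases n)
     (auto intro: continuous_on_subset[OF euler_smooth_continuous] DERIV_continuous_on has_field_derivative_at_within)

text \<open>A derivative falls on \<open>p\<close>, costing one degree, or on \<open>F\<close>,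
  which uses up one classical derivative but produces a factor x . b. In both cases a + 2 n and n +
  m drop by at most one; once n = 0 the singular terms take over. With a = 0 and n = m = k the
  result is C^(2k).\<close>

lemma Ck_on_radial_term:
  fixes p :: "'a::euclidean_space \<Rightarrow> real"
  assumes "hom_poly a p" "radially_smooth n m F" "k \<le> a + 2 * n" "k \<le> n + m"
  shows "Ck_on k (\<lambda>x. p x * F (hsq x)) UNIV"
  using assms
proof (induction k arbitrary: a p n F)
  case 0
  have "continuous_on UNIV (\<lambda>x::'a. F (hsq x))"
    by (intro continuous_on_compose2[OF radially_smooth_continuous[OF 0(2)]] continuous_intros) auto
  then show ?case by (auto intro!: continuous_intros hom_poly_continuous[OF 0(1)])
next
  case (Suc k)
  show ?case
  proof (cases n)
    case 0
    have "euler_smooth (Suc k) F"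
      using Suc.prems 0 by (rule_tac euler_smooth_mono[of m F]) (auto simp del: euler_smooth.simps)
    from Ck_on_singular_term[OF Suc.prems(1) this, of 0] Suc.prems(3) 0 show ?thesis by simp
  next
    case (Suc n')
    obtain p' where p': "\<And>x. (p has_derivative p' x) (at x)" "\<And>w. hom_poly (a - 1) (\<lambda>x. p' x w)"
      using hom_poly_deriv[OF Suc.prems(1)] by auto
    obtain F' where F': "\<And>s. s \<ge> 0 \<Longrightarrow> (F has_real_derivative F' s) (at s)" "radially_smooth n' m F'"
      using Suc.prems(2) Suc by auto
    show ?thesis
    proof (rule Ck_on_SucI)
      show "((\<lambda>x. p x * F (hsq x)) has_derivative
          (\<lambda>v. p' x v * F (hsq x) + p x * (x \<bullet> v) * F' (hsq x))) (at x)" for x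
        by (rule has_derivative_eq_rhs[OF has_derivative_mult[OF p'(1) hsq_compose_deriv[OF F'(1)]]])
           (auto simp: fun_eq_iff algebra_simps)
      show "Ck_on k (\<lambda>x. p' x b * F (hsq x) + p x * (x \<bullet> b) * F' (hsq x)) UNIV" for b
        using Suc.prems(3,4) Suc
        by (intro Ck_on_add Suc.IH[OF p'(2) Suc.prems(2)] Suc.IH[OF hom_poly_inner_mult[OF Suc.prems(1)] F'(2)]) auto
    qed
  qed
qed

lemma radially_smooth_antideriv:
  assumes "euler_smooth m g"
  shows "radially_smooth n m (\<lambda>s. (\<Sum>i<n. c i * s ^ i) + C * (antideriv ^^ n) g s)"
proof (induction n arbitrary: c)
  case 0
  show ?case using euler_smooth_lincomb[OF assms assms, of C 0] by simp
next
  case (Suc n)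
  note g = euler_smooth_continuous[OF assms]
  have "((\<lambda>s. (\<Sum>i<Suc n. c i * s ^ i) + C * (antideriv ^^ Suc n) g s) has_real_derivative
      (\<Sum>i<n. (real (Suc i) * c (Suc i)) * s ^ i) + C * (antideriv ^^ n) g s) (at s)" if s: "s \<ge> 0" for s
  proof -
    have "((\<lambda>s. c (Suc i) * s ^ Suc i) has_real_derivative real (Suc i) * c (Suc i) * s ^ i) (at s)" for i
      using DERIV_cmult[OF DERIV_power_Suc[OF DERIV_ident], of "c (Suc i)" i s UNIV] by (simp add: mult_ac)
    then have "((\<lambda>s. c 0 * s ^ 0 + (\<Sum>i<n. c (Suc i) * s ^ Suc i) + C * antideriv ((antideriv ^^ n) g) s)
        has_real_derivative 0 + (\<Sum>i<n. real (Suc i) * c (Suc i) * s ^ i) + C * (antideriv ^^ n) g s) (at s)"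
      by (intro DERIV_add DERIV_sum DERIV_cmult antideriv_deriv antideriv_pow_continuous g s) auto
    then show ?thesis by (simp add: sum.lessThan_Suc_shift del: sum.lessThan_Suc)
  qed
  then show ?case
    unfolding radially_smooth.simps(2)
    by (intro exI[of _ "\<lambda>s. (\<Sum>i<n. (real (Suc i) * c (Suc i)) * s ^ i) + C * (antideriv ^^ n) g s"] conjI Suc allI impI)
qed

lemma euler_smooth_avg_iter: "continuous_on UNIV f \<Longrightarrow> euler_smooth k (avg_iter d k f)"
  by (induction k) (auto intro: euler_smooth_avg simp del: euler_smooth.simps(2))

lemma Ck_on_radial_solution:
  fixes d :: nat
  assumes f: "continuous_on UNIV f"
  shows "Ck_on (2 * k) (\<lambda>x::'a::euclidean_space. (\<Sum>i<k. c i * hsq x ^ i) + (inv_lap d ^^ k) f (hsq x)) UNIV"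
  using Ck_on_radial_term[OF hom_poly.const[of 1]
      radially_smooth_antideriv[OF euler_smooth_avg_iter[OF f, of k d], of k c "(-1) ^ k"], of "2 * k"]
  by (simp add: inv_lap_pow_eq[OF f])

section \<open>The polyharmonic operator on radial functions\<close>

lemma avg_polynomial:
  "avg m (\<lambda>s. \<Sum>i<k. c i * s ^ i) s = (\<Sum>i<k. c i / (real m + 2 * real i + 1) * s ^ i)"
proof (induction k)
  case (Suc k)
  have "avg m (\<lambda>s. \<Sum>i<Suc k. c i * s ^ i) s
      = avg m (\<lambda>s. \<Sum>i<k. c i * s ^ i) s + avg m (\<lambda>s. c k * s ^ k) s"
    by (subst avg_add[symmetric]) (auto intro!: continuous_intros)
  then show ?case by (simp add: Suc avg_monomial)
qed simp

text \<open>A first partial derivative is x . b times a function of s, a term whose derivative is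
  known at the origin as well. The squares of the coordinates sum to 2 s, and the identity 2 s A' +
  (d + 1) A = H for A = \<open>avg d H\<close> finishes the computation.\<close>

lemma laplacian_radial:
  fixes F :: "real \<Rightarrow> real"
  assumes F: "\<And>s. 0 \<le> s \<Longrightarrow> (F has_real_derivative - avg d H s) (at s)"
    and H: "continuous_on UNIV H" and dim: "DIM('a::euclidean_space) = Suc d"
  shows "laplacian UNIV (\<lambda>x::'a. F (hsq x)) x = - H (hsq x)"
proof -
  define e where "e s = - ((H s - (real d + 1) * avg d H s) / 2)" for s
  have e: "((\<lambda>s. - avg d H s) has_real_derivative e s / s) (at s)" if "s > 0" for s
    using DERIV_minus[OF avg_deriv[OF H that, of d]] by (simp add: e_def)
  have first: "dir_deriv UNIV b (\<lambda>x::'a. F (hsq x)) = (\<lambda>x. (x \<bullet> b) * - avg d H (hsq x) / hsq x ^ 0)" for b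
    using dir_deriv_UNIV_eq[OF hsq_compose_deriv[OF F]] by (simp add: fun_eq_iff mult.commute)
  have p: "hom_poly 1 (\<lambda>x::'a. x \<bullet> b)" for b
    using hom_poly.mult[OF hom_poly.const[of 1], of b] by simp
  have p': "((\<lambda>x::'a. x \<bullet> b) has_derivative (\<lambda>v. v \<bullet> b)) (at x)" for b x
    by (auto intro!: derivative_eq_intros)
  have second: "dir_deriv UNIV b (dir_deriv UNIV b (\<lambda>x::'a. F (hsq x))) x
      = - avg d H (hsq x) + (x \<bullet> b)\<^sup>2 * e (hsq x) / hsq x" if "b \<in> Basis" for b
  proof -
    have "((\<lambda>x::'a. (x \<bullet> b) * - avg d H (hsq x) / hsq x ^ 0) has_derivative
        (\<lambda>v. (v \<bullet> b) * - avg d H (hsq x) / hsq x ^ 0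
          + (x \<bullet> b) * (x \<bullet> v) * (e (hsq x) - real 0 * - avg d H (hsq x)) / hsq x ^ Suc 0)) (at x)"
      by (rule singular_term_deriv[OF p p' _ e]) (auto intro!: continuous_intros H)
    from dir_deriv_UNIV[OF this] show ?thesis
      unfolding first using that by (simp add: power2_eq_square)
  qed
  have "laplacian UNIV (\<lambda>x::'a. F (hsq x)) x
      = (\<Sum>b\<in>(Basis::'a set). - avg d H (hsq x) + (x \<bullet> b)\<^sup>2 * (e (hsq x) / hsq x))"
    unfolding laplacian_def by (intro sum.cong) (simp_all add: second)
  also have "\<dots> = - (real d + 1) * avg d H (hsq x) + (\<Sum>b\<in>(Basis::'a set). (x \<bullet> b)\<^sup>2) * (e (hsq x) / hsq x)"
    unfolding sum.distrib sum_distrib_right by (simp add: dim algebra_simps)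
  also have "(\<Sum>b\<in>(Basis::'a set). (x \<bullet> b)\<^sup>2) = 2 * hsq x"
    using euclidean_inner[of x x] by (simp add: hsq_def power2_eq_square)
  also have "- (real d + 1) * avg d H (hsq x) + 2 * hsq x * (e (hsq x) / hsq x) = - H (hsq x)"
  \<comment> \<open>At the origin the term with the quotient disappears by division by zero, and (d
    + 1) \<open>avg d H 0\<close> is already \<open>H 0\<close>.\<close>
  proof (cases "x = 0")
    case True
    then show ?thesis by (simp add: divide_simps algebra_simps)
  next
    case False
    then show ?thesis by (simp add: e_def field_simps)
  qed
  finally show ?thesis .
qed

lemma polyharmonic_Suc_right:
  "polyharmonic S (Suc k) f = polyharmonic S k (\<lambda>x. - laplacian S f x)"
  by (induction k) simp_all

text \<open>The innermost Laplacian sends s^(i+1) to (i + 1) (d + 2 i + 1) s^i, whence the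
  coefficients \<open>c'\<close>, and it undoes one \<open>inv_lap d\<close>. After \<open>k\<close>
  steps the polynomial is gone and \<open>f\<close> remains.\<close>

lemma polyharmonic_radial_solution:
  assumes f: "continuous_on UNIV f" and dim: "DIM('a::euclidean_space) = Suc d"
  shows "polyharmonic UNIV k (\<lambda>x::'a. (\<Sum>i<k. c i * hsq x ^ i) + (inv_lap d ^^ k) f (hsq x)) = (\<lambda>x. f (hsq x))"
proof (induction k arbitrary: c)
  case (Suc k)
  define c' where "c' i = - (real (Suc i) * (real d + 2 * real i + 1) * c (Suc i))" for i
  define H where "H s = (\<Sum>i<k. c' i * s ^ i) + (inv_lap d ^^ k) f s" for s
  have H: "continuous_on UNIV H" unfolding H_def[abs_def] by (intro continuous_intros f)
  have avg_H: "avg d H s = (\<Sum>i<k. - (real (Suc i) * c (Suc i)) * s ^ i) + avg d ((inv_lap d ^^ k) f) s" for s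
  proof -
    have nz: "real d + 2 * real i + 1 \<noteq> 0" for i by (auto simp: add_nonneg_eq_0_iff)
    have "c' i / (real d + 2 * real i + 1) = - (real (Suc i) * c (Suc i))" for i
      unfolding c'_def using nz[of i] by (simp add: divide_simps) 
    then show ?thesis
      unfolding H_def[abs_def]
      by (subst avg_add) (auto intro!: continuous_intros f simp: avg_polynomial simp del: of_nat_Suc)
  qed
  have "((\<lambda>s. (\<Sum>i<Suc k. c i * s ^ i) + (inv_lap d ^^ Suc k) f s) has_real_derivative - avg d H s) (at s)"
    if s: "0 \<le> s" for s
  proof -
    have "((\<lambda>s. c (Suc i) * s ^ Suc i) has_real_derivative real (Suc i) * c (Suc i) * s ^ i) (at s)" for i
      using DERIV_cmult[OF DERIV_power_Suc[OF DERIV_ident], of "c (Suc i)" i s UNIV] by (simp add: mult_ac)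
    then have "((\<lambda>s. c 0 * s ^ 0 + (\<Sum>i<k. c (Suc i) * s ^ Suc i) + - antideriv (avg d ((inv_lap d ^^ k) f)) s)
        has_real_derivative 0 + (\<Sum>i<k. real (Suc i) * c (Suc i) * s ^ i) + - avg d ((inv_lap d ^^ k) f) s) (at s)"
      by (intro DERIV_add DERIV_sum DERIV_minus antideriv_deriv avg_continuous inv_lap_pow_continuous f s) auto
    then show ?thesis
      by (simp add: avg_H inv_lap_def[of d "(inv_lap d ^^ k) f"] sum.lessThan_Suc_shift sum_negf del: sum.lessThan_Suc of_nat_Suc)
  qed
  from laplacian_radial[OF this H dim]
  have "polyharmonic UNIV (Suc k) (\<lambda>x::'a. (\<Sum>i<Suc k. c i * hsq x ^ i) + (inv_lap d ^^ Suc k) f (hsq x))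
      = polyharmonic UNIV k (\<lambda>x. H (hsq x))"
    unfolding polyharmonic_Suc_right by simp
  then show ?case unfolding H_def Suc by simp
qed simp

text \<open>On a segment from \<open>x\<close> to a point of \<open>S\<close> the problem is
  one-dimensional, so two derivatives agree on all directions y - x with y in \<open>S\<close>; an
  interior ball makes these directions span the space. This is needed at boundary points of the
  closed ball, where \<open>frechet_derivative\<close> is merely a choice.\<close>

lemma has_derivative_unique_within_convex:
  fixes f :: "'a::euclidean_space \<Rightarrow> real"
  assumes "convex S" "interior S \<noteq> {}" "x \<in> S"
    and f': "(f has_derivative f') (at x within S)" and f'': "(f has_derivative f'') (at x within S)"
  shows "f' = f''"
proof -
  interpret f': bounded_linear f' using f' by (rule has_derivative_bounded_linear)
  interpret f'': bounded_linear f'' using f'' by (rule has_derivative_bounded_linear)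
  have eq: "f' (y - x) = f'' (y - x)" if "y \<in> S" for y
  proof -
    have line: "((\<lambda>t. x + t *\<^sub>R (y - x)) has_derivative (\<lambda>t. t *\<^sub>R (y - x))) (at 0 within {0..1})"
      by (auto intro!: derivative_eq_intros)
    have sub: "(\<lambda>t. x + t *\<^sub>R (y - x)) ` {0..1} \<subseteq> S"
    proof clarify
      fix t :: real assume "t \<in> {0..1}"
      then have "(1 - t) *\<^sub>R x + t *\<^sub>R y \<in> S"
        using convexD_alt[OF assms(1,3) \<open>y \<in> S\<close>] by auto
      then show "x + t *\<^sub>R (y - x) \<in> S" by (simp add: algebra_simps)
    qed
    have comp: "((\<lambda>t. f (x + t *\<^sub>R (y - x))) has_derivative (\<lambda>t. g (t *\<^sub>R (y - x)))) (at 0 within {0..1})"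
      if "(f has_derivative g) (at x within S)" for g
      using has_derivative_in_compose[OF line, of f g] has_derivative_subset[OF that sub] by simp
    have "(\<lambda>t. f' (t *\<^sub>R (y - x))) = (\<lambda>t. f'' (t *\<^sub>R (y - x)))"
      by (rule frechet_derivative_unique_within_closed_interval[of 0 1 0])
         (use comp[OF f'] comp[OF f''] in auto)
    then have "f' (1 *\<^sub>R (y - x)) = f'' (1 *\<^sub>R (y - x))" by meson
    then show ?thesis by simp
  qed
  obtain z e where e: "e > 0" "ball z e \<subseteq> S"
    using assms(2) by (metis all_not_in_conv mem_interior)
  show ?thesis
  proof
    fix v
    show "f' v = f'' v"
    proof (cases "v = 0")
      case False
      \<comment> \<open>Small enough for z + t v to stay in the ball around \<open>z\<close>, so
        that t v is a difference of two admissible directions.\<close>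
      define t where "t = e / (2 * norm v)"
      have t: "t > 0" using e False by (simp add: t_def)
      have "z \<in> S" "z + t *\<^sub>R v \<in> S"
        using e False by (auto simp: t_def dist_norm intro!: subsetD[OF e(2)])
      from eq[OF this(1)] eq[OF this(2)]
      have "f' ((z + t *\<^sub>R v - x) - (z - x)) = f'' ((z + t *\<^sub>R v - x) - (z - x))"
        by (simp only: f'.diff f''.diff)
      then have "t * f' v = t * f'' v" by (simp add: f'.scaleR f''.scaleR)
      then show ?thesis using t by simp
    qed (simp add: f'.zero f''.zero)
  qed
qed

lemma dir_deriv_cong:
  assumes "\<And>y. y \<in> S \<Longrightarrow> f y = g y" "x \<in> S"
  shows "dir_deriv S w f x = dir_deriv S w g x"
proof -
  have "(f has_derivative f') (at x within S) \<longleftrightarrow> (g has_derivative f') (at x within S)" for f'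
    using has_derivative_transform[OF assms(2), of g f f'] has_derivative_transform[OF assms(2), of f g f'] assms(1)
    by metis
  then show ?thesis by (simp add: dir_deriv_def frechet_derivative_def)
qed

lemma Ck_on_cong:
  assumes "\<And>y. y \<in> S \<Longrightarrow> f y = g y"
  shows "Ck_on k f S \<longleftrightarrow> Ck_on k g S"
  using assms
proof (induction k arbitrary: f g)
  case 0
  then show ?case by (auto cong: continuous_on_cong)
next
  case (Suc k)
  have "f differentiable_on S \<longleftrightarrow> g differentiable_on S"
    using Suc.prems by (auto simp: differentiable_on_def intro: differentiable_transform_within[where d = 1])
  moreover have "Ck_on k (dir_deriv S b f) S \<longleftrightarrow> Ck_on k (dir_deriv S b g) S" for b
    by (rule Suc.IH) (rule dir_deriv_cong[OF Suc.prems])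
  ultimately show ?case by simp
qed

lemma dir_deriv_convex:
  fixes f :: "'a::euclidean_space \<Rightarrow> real"
  assumes "convex S" "interior S \<noteq> {}" "x \<in> S" "f differentiable at x"
  shows "dir_deriv S w f x = dir_deriv UNIV w f x"
proof -
  have D: "(f has_derivative frechet_derivative f (at x)) (at x)"
    using assms(4) by (simp add: frechet_derivative_works)
  then have DS: "(f has_derivative frechet_derivative f (at x)) (at x within S)"
    by (rule has_derivative_at_withinI)
  then have "(f has_derivative frechet_derivative f (at x within S)) (at x within S)"
    using frechet_derivative_works differentiable_def by blast
  from has_derivative_unique_within_convex[OF assms(1-3) this DS] show ?thesis
    by (simp add: dir_deriv_def)
qed

lemma Ck_on_convex:
  fixes f :: "'a::euclidean_space \<Rightarrow> real"
  assumes S: "convex S" "interior S \<noteq> {}" and f: "Ck_on k f UNIV"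
  shows "Ck_on k f S"
  using f
proof (induction k arbitrary: f)
  case (Suc k)
  have diff: "f differentiable at x" for x using Suc.prems by (simp add: differentiable_on_def)
  have "Ck_on k (dir_deriv S b f) S \<longleftrightarrow> Ck_on k (dir_deriv UNIV b f) S" for b
    by (rule Ck_on_cong) (rule dir_deriv_convex[OF S _ diff])
  then show ?case using Suc diff by (auto simp: differentiable_on_def intro: differentiable_at_withinI)
qed (auto intro: continuous_on_subset)

lemma polyharmonic_open:
  assumes "open S" "x \<in> S"
  shows "polyharmonic S k f x = polyharmonic UNIV k f x"
  using assms(2)
proof (induction k arbitrary: x)
  case (Suc k)
  have dir: "dir_deriv S w g x = dir_deriv UNIV w h x" if "\<And>y. y \<in> S \<Longrightarrow> g y = h y" "x \<in> S" for g h w x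
  proof -
    have "(g has_derivative g') (at x) \<longleftrightarrow> (h has_derivative g') (at x)" for g'
      using has_derivative_transform_within_open[OF _ assms(1) that(2), of g g' UNIV h]
        has_derivative_transform_within_open[OF _ assms(1) that(2), of h g' UNIV g] that(1) by metis
    then show ?thesis by (simp add: dir_deriv_def frechet_derivative_def at_within_open[OF that(2) assms(1)])
  qed
  show ?case
    unfolding polyharmonic.simps laplacian_def
    by (intro arg_cong[where f = uminus] sum.cong refl dir Suc)
qed simp

text \<open>
  Vanishing to order \<open>n\<close> on the unit sphere, for derivatives in all directions; the frozen normal direction
  is one of them.
\<close>

primrec vanishing :: "nat \<Rightarrow> ('a::euclidean_space \<Rightarrow> real) \<Rightarrow> bool" where
  "vanishing 0 f \<longleftrightarrow> True"
| "vanishing (Suc n) f \<longleftrightarrow> (\<forall>x\<in>sphere 0 1. f x = 0) \<and> (\<forall>x. f differentiable at x) \<and>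
     (\<forall>w. vanishing n (dir_deriv UNIV w f))"

lemma vanishing_SucI:
  assumes "\<And>x. (f has_derivative f' x) (at x)" "\<And>x. x \<in> sphere 0 1 \<Longrightarrow> f x = 0"
    "\<And>w. vanishing n (\<lambda>x. f' x w)"
  shows "vanishing (Suc n) f"
  using assms dir_deriv_UNIV_eq[OF assms(1)] by (auto simp: differentiable_def)

lemma vanishing_add: "vanishing n f \<Longrightarrow> vanishing n g \<Longrightarrow> vanishing n (\<lambda>x. f x + g x)"
proof (induction n arbitrary: f g)
  case (Suc n)
  have deriv: "(h has_derivative frechet_derivative h (at x)) (at x)" if "vanishing (Suc n) h" for h :: "'a \<Rightarrow> real" and x
    using that by (auto simp: frechet_derivative_works)
  show ?case
  proof (rule vanishing_SucI[OF has_derivative_add[OF deriv[OF Suc.prems(1)] deriv[OF Suc.prems(2)]]])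
    show "vanishing n (\<lambda>x. frechet_derivative f (at x) w + frechet_derivative g (at x) w)" for w
      using Suc.IH[of "dir_deriv UNIV w f" "dir_deriv UNIV w g"] Suc.prems by (simp add: dir_deriv_def[abs_def])
  qed (use Suc.prems in auto)
qed simp

text \<open>The innermost derivative is peeled off: on the closed ball it equals the ordinary
  derivative in the fixed direction \<open>x\<close>, which vanishes to one order less. The
  remaining derivatives see only values on the closed ball, so the replacement is harmless.\<close>

lemma normal_deriv_vanishing:
  fixes f :: "'a::euclidean_space \<Rightarrow> real"
  assumes "vanishing n f" "r < n" "x \<in> sphere 0 1"
  shows "normal_deriv r f x = 0"
proof -
  let ?D = "dir_deriv (cball 0 1) x"
  have cong: "(?D ^^ r) f y = (?D ^^ r) g y" if "\<And>y. y \<in> cball 0 1 \<Longrightarrow> f y = g y" "y \<in> cball 0 1" for f g r y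
    using that(2)
  proof (induction r arbitrary: y)
    case (Suc r)
    have "?D ((?D ^^ r) f) y = ?D ((?D ^^ r) g) y" by (rule dir_deriv_cong) (use Suc in auto)
    then show ?case by simp
  qed (use that in auto)
  have "(?D ^^ r) f x = 0"
    using assms(1,2)
  proof (induction r arbitrary: f n)
    case 0
    then show ?case using assms(3) by (cases n) auto
  next
    case (Suc r)
    then obtain n' where n: "n = Suc n'" by (cases n) auto
    have "(?D ^^ Suc r) f x = (?D ^^ r) (?D f) x" by (simp only: funpow_Suc_right o_apply)
    also have "\<dots> = (?D ^^ r) (dir_deriv UNIV x f) x"
      using Suc.prems n assms(3) by (intro cong dir_deriv_convex) auto
    also have "\<dots> = 0" using Suc.prems n by (intro Suc.IH[of n']) auto
    finally show ?case .
  qed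
  then show ?thesis by (simp add: normal_deriv_def)
qed

text \<open>A derivative either hits the polynomial factor or removes one backward integration. In
  derivatives of order below n \<le> k at least one integration is left, and it vanishes at s = 1/2,
  that is, on the unit sphere. The factors \<open>p\<close> and \<open>c\<close> make the class
  closed under differentiation.\<close>

lemma vanishing_backint:
  fixes p :: "'a::euclidean_space \<Rightarrow> real"
  assumes g: "continuous_on UNIV g" and p: "hom_poly a p" and "n \<le> k"
  shows "vanishing n (\<lambda>x. p x * (c * (backint (1/2) ^^ k) g (hsq x)))"
  using p \<open>n \<le> k\<close>
proof (induction n arbitrary: a p c k)
  case (Suc n)
  then obtain j where k: "k = Suc j" "n \<le> j" by (cases k) auto
  let ?K = "\<lambda>k. (backint (1/2) ^^ k) g"
  obtain p' where p': "\<And>x. (p has_derivative p' x) (at x)" "\<And>w. hom_poly (a - 1) (\<lambda>x. p' x w)"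
    using hom_poly_deriv[OF Suc.prems(1)] by auto
  have dK: "((\<lambda>s. c * ?K k s) has_real_derivative - c * ?K j s) (at s)" if "0 \<le> s" for s
    using DERIV_cmult[OF backint_deriv[OF backint_pow_continuous[OF g] that], of c "1/2" j "1/2"] by (simp add: k)
  show ?case
  proof (rule vanishing_SucI)
    show "((\<lambda>x. p x * (c * ?K k (hsq x))) has_derivative
        (\<lambda>v. p' x v * (c * ?K k (hsq x)) + (p x * (x \<bullet> v)) * (- c * ?K j (hsq x)))) (at x)" for x
      by (rule has_derivative_eq_rhs[OF has_derivative_mult[OF p'(1) hsq_compose_deriv[OF dK]]])
         (auto simp: fun_eq_iff algebra_simps)
    show "p x * (c * ?K k (hsq x)) = 0" if "x \<in> sphere 0 1" for x
    proof -
      have "?K k (1/2) = 0" by (simp add: k)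
      moreover have "hsq x = 1/2" using that by (simp add: hsq_norm)
      ultimately show ?thesis by (simp only: mult_zero_right)
    qed
    show "vanishing n (\<lambda>x. p' x w * (c * ?K k (hsq x)) + (p x * (x \<bullet> w)) * (- c * ?K j (hsq x)))" for w
      using k by (intro vanishing_add Suc.IH[OF p'(2)] Suc.IH[OF hom_poly_inner_mult[OF Suc.prems(1)]]) auto
  qed
qed simp

section \<open>Regularity, equation and boundary data of \<open>green\<close>\<close>

lemma green_Ck_on:
  assumes f: "continuous_on UNIV f"
  shows "Ck_on (2 * k) (\<lambda>x::'a::euclidean_space. c * green d b k f (hsq x)) UNIV"
proof -
  have cf: "continuous_on UNIV (\<lambda>s. c * f s)" by (intro continuous_intros f)
  obtain e where "\<And>s. green d b k (\<lambda>s. c * f s) s = (\<Sum>i<k. e i * s ^ i) + (inv_lap d ^^ k) (\<lambda>s. c * f s) s"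
    using green_eq[OF cf] by blast
  then show ?thesis using Ck_on_radial_solution[OF cf, where k = k and c = e and d = d and 'a = 'a]
    by (simp add: green_cmult)
qed

lemma green_polyharmonic:
  assumes f: "continuous_on UNIV f" and dim: "DIM('a::euclidean_space) = Suc d"
  shows "polyharmonic UNIV k (\<lambda>x::'a. c * green d b k f (hsq x)) = (\<lambda>x. c * f (hsq x))"
proof -
  have cf: "continuous_on UNIV (\<lambda>s. c * f s)" by (intro continuous_intros f)
  obtain e where "\<And>s. green d b k (\<lambda>s. c * f s) s = (\<Sum>i<k. e i * s ^ i) + (inv_lap d ^^ k) (\<lambda>s. c * f s) s"
    using green_eq[OF cf] by blast
  then show ?thesis using polyharmonic_radial_solution[OF cf dim, where k = k and c = e]
    by (simp add: green_cmult)
qed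

lemma green_normal_deriv:
  assumes "continuous_on UNIV f" "r < k" "x \<in> sphere 0 1"
  shows "normal_deriv r (\<lambda>x::'a::euclidean_space. c * green d (1/2) k f (hsq x)) x = 0"
proof -
  have "vanishing k (\<lambda>x::'a. 1 * (c * (backint (1/2) ^^ k) (avg_iter d k f) (hsq x)))"
    by (rule vanishing_backint[OF avg_iter_continuous[OF assms(1)] hom_poly.const order_refl])
  from normal_deriv_vanishing[OF this assms(2,3)] show ?thesis by (simp add: green_def)
qed

section \<open>Fixed points in spaces of continuous functions\<close>

lemma cube_convergent_subsequence:
  fixes z :: "nat \<Rightarrow> nat \<Rightarrow> real"
  assumes "\<And>k i. \<bar>z k i\<bar> \<le> M"
  obtains \<phi> l where "strict_mono \<phi>" "\<And>i. (\<lambda>k. z (\<phi> k) i) \<longlonglongrightarrow> l i"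
proof -
  obtain \<phi> where \<phi>: "strict_mono \<phi>" "\<And>i. i \<in> UNIV \<Longrightarrow> \<exists>l. (\<lambda>k. z (\<phi> k) i) \<longlonglongrightarrow> l"
    by (rule function_convergent_subsequence[of "UNIV :: nat set" z M]) (use assms in auto)
  then obtain l where "\<And>i. (\<lambda>k. z (\<phi> k) i) \<longlonglongrightarrow> l i" by (metis UNIV_I)
  then show ?thesis using \<phi>(1) that by blast
qed

text \<open>
  The dimension \<open>n\<close> is a term here, unlike in the library's \<open>brouwer_cube\<close>, where it is a type.
\<close>

lemma brouwer_unit_cube:
  fixes f :: "(nat \<Rightarrow> real) \<Rightarrow> nat \<Rightarrow> real"
  assumes range: "\<And>x i. (\<And>j. x j \<in> {0..1}) \<Longrightarrow> i < n \<Longrightarrow> f x i \<in> {0..1}"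
    and cont: "\<And>z x i. (\<And>k j. z k j \<in> {0..1}) \<Longrightarrow> (\<And>j. (\<lambda>k. z k j) \<longlonglongrightarrow> x j) \<Longrightarrow> i < n \<Longrightarrow>
      (\<lambda>k. f (z k) i) \<longlonglongrightarrow> f x i"
  obtains x where "\<And>j. x j \<in> {0..1}" "\<And>i. i < n \<Longrightarrow> f x i = x i"
proof -
  define pt where "pt p q j = (if j < n then real (q j) / real (Suc p) else 0)" for p and q :: "nat \<Rightarrow> nat" and j
  \<comment> \<open>Label 0 implies that \<open>f\<close> does not decrease coordinate
    \<open>i\<close>, label 1 that \<open>f\<close> does not increase it. On the face where the
    coordinate is 1 the second always holds, which allows the label prescribed there by Kuhn's
    lemma.\<close>
  define label where "label p q i = (if pt p q i \<noteq> 1 \<and> pt p q i \<le> f (pt p q) i then 0 else 1::nat)" for p q i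
  have pt: "pt p q j \<in> {0..1}" if "\<forall>j<n. q j \<le> Suc p" for p q j
    using that by (auto simp: pt_def)
  define adj where "adj q r \<longleftrightarrow> (\<forall>j<n. q j \<le> r j \<and> r j \<le> q j + 1)" for q r :: "nat \<Rightarrow> nat"
  have label01: "label p r i = 0 \<or> label p r i = 1" for p r i by (simp add: label_def)
  have "\<exists>q. (\<forall>i<n. q i < Suc p) \<and>
      (\<forall>i<n. \<exists>r s. adj q r \<and> adj q s \<and> label p r i = 0 \<and> label p s i = 1)" for p
  proof (rule kuhn_lemma[of "Suc p" n "label p"])
    show "\<forall>x. (\<forall>i<n. x i \<le> Suc p) \<longrightarrow> (\<forall>i<n. x i = 0 \<longrightarrow> label p x i = 0)"
    proof clarify
      fix x i assume x: "\<forall>i<n. x i \<le> Suc p" "i < n" "x i = 0"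
      then have "f (pt p x) i \<in> {0..1}" by (intro range pt) auto
      then show "label p x i = 0" using x by (auto simp: label_def pt_def)
    qed
    show "\<forall>x. (\<forall>i<n. x i \<le> Suc p) \<longrightarrow> (\<forall>i<n. x i = Suc p \<longrightarrow> label p x i = 1)"
      by (auto simp: label_def pt_def)
  next
    fix q assume q: "\<forall>i<n. q i < Suc p"
      "\<forall>i<n. \<exists>r s. (\<forall>j<n. q j \<le> r j \<and> r j \<le> q j + 1) \<and>
        (\<forall>j<n. q j \<le> s j \<and> s j \<le> q j + 1) \<and> label p r i \<noteq> label p s i"
    have vertices: "\<forall>i<n. \<exists>r s. adj q r \<and> adj q s \<and> label p r i \<noteq> label p s i"
      using q(2) unfolding adj_def .
    have "\<exists>r s. adj q r \<and> adj q s \<and> label p r i = 0 \<and> label p s i = 1" if i: "i < n" for i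
    proof -
      obtain r s where "adj q r" "adj q s" "label p r i \<noteq> label p s i"
        using vertices i by blast
      then show ?thesis using label01[of p r i] label01[of p s i] by metis
    qed
    then show ?thesis using q(1) by blast
  qed (use label01 in auto)
  then have "\<exists>q. \<forall>p. (\<forall>i<n. q p i < Suc p) \<and>
      (\<forall>i<n. \<exists>r s. adj (q p) r \<and> adj (q p) s \<and> label p r i = 0 \<and> label p s i = 1)"
    by (intro choice allI)
  then obtain q where q: "\<And>p i. i < n \<Longrightarrow> q p i < Suc p"
    and vertices: "\<And>p i. i < n \<Longrightarrow> \<exists>r s. adj (q p) r \<and> adj (q p) s \<and> label p r i = 0 \<and> label p s i = 1"
    by blast
  have "\<forall>p i. \<exists>r. i < n \<longrightarrow> adj (q p) r \<and> label p r i = 0" using vertices by blast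
  then have "\<exists>r. \<forall>p i. i < n \<longrightarrow> adj (q p) (r p i) \<and> label p (r p i) i = 0" by metis
  moreover have "\<forall>p i. \<exists>s. i < n \<longrightarrow> adj (q p) s \<and> label p s i = 1" using vertices by blast
  then have "\<exists>s. \<forall>p i. i < n \<longrightarrow> adj (q p) (s p i) \<and> label p (s p i) i = 1" by metis
  ultimately obtain r s where "\<And>p i. i < n \<Longrightarrow> adj (q p) (r p i)" "\<And>p i. i < n \<Longrightarrow> adj (q p) (s p i)"
    and rs: "\<And>p i. i < n \<Longrightarrow> label p (r p i) i = 0" "\<And>p i. i < n \<Longrightarrow> label p (s p i) i = 1"
    by blast
  then have r: "\<And>p i j. i < n \<Longrightarrow> j < n \<Longrightarrow> q p j \<le> r p i j \<and> r p i j \<le> q p j + 1"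
    and s: "\<And>p i j. i < n \<Longrightarrow> j < n \<Longrightarrow> q p j \<le> s p i j \<and> s p i j \<le> q p j + 1"
    by (auto simp: adj_def)
  have "\<bar>pt p (q p) j\<bar> \<le> 1" for p j using pt[of "q p" p j] q by (auto simp: less_imp_le)
  then obtain \<phi> x where \<phi>: "strict_mono \<phi>" and x: "\<And>j. (\<lambda>k. pt (\<phi> k) (q (\<phi> k)) j) \<longlonglongrightarrow> x j"
    using cube_convergent_subsequence[of "\<lambda>k. pt k (q k)" 1] by metis
  have x01: "x j \<in> {0..1}" for j
  proof -
    have "pt p (q p) j \<in> {0..1}" for p using q by (intro pt) (auto simp: less_imp_le)
    then show ?thesis using x[of j] LIMSEQ_le_const[OF x] LIMSEQ_le_const2[OF x] by (metis atLeastAtMost_iff)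
  qed
  \<comment> \<open>In each coordinate the vertices of a cell are within 1 / (p + 1) of its corner,
    so every choice of vertices has the same limit.\<close>
  have near: "(\<lambda>k. pt (\<phi> k) (t (\<phi> k)) j) \<longlonglongrightarrow> x j"
    if t: "\<And>p j. j < n \<Longrightarrow> q p j \<le> t p j \<and> t p j \<le> q p j + 1" for t j
  proof -
    have small: "(\<lambda>k. inverse (real (Suc (\<phi> k)))) \<longlonglongrightarrow> 0"
      using LIMSEQ_subseq_LIMSEQ[OF LIMSEQ_inverse_real_of_nat \<phi>] by (simp add: o_def)
    have "norm (pt (\<phi> k) (t (\<phi> k)) j - pt (\<phi> k) (q (\<phi> k)) j) \<le> inverse (real (Suc (\<phi> k)))" for k
    proof (cases "j < n")
      case True
      have "\<bar>real (t (\<phi> k) j) - real (q (\<phi> k) j)\<bar> \<le> 1" using t[OF True, of "\<phi> k"] by linarith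
      then show ?thesis
        using True by (simp add: pt_def inverse_eq_divide diff_divide_distrib[symmetric] divide_right_mono abs_divide)
    qed (simp add: pt_def)
    then have "(\<lambda>k. pt (\<phi> k) (t (\<phi> k)) j - pt (\<phi> k) (q (\<phi> k)) j) \<longlonglongrightarrow> 0"
      by (intro Lim_null_comparison[OF always_eventually small] allI)
    from tendsto_add[OF this x[of j]] show ?thesis by simp
  qed
  have le: "\<forall>j<n. t j \<le> Suc p" if "\<And>j. j < n \<Longrightarrow> q p j \<le> t j \<and> t j \<le> q p j + 1" for p t
    using that q[of _ p] by (metis Suc_eq_plus1 Suc_leI le_trans)
  \<comment> \<open>The vertices labelled 0 give x i \<le> f x i in the limit, those labelled 1 the
    opposite inequality.\<close>
  have "f x i = x i" if i: "i < n" for i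
  proof (rule antisym)
    have r01: "pt (\<phi> k) (r (\<phi> k) i) j \<in> {0..1}" and s01: "pt (\<phi> k) (s (\<phi> k) i) j \<in> {0..1}" for k j
      using r[OF i] s[OF i] by (intro pt le; blast)+
    have "(\<lambda>k. f (pt (\<phi> k) (r (\<phi> k) i)) i) \<longlonglongrightarrow> f x i"
      by (intro cont r01 near[of "\<lambda>p. r p i"] r i)
    moreover have "pt (\<phi> k) (r (\<phi> k) i) i \<le> f (pt (\<phi> k) (r (\<phi> k) i)) i" for k
      using rs(1)[OF i, of "\<phi> k"] by (auto simp: label_def split: if_splits)
    ultimately show "x i \<le> f x i"
      using near[of "\<lambda>p. r p i" i] r[OF i] LIMSEQ_le by blast
    have "(\<lambda>k. f (pt (\<phi> k) (s (\<phi> k) i)) i) \<longlonglongrightarrow> f x i"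
      by (intro cont s01 near[of "\<lambda>p. s p i"] s i)
    moreover have "f (pt (\<phi> k) (s (\<phi> k) i)) i \<le> pt (\<phi> k) (s (\<phi> k) i) i" for k
    proof -
      have "f (pt (\<phi> k) (s (\<phi> k) i)) i \<le> 1" using range[OF s01 i] by auto
      then show ?thesis
        using rs(2)[OF i, of "\<phi> k"] by (auto simp: label_def split: if_splits)
    qed
    ultimately show "f x i \<le> x i"
      using near[of "\<lambda>p. s p i" i] s[OF i] LIMSEQ_le by blast
  qed
  then show ?thesis using that x01 by blast
qed

text \<open>Arzela-Ascoli on the half-line: a diagonal subsequence converges at the nonnegative
  rationals, and the Lipschitz bounds extend this to all points. The bounds hold from an index
  depending on the interval, as is natural for solutions on growing balls.\<close>

lemma locally_lipschitz_convergent_subsequence: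
  fixes F :: "nat \<Rightarrow> real \<Rightarrow> real"
  assumes bd: "\<And>\<rho>. \<exists>C. \<forall>\<^sub>F n in sequentially. \<forall>r\<in>{0..\<rho>}. \<bar>F n r\<bar> \<le> C"
    and lip: "\<And>\<rho>. \<exists>C. \<forall>\<^sub>F n in sequentially. \<forall>r\<in>{0..\<rho>}. \<forall>s\<in>{0..\<rho>}. \<bar>F n r - F n s\<bar> \<le> C * \<bar>r - s\<bar>"
  obtains \<phi> f where "strict_mono \<phi>" "\<And>s. 0 \<le> s \<Longrightarrow> (\<lambda>k. F (\<phi> k) s) \<longlonglongrightarrow> f s" "continuous_on {0..} f"
proof -
  have "\<exists>K>0. \<forall>n. \<bar>F n s\<bar> \<le> K" if s: "0 \<le> s" for s
  proof -
    obtain C where "\<forall>\<^sub>F n in sequentially. \<forall>r\<in>{0..s}. \<bar>F n r\<bar> \<le> C" using bd by blast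
    then have "\<forall>\<^sub>F n in sequentially. norm (F n s) \<le> C" by eventually_elim (use s in auto)
    then have "Bseq (\<lambda>n. F n s)" by (rule BfunI)
    then show ?thesis by (auto simp: Bseq_def)
  qed
  then obtain K where K: "\<And>s. 0 \<le> s \<Longrightarrow> 0 < K s" "\<And>n s. 0 \<le> s \<Longrightarrow> \<bar>F n s\<bar> \<le> K s"
    by metis
  define S where "S = {s\<in>\<rat>. (0::real) \<le> s}"
  have "countable S" unfolding S_def using countable_rat by (rule countable_subset[rotated]) auto
  \<comment> \<open>Dividing by the pointwise bound \<open>K s\<close> provides the uniform bound
    under which the diagonal argument is available.\<close>
  moreover have "norm (F n s / K s) \<le> 1" if "s \<in> S" for n s
    using K(1)[of s] K(2)[of s n] that by (simp add: S_def abs_divide divide_le_eq)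
  ultimately obtain \<phi> where \<phi>: "strict_mono \<phi>"
    and conv: "\<And>s. s \<in> S \<Longrightarrow> \<exists>l. (\<lambda>k. F (\<phi> k) s / K s) \<longlonglongrightarrow> l"
    using function_convergent_subsequence[of S "\<lambda>n s. F n s / K s" 1] by blast
  have S_conv: "Cauchy (\<lambda>k. F (\<phi> k) s)" if "s \<in> S" for s
  proof -
    obtain l where "(\<lambda>k. F (\<phi> k) s / K s) \<longlonglongrightarrow> l" using conv \<open>s \<in> S\<close> by blast
    then have "(\<lambda>k. F (\<phi> k) s / K s * K s) \<longlonglongrightarrow> l * K s" by (intro tendsto_intros)
    then show ?thesis using K(1)[of s] that LIMSEQ_imp_Cauchy by (auto simp: S_def)
  qed
  have lip': "\<exists>C>0. \<forall>\<^sub>F k in sequentially. \<forall>r\<in>{0..\<rho>}. \<forall>s\<in>{0..\<rho>}. \<bar>F (\<phi> k) r - F (\<phi> k) s\<bar> \<le> C * \<bar>r - s\<bar>" for \<rho>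
  proof -
    obtain C where "\<forall>\<^sub>F n in sequentially. \<forall>r\<in>{0..\<rho>}. \<forall>s\<in>{0..\<rho>}. \<bar>F n r - F n s\<bar> \<le> C * \<bar>r - s\<bar>"
      using lip by blast
    then have "\<forall>\<^sub>F k in sequentially. \<forall>r\<in>{0..\<rho>}. \<forall>s\<in>{0..\<rho>}. \<bar>F (\<phi> k) r - F (\<phi> k) s\<bar> \<le> C * \<bar>r - s\<bar>"
      by (rule eventually_subseq[OF \<phi>])
    then have "\<forall>\<^sub>F k in sequentially. \<forall>r\<in>{0..\<rho>}. \<forall>s\<in>{0..\<rho>}. \<bar>F (\<phi> k) r - F (\<phi> k) s\<bar> \<le> (\<bar>C\<bar> + 1) * \<bar>r - s\<bar>"
      by eventually_elim (meson abs_ge_self abs_ge_zero add_increasing2 mult_right_mono order_trans zero_le_one)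
    then show ?thesis by (intro exI[of _ "\<bar>C\<bar> + 1"]) auto
  qed
  have "Cauchy (\<lambda>k. F (\<phi> k) s)" if s: "0 \<le> s" for s
  proof (rule metric_CauchyI)
    fix e :: real assume e: "0 < e"
    obtain C where C: "C > 0" and evC: "\<forall>\<^sub>F k in sequentially. \<forall>r\<in>{0..s+1}. \<forall>t\<in>{0..s+1}. \<bar>F (\<phi> k) r - F (\<phi> k) t\<bar> \<le> C * \<bar>r - t\<bar>"
      using lip' by blast
    obtain r where r: "r \<in> \<rat>" "s < r" "r < s + min 1 (e / (3 * C))"
      using Rats_dense_in_real[of s "s + min 1 (e / (3 * C))"] e C by auto
    then have rS: "r \<in> S" using s by (simp add: S_def)
    have "r - s < e / (3 * C)" using r(3) by auto
    then have near: "C * \<bar>s - r\<bar> < e / 3" using r(2) C by (simp add: field_simps)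
    have "\<forall>\<^sub>F k in sequentially. \<bar>F (\<phi> k) s - F (\<phi> k) r\<bar> < e / 3"
      using evC
    proof eventually_elim
      case (elim k)
      moreover have "s \<in> {0..s+1}" "r \<in> {0..s+1}" using s r by auto
      ultimately have "\<bar>F (\<phi> k) s - F (\<phi> k) r\<bar> \<le> C * \<bar>s - r\<bar>" by blast
      then show ?case using near by linarith
    qed
    then obtain M1 where M1: "\<And>k. k \<ge> M1 \<Longrightarrow> \<bar>F (\<phi> k) s - F (\<phi> k) r\<bar> < e / 3"
      by (auto simp: eventually_sequentially)
    obtain M2 where M2: "\<And>m n. m \<ge> M2 \<Longrightarrow> n \<ge> M2 \<Longrightarrow> dist (F (\<phi> m) r) (F (\<phi> n) r) < e / 3"
      using metric_CauchyD[OF S_conv[OF rS], of "e/3"] e by auto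
    have "dist (F (\<phi> m) s) (F (\<phi> n) s) < e" if "m \<ge> max M1 M2" "n \<ge> max M1 M2" for m n
      using M1[of m] M1[of n] M2[of m n] that unfolding dist_real_def by linarith
    then show "\<exists>M. \<forall>m\<ge>M. \<forall>n\<ge>M. dist (F (\<phi> m) s) (F (\<phi> n) s) < e" by blast
  qed
  then have "\<exists>l. (\<lambda>k. F (\<phi> k) s) \<longlonglongrightarrow> l" if "0 \<le> s" for s
    using that by (simp add: Cauchy_convergent_iff convergent_def)
  then obtain f where f: "\<And>s. 0 \<le> s \<Longrightarrow> (\<lambda>k. F (\<phi> k) s) \<longlonglongrightarrow> f s" by metis
  have "continuous_on {0..} f"
    unfolding continuous_on_eq_continuous_within
  proof
    fix s :: real assume "s \<in> {0..}"
    then have s: "0 \<le> s" by simp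
    obtain C where C: "C > 0" and evC: "\<forall>\<^sub>F k in sequentially. \<forall>r\<in>{0..s+1}. \<forall>t\<in>{0..s+1}. \<bar>F (\<phi> k) r - F (\<phi> k) t\<bar> \<le> C * \<bar>r - t\<bar>"
      using lip' by blast
    have le: "\<bar>f r - f s\<bar> \<le> C * \<bar>r - s\<bar>" if "r \<in> {0..s+1}" for r
    proof (rule tendsto_upperbound)
      show "(\<lambda>k. \<bar>F (\<phi> k) r - F (\<phi> k) s\<bar>) \<longlonglongrightarrow> \<bar>f r - f s\<bar>"
        using f s that by (intro tendsto_intros) auto
      show "\<forall>\<^sub>F k in sequentially. \<bar>F (\<phi> k) r - F (\<phi> k) s\<bar> \<le> C * \<bar>r - s\<bar>"
        using evC by eventually_elim (use that s in auto)
    qed simp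
    show "continuous (at s within {0..}) f"
      unfolding continuous_within_eps_delta
    proof (intro allI impI)
      fix e :: real assume e: "0 < e"
      show "\<exists>d>0. \<forall>r\<in>{0..}. dist r s < d \<longrightarrow> dist (f r) (f s) < e"
      proof (intro exI[of _ "min 1 (e / C)"] conjI ballI impI)
        fix r assume r: "r \<in> {0..}" "dist r s < min 1 (e / C)"
        then have "\<bar>f r - f s\<bar> \<le> C * \<bar>r - s\<bar>" by (intro le) (auto simp: dist_real_def)
        also have "\<dots> < e" using r C by (simp add: dist_real_def field_simps)
        finally show "dist (f r) (f s) < e" by (simp add: dist_real_def)
      qed (use e C in auto)
    qed
  qed
  with \<phi> f show ?thesis using that by blast
qed


section \<open>Schauder's theorem on an interval\<close>

definition unit_valued :: "(real \<Rightarrow> real) \<Rightarrow> bool" where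
  "unit_valued u \<longleftrightarrow> continuous_on UNIV u \<and> (\<forall>s. u s \<in> {0..1})"

text \<open>Composition with it extends a function continuously from the interval to the line, as
  the integral operators require.\<close>

definition clamp_to :: "real \<Rightarrow> real \<Rightarrow> real" where
  "clamp_to b s = max 0 (min b s)"

lemma clamp_to_in: "0 < b \<Longrightarrow> clamp_to b s \<in> {0..b}"
  by (auto simp: clamp_to_def)

lemma clamp_to_id: "s \<in> {0..b} \<Longrightarrow> clamp_to b s = s"
  by (auto simp: clamp_to_def)

lemma clamp_to_continuous [continuous_intros]: "continuous_on A (clamp_to b)"
  unfolding clamp_to_def[abs_def] by (intro continuous_intros)

lemma clamp_to_lipschitz: "\<bar>clamp_to b r - clamp_to b s\<bar> \<le> \<bar>r - s\<bar>"
  by (auto simp: clamp_to_def max_def min_def)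

text \<open>Node values are turned into a function by a partition of unity, and evaluating its image
  at the nodes maps a cube into itself. Brouwer's theorem gives an interpolant \<open>u\<close>
  whose node values are those of \<open>\<Phi> u\<close>. Only nodes within 2 \<delta> contribute at
  a given point, hence the error.\<close>

lemma schauder_approx:
  fixes \<Phi> :: "(real \<Rightarrow> real) \<Rightarrow> real \<Rightarrow> real"
  assumes b: "0 < b"
    and range: "\<And>u s. unit_valued u \<Longrightarrow> s \<in> {0..b} \<Longrightarrow> \<Phi> u s \<in> {0..1}"
    and lip: "\<And>u r s. unit_valued u \<Longrightarrow> r \<in> {0..b} \<Longrightarrow> s \<in> {0..b} \<Longrightarrow> \<bar>\<Phi> u r - \<Phi> u s\<bar> \<le> L * \<bar>r - s\<bar>"
    and cont: "\<And>U u s. (\<And>k::nat. unit_valued (U k)) \<Longrightarrow> unit_valued u \<Longrightarrow> (\<And>s. (\<lambda>k. U k s) \<longlonglongrightarrow> u s) \<Longrightarrow>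
      s \<in> {0..b} \<Longrightarrow> (\<lambda>k. \<Phi> (U k) s) \<longlonglongrightarrow> \<Phi> u s"
  obtains u where "unit_valued u" "\<And>s. \<bar>u s - \<Phi> u (clamp_to b s)\<bar> \<le> L * (2 * (b / real (Suc n)))"
proof -
  define \<delta> where "\<delta> = b / real (Suc n)"
  have \<delta>: "0 < \<delta>" "real (Suc n) * \<delta> = b" using b by (auto simp: \<delta>_def)
  \<comment> \<open>The nodes k \<delta> for k = 0, ..., n + 1 include both ends of the
    interval.\<close>
  define N where "N = n + 2"
  define x where "x k = real k * \<delta>" for k :: nat
  have x: "x k \<in> {0..b}" if "k < N" for k
  proof -
    have "real k * \<delta> \<le> real (Suc n) * \<delta>" using that \<delta> by (intro mult_right_mono) (auto simp: N_def)
    then show ?thesis using \<delta> by (auto simp: x_def)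
  qed
  define \<psi> where "\<psi> k s = max 0 (2 * \<delta> - \<bar>clamp_to b s - x k\<bar>)" for k s
  define W where "W s = (\<Sum>k<N. \<psi> k s)" for s
  have \<psi>: "0 \<le> \<psi> k s" for k s by (simp add: \<psi>_def)
  have W: "0 < W s" for s
  proof -
    define t where "t = clamp_to b s"
    have t: "0 \<le> t" "t \<le> b" using clamp_to_in[OF b, of s] by (auto simp: t_def)
    \<comment> \<open>The last node not exceeding \<open>t\<close> is less than \<delta> away, while
      the hat functions have half-width 2 \<delta>; hence some weight is positive.\<close>
    define k where "k = nat \<lfloor>t / \<delta>\<rfloor>"
    have "0 \<le> t / \<delta>" using t \<delta> by simp
    then have k: "real k \<le> t / \<delta>" "t / \<delta> < real k + 1" by (auto simp: k_def) 
    have "t / \<delta> \<le> real (Suc n)" using t \<delta> by (simp add: divide_le_eq)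
    then have kN: "k < N" using k(1) unfolding N_def by linarith
    have "x k \<le> t" "t < x k + \<delta>" using k \<delta> by (auto simp: x_def field_simps)
    then have "0 < \<psi> k s" using \<delta> by (simp add: \<psi>_def t_def[symmetric])
    then show ?thesis unfolding W_def using kN \<psi> by (intro sum_pos2[of _ k]) auto
  qed
  define ip where "ip c s = (\<Sum>k<N. c k * \<psi> k s) / W s" for c :: "nat \<Rightarrow> real" and s
  have \<psi>_cont: "continuous_on UNIV (\<psi> k)" for k
    unfolding \<psi>_def[abs_def] by (intro continuous_intros)
  have W_cont: "continuous_on UNIV W" unfolding W_def[abs_def] by (intro continuous_intros \<psi>_cont)
  have ip: "unit_valued (ip c)" if c: "\<And>k. c k \<in> {0..1}" for c
  proof -
    have "continuous_on UNIV (ip c)"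
      unfolding ip_def[abs_def] using W by (intro continuous_intros \<psi>_cont W_cont) (auto simp: less_imp_neq[OF W, symmetric])
    moreover have "ip c s \<in> {0..1}" for s
    proof -
      have "(\<Sum>k<N. c k * \<psi> k s) \<le> (\<Sum>k<N. 1 * \<psi> k s)" "0 \<le> (\<Sum>k<N. c k * \<psi> k s)"
        using c \<psi> by (auto intro!: sum_mono sum_nonneg mult_left_le_one_le)
      then show ?thesis using W[of s] by (auto simp: ip_def W_def divide_le_eq)
    qed
    ultimately show ?thesis by (simp add: unit_valued_def)
  qed
  obtain c where c: "\<And>k. c k \<in> {0..1}" "\<And>k. k < N \<Longrightarrow> \<Phi> (ip c) (x k) = c k"
  proof (rule brouwer_unit_cube[of N "\<lambda>c k. \<Phi> (ip c) (x k)"])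
    show "\<Phi> (ip c) (x i) \<in> {0..1}" if "\<And>j. c j \<in> {0..1}" "i < N" for c i
      using that by (intro range ip x)
    show "(\<lambda>k. \<Phi> (ip (z k)) (x i)) \<longlonglongrightarrow> \<Phi> (ip c) (x i)"
      if "\<And>k j. z k j \<in> {0..1}" "\<And>j. (\<lambda>k. z k j) \<longlonglongrightarrow> c j" "i < N" for z c i
    proof (intro cont ip x that)
      show "c j \<in> {0..1}" for j
        using that(1) LIMSEQ_le_const[OF that(2)] LIMSEQ_le_const2[OF that(2)] by (metis atLeastAtMost_iff)
      show "(\<lambda>k. ip (z k) s) \<longlonglongrightarrow> ip c s" for s
        unfolding ip_def using W[of s] by (intro tendsto_intros that(2)) auto
    qed
  qed blast
  define u where "u = ip c"
  have u: "unit_valued u" unfolding u_def by (intro ip c)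
  have "\<bar>u s - \<Phi> u (clamp_to b s)\<bar> \<le> L * (2 * \<delta>)" for s
  proof -
    define y where "y = \<Phi> u (clamp_to b s)"
    have L: "0 \<le> L" using order_trans[OF abs_ge_zero lip[OF u, of b 0]] b by (simp add: zero_le_mult_iff)
    have "\<bar>(c k - y) * \<psi> k s\<bar> \<le> L * (2 * \<delta>) * \<psi> k s" if "k < N" for k
    proof (cases "\<psi> k s = 0")
      case False
      then have "\<bar>x k - clamp_to b s\<bar> \<le> 2 * \<delta>" by (auto simp: \<psi>_def max_def split: if_splits)
      moreover have "\<bar>c k - y\<bar> \<le> L * \<bar>x k - clamp_to b s\<bar>"
        using lip[OF u x[OF that] clamp_to_in[OF b, of s]] c(2)[OF that] by (simp add: y_def u_def)
      ultimately have "\<bar>c k - y\<bar> \<le> L * (2 * \<delta>)" using L by (meson mult_left_mono order_trans)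
      then show ?thesis using \<psi>[of k s] by (simp add: abs_mult mult_right_mono)
    qed simp
    then have "(\<Sum>k<N. \<bar>(c k - y) * \<psi> k s\<bar>) \<le> (\<Sum>k<N. L * (2 * \<delta>) * \<psi> k s)" by (intro sum_mono) auto
    then have "\<bar>\<Sum>k<N. (c k - y) * \<psi> k s\<bar> \<le> L * (2 * \<delta>) * W s"
      by (simp add: W_def sum_distrib_left) (rule order_trans[OF sum_abs])
    \<comment> \<open>The weights divided by \<open>W s\<close> sum to 1, so the error is a weighted
      mean of the differences \<open>c k - y\<close>.\<close>
    moreover have "u s - y = (\<Sum>k<N. (c k - y) * \<psi> k s) / W s"
    proof -
      have "(\<Sum>k<N. (c k - y) * \<psi> k s) = (\<Sum>k<N. c k * \<psi> k s) - y * W s"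
        by (simp add: W_def left_diff_distrib sum_subtractf sum_distrib_left)
      then show ?thesis using W[of s] by (simp add: u_def ip_def diff_divide_distrib)
    qed
    ultimately show ?thesis using W[of s] by (simp add: y_def[symmetric] abs_divide divide_le_eq)
  qed
  then show ?thesis using that u \<delta>_def by blast
qed

text \<open>The images of the approximate fixed points are equi-Lipschitz and thus converge along a
  subsequence. The approximate fixed points differ from their images by a null sequence, so they
  have the same limit, and continuity of \<open>\<Phi>\<close> makes it a fixed point.\<close>

lemma schauder_interval:
  fixes \<Phi> :: "(real \<Rightarrow> real) \<Rightarrow> real \<Rightarrow> real"
  assumes b: "0 < b"
    and range: "\<And>u s. unit_valued u \<Longrightarrow> s \<in> {0..b} \<Longrightarrow> \<Phi> u s \<in> {0..1}"
    and lip: "\<And>u r s. unit_valued u \<Longrightarrow> r \<in> {0..b} \<Longrightarrow> s \<in> {0..b} \<Longrightarrow> \<bar>\<Phi> u r - \<Phi> u s\<bar> \<le> L * \<bar>r - s\<bar>"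
    and cont: "\<And>U u s. (\<And>k::nat. unit_valued (U k)) \<Longrightarrow> unit_valued u \<Longrightarrow> (\<And>s. (\<lambda>k. U k s) \<longlonglongrightarrow> u s) \<Longrightarrow>
      s \<in> {0..b} \<Longrightarrow> (\<lambda>k. \<Phi> (U k) s) \<longlonglongrightarrow> \<Phi> u s"
  obtains u where "unit_valued u" "\<And>s. s \<in> {0..b} \<Longrightarrow> u s = \<Phi> u s"
proof -
  have "\<exists>u. unit_valued u \<and> (\<forall>s. \<bar>u s - \<Phi> u (clamp_to b s)\<bar> \<le> L * (2 * (b / real (Suc n))))" for n
    using schauder_approx[where n = n and \<Phi> = \<Phi>, OF b range lip cont] by blast
  then obtain U where U: "\<And>n. unit_valued (U n)"
    and approx: "\<And>n s. \<bar>U n s - \<Phi> (U n) (clamp_to b s)\<bar> \<le> L * (2 * (b / real (Suc n)))" by metis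
  have L: "0 \<le> L" using order_trans[OF abs_ge_zero lip[OF U, of b 0]] b by (simp add: zero_le_mult_iff)
  define F where "F n s = \<Phi> (U n) (clamp_to b s)" for n s
  have F01: "F n s \<in> {0..1}" for n s unfolding F_def by (intro range U clamp_to_in b)
  have Flip: "\<bar>F n r - F n s\<bar> \<le> L * \<bar>r - s\<bar>" for n r s
  proof -
    have "\<bar>F n r - F n s\<bar> \<le> L * \<bar>clamp_to b r - clamp_to b s\<bar>"
      unfolding F_def by (intro lip U clamp_to_in b)
    also have "\<dots> \<le> L * \<bar>r - s\<bar>" by (intro mult_left_mono clamp_to_lipschitz L)
    finally show ?thesis .
  qed
  obtain \<phi> w where \<phi>: "strict_mono \<phi>" and w: "\<And>s. 0 \<le> s \<Longrightarrow> (\<lambda>k. F (\<phi> k) s) \<longlonglongrightarrow> w s"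
    and w_cont: "continuous_on {0..} w"
  proof (rule locally_lipschitz_convergent_subsequence[of F])
    show "\<exists>C. \<forall>\<^sub>F n in sequentially. \<forall>r\<in>{0..\<rho>}. \<bar>F n r\<bar> \<le> C" for \<rho>
    proof (intro exI[of _ 1] always_eventually allI ballI)
      show "\<bar>F n r\<bar> \<le> 1" for n r using F01[of n r] by simp
    qed
    show "\<exists>C. \<forall>\<^sub>F n in sequentially. \<forall>r\<in>{0..\<rho>}. \<forall>s\<in>{0..\<rho>}. \<bar>F n r - F n s\<bar> \<le> C * \<bar>r - s\<bar>" for \<rho>
      by (intro exI[of _ L] always_eventually allI ballI Flip)
  qed blast
  define u where "u s = w (clamp_to b s)" for s
  have cl: "0 \<le> clamp_to b s" for s by (simp add: clamp_to_def)
  have Uu: "(\<lambda>k. U (\<phi> k) s) \<longlonglongrightarrow> u s" for s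
  proof -
    have "(\<lambda>k. L * (2 * (b / real (Suc (\<phi> k))))) \<longlonglongrightarrow> L * (2 * 0)"
    proof (intro tendsto_mult tendsto_const)
      have "(\<lambda>n. b / real (Suc n)) \<longlonglongrightarrow> 0"
        using tendsto_mult[OF tendsto_const[of b] LIMSEQ_inverse_real_of_nat] by (simp add: divide_inverse)
      from LIMSEQ_subseq_LIMSEQ[OF this \<phi>] show "(\<lambda>k. b / real (Suc (\<phi> k))) \<longlonglongrightarrow> 0" by (simp add: o_def)
    qed
    then have small: "(\<lambda>k. L * (2 * (b / real (Suc (\<phi> k))))) \<longlonglongrightarrow> 0" by (simp only: mult_zero_right)
    have "(\<lambda>k. U (\<phi> k) s - F (\<phi> k) s) \<longlonglongrightarrow> 0"
      by (rule Lim_null_comparison[OF always_eventually small]) (simp only: F_def approx real_norm_def, simp)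
    moreover have "(\<lambda>k. F (\<phi> k) s) \<longlonglongrightarrow> u s"
    proof -
      have "F n s = F n (clamp_to b s)" for n
        using clamp_to_id[OF clamp_to_in[OF b]] by (simp add: F_def)
      then show ?thesis using w[OF cl, of s] by (simp add: u_def)
    qed
    ultimately have "(\<lambda>k. (U (\<phi> k) s - F (\<phi> k) s) + F (\<phi> k) s) \<longlonglongrightarrow> 0 + u s" by (rule tendsto_add)
    then show ?thesis by simp
  qed
  have u: "unit_valued u"
    unfolding unit_valued_def
  proof (intro conjI allI)
    show "continuous_on UNIV u"
      unfolding u_def[abs_def]
      by (rule continuous_on_compose2[OF w_cont]) (auto intro: continuous_intros cl)
    show "u s \<in> {0..1}" for s
      using U LIMSEQ_le_const[OF Uu] LIMSEQ_le_const2[OF Uu] unfolding unit_valued_def by (metis atLeastAtMost_iff)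
  qed
  show ?thesis
  proof (rule that[OF u])
    fix s assume s: "s \<in> {0..b}"
    have "(\<lambda>k. \<Phi> (U (\<phi> k)) s) \<longlonglongrightarrow> \<Phi> u s" by (intro cont U u Uu s)
    moreover have "(\<lambda>k. \<Phi> (U (\<phi> k)) s) \<longlonglongrightarrow> u s"
      using w[of s] s by (simp add: F_def u_def clamp_to_id)
    ultimately show "u s = \<Phi> u s" by (rule LIMSEQ_unique[rotated])
  qed
qed

section \<open>Compactness of radial solutions\<close>

text \<open>
  \<open>Q\<close> will be boundedness, convergence or vanishing of a sequence; \<open>P (2 s) - 2\<^sup>k P s\<close> eliminates the
  top coefficient.
\<close>

lemma polynomial_coefficients:
  fixes c :: "nat \<Rightarrow> nat \<Rightarrow> real"
  assumes lin: "\<And>x y a b. Q x \<Longrightarrow> Q y \<Longrightarrow> Q (\<lambda>n. a * x n + b * y n)"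
    and Q: "\<And>s. 0 < s \<Longrightarrow> Q (\<lambda>n. \<Sum>i<k. c n i * s ^ i)" and "i < k"
  shows "Q (\<lambda>n. c n i)"
  using Q \<open>i < k\<close>
proof (induction k arbitrary: c i)
  case (Suc k)
  have low: "Q (\<lambda>n. c n j)" if "j < k" for j
  proof -
    have "Q (\<lambda>n. (2 ^ j - 2 ^ k) * c n j)"
    proof (rule Suc.IH[OF _ that])
      fix s :: real assume s: "0 < s"
      have "Q (\<lambda>n. 1 * (\<Sum>i<Suc k. c n i * (2 * s) ^ i) + (- (2 ^ k)) * (\<Sum>i<Suc k. c n i * s ^ i))"
        using s by (intro lin Suc.prems) auto
      moreover have "1 * (\<Sum>i<Suc k. c n i * (2 * s) ^ i) + (- (2 ^ k)) * (\<Sum>i<Suc k. c n i * s ^ i)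
          = (\<Sum>i<k. (2 ^ i - 2 ^ k) * c n i * s ^ i)" for n
        by (simp add: power_mult_distrib sum_distrib_left left_diff_distrib right_diff_distrib sum_subtractf sum_negf mult_ac distrib_left)
      ultimately show "Q (\<lambda>n. \<Sum>i<k. (2 ^ i - 2 ^ k) * c n i * s ^ i)" by (simp only:)
    qed
    from lin[OF this this, of "1 / (2 ^ j - 2 ^ k)" 0] show ?thesis using that by simp
  qed
  have Q0: "Q (\<lambda>n. 0)" using lin[OF Suc.prems(1) Suc.prems(1), of 1 1 0 0] by simp
  have "Q (\<lambda>n. \<Sum>j<m. c n j)" if "m \<le> k" for m
    using that
  proof (induction m)
    case (Suc m)
    then show ?case using lin[OF Suc.IH low, of m 1 1] by simp
  qed (use Q0 in simp)
  from lin[OF Suc.prems(1)[of 1] this[of k], of 1 "-1"] have "Q (\<lambda>n. c n k)" by simp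
  then show ?case using low Suc.prems(2) by (cases "i = k") auto
qed simp

lemma polynomial_coefficients_Bseq:
  fixes c :: "nat \<Rightarrow> nat \<Rightarrow> real"
  assumes "\<And>s. 0 < s \<Longrightarrow> Bseq (\<lambda>n. \<Sum>i<k. c n i * s ^ i)" "i < k"
  shows "Bseq (\<lambda>n. c n i)"
proof (rule polynomial_coefficients[where Q = Bseq and k = k and c = c])
  fix x y :: "nat \<Rightarrow> real" and a b :: real assume "Bseq x" "Bseq y"
  then obtain K L where K: "\<And>n. norm (x n) \<le> K" and L: "\<And>n. norm (y n) \<le> L"
    unfolding Bseq_def by auto
  show "Bseq (\<lambda>n. a * x n + b * y n)"
  proof (rule BseqI')
    fix n
    have "\<bar>a\<bar> * \<bar>x n\<bar> \<le> \<bar>a\<bar> * K" "\<bar>b\<bar> * \<bar>y n\<bar> \<le> \<bar>b\<bar> * L"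
      using K[of n] L[of n] by (auto intro!: mult_left_mono)
    then show "norm (a * x n + b * y n) \<le> \<bar>a\<bar> * K + \<bar>b\<bar> * L"
      using abs_triangle_ineq[of "a * x n" "b * y n"] by (simp add: abs_mult)
  qed
qed (use assms in auto)

lemma polynomial_coefficients_convergent:
  fixes c :: "nat \<Rightarrow> nat \<Rightarrow> real"
  assumes "\<And>s. 0 < s \<Longrightarrow> convergent (\<lambda>n. \<Sum>i<k. c n i * s ^ i)" "i < k"
  shows "convergent (\<lambda>n. c n i)"
proof (rule polynomial_coefficients[where Q = convergent and k = k and c = c])
  show "convergent (\<lambda>n. a * x n + b * y n)" if "convergent x" "convergent y" for x y and a b :: real
    using convergent_add[OF convergent_mult[OF convergent_const that(1)] convergent_mult[OF convergent_const that(2)]]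
    by simp
qed (use assms in auto)

lemma polynomial_coefficients_zero:
  fixes c :: "nat \<Rightarrow> real"
  assumes "\<And>s. 0 < s \<Longrightarrow> (\<Sum>i<k. c i * s ^ i) = 0" "i < k"
  shows "c i = 0"
  using polynomial_coefficients[where Q = "\<lambda>x. \<forall>n::nat. x n = (0::real)" and k = k and c = "\<lambda>n. c" and i = i] assms by auto

text \<open>The bound holds at all points (n + 1) s, so the coefficients c i (n + 1)^i of the
  rescaled polynomials are bounded in n, which for i > 0 forces c i = 0.\<close>

lemma bounded_polynomial_constant:
  fixes c :: "nat \<Rightarrow> real"
  assumes "\<And>s. 0 < s \<Longrightarrow> \<bar>\<Sum>i<k. c i * s ^ i\<bar> \<le> C" "i < k" "0 < i"
  shows "c i = 0"
proof (rule ccontr)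
  assume c: "c i \<noteq> 0"
  have "Bseq (\<lambda>n. c i * real (Suc n) ^ i)"
  proof (rule polynomial_coefficients_Bseq[where k = k and c = "\<lambda>n i. c i * real (Suc n) ^ i"])
    show "Bseq (\<lambda>n. \<Sum>i<k. c i * real (Suc n) ^ i * s ^ i)" if s: "0 < s" for s
    proof (rule BseqI')
      show "norm (\<Sum>i<k. c i * real (Suc n) ^ i * s ^ i) \<le> C" for n
        using assms(1)[of "real (Suc n) * s"] s by (simp add: power_mult_distrib mult.assoc del: of_nat_Suc)
    qed
  qed fact
  then obtain K where K: "\<And>n. norm (c i * real (Suc n) ^ i) \<le> K" by (auto simp: Bseq_def simp del: of_nat_Suc)
  obtain n where n: "K / \<bar>c i\<bar> < real n" using reals_Archimedean2 by blast
  have "real (Suc n) \<le> real (Suc n) ^ i" using \<open>0 < i\<close> by (intro self_le_power) auto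
  then have "\<bar>c i\<bar> * real n < \<bar>c i\<bar> * real (Suc n) ^ i" using c by (intro mult_strict_left_mono) auto
  moreover have "K < \<bar>c i\<bar> * real n" using n c by (simp add: divide_less_eq mult.commute)
  ultimately show False using K[of n] by (simp add: abs_mult del: of_nat_Suc power_Suc)
qed

text \<open>The equation (- \<Delta>)^k F = f in integrated form, up to a k-harmonic polynomial. As
  no derivatives occur, pointwise limits and rescalings act directly on \<open>f\<close> and on
  finitely many coefficients.\<close>

definition radial_solution :: "nat \<Rightarrow> nat \<Rightarrow> real set \<Rightarrow> (real \<Rightarrow> real) \<Rightarrow> (real \<Rightarrow> real) \<Rightarrow> bool" where
  "radial_solution d k S f F \<longleftrightarrow> (\<exists>c. \<forall>s\<in>S. F s = (\<Sum>i<k. c i * s ^ i) + (inv_lap d ^^ k) f s)"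

lemma radial_solution_cmult:
  assumes "radial_solution d k S f F"
  shows "radial_solution d k S (\<lambda>s. a * f s) (\<lambda>s. a * F s)"
proof -
  obtain c where c: "\<forall>s\<in>S. F s = (\<Sum>i<k. c i * s ^ i) + (inv_lap d ^^ k) f s"
    using assms by (auto simp: radial_solution_def)
  show ?thesis
    unfolding radial_solution_def
    by (rule exI[of _ "\<lambda>i. a * c i"]) (use c in \<open>simp add: inv_lap_pow_cmult sum_distrib_left distrib_left mult.assoc\<close>)
qed

text \<open>Dilating s by \<open>l\<close> dilates lengths by sqrt l, so each Laplacian contributes
  one factor 1 / l.\<close>

lemma radial_solution_scale:
  assumes "radial_solution d k {0..b} f F" "0 < l"
  shows "radial_solution d k {0..b * l} (\<lambda>s. f (s / l) / l ^ k) (\<lambda>s. F (s / l))"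
proof -
  obtain c where c: "\<And>s. s \<in> {0..b} \<Longrightarrow> F s = (\<Sum>i<k. c i * s ^ i) + (inv_lap d ^^ k) f s"
    using assms by (auto simp: radial_solution_def)
  have "F (s / l) = (\<Sum>i<k. (c i / l ^ i) * s ^ i) + (inv_lap d ^^ k) (\<lambda>s. f (s / l) / l ^ k) s"
    if "s \<in> {0..b * l}" for s
  proof -
    have "(inv_lap d ^^ k) (\<lambda>s. (1 / l ^ k) * f (s / l)) s = (inv_lap d ^^ k) f (s / l)"
      unfolding inv_lap_pow_cmult using inv_lap_pow_scale[where c = l and d = d and k = k and g = f] assms(2) by simp
    moreover have "s / l \<in> {0..b}" using that assms(2) by (auto simp: divide_le_eq)
    ultimately show ?thesis using c[of "s / l"] by (simp add: power_divide)
  qed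
  then show ?thesis unfolding radial_solution_def by (intro exI[of _ "\<lambda>i. c i / l ^ i"] ballI)
qed

lemma inv_lap_pow_convergence_eventually:
  assumes f: "\<And>n. continuous_on UNIV (f n)"
    and bd: "\<And>\<rho>. \<exists>C. \<forall>\<^sub>F n in sequentially. \<forall>r\<in>{0..\<rho>}. \<bar>f n r\<bar> \<le> C"
    and lim: "\<And>r. 0 \<le> r \<Longrightarrow> (\<lambda>n. f n r) \<longlonglongrightarrow> g r" and s: "0 \<le> s"
  shows "(\<lambda>n. (inv_lap d ^^ k) (f n) s) \<longlonglongrightarrow> (inv_lap d ^^ k) g s"
proof -
  obtain C where "\<forall>\<^sub>F n in sequentially. \<forall>r\<in>{0..s}. \<bar>f n r\<bar> \<le> C" using bd by blast
  then obtain m where m: "\<And>n r. n \<ge> m \<Longrightarrow> r \<in> {0..s} \<Longrightarrow> \<bar>f n r\<bar> \<le> C" unfolding eventually_sequentially by blast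
  have "(\<lambda>n. (inv_lap d ^^ k) (f (n + m)) s) \<longlonglongrightarrow> (inv_lap d ^^ k) g s"
  proof (rule inv_lap_pow_convergence)
    show "\<bar>f (n + m) r\<bar> \<le> C" if "r \<in> {0..s}" for n r using m[OF _ that] by simp
    show "(\<lambda>n. f (n + m) r) \<longlonglongrightarrow> g r" if "r \<in> {0..s}" for r
      by (intro LIMSEQ_ignore_initial_segment lim) (use that in auto)
  qed (use f s in auto)
  then show ?thesis by (rule LIMSEQ_offset)
qed

text \<open>The polynomial parts converge pointwise as differences of convergent sequences, and
  hence their coefficients converge. Every point is eventually covered because \<open>b n\<close>
  tends to infinity.\<close>

lemma radial_solution_limit:
  assumes sol: "\<And>n. radial_solution d k {0..b n} (f n) (F n)" and b: "filterlim b at_top sequentially"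
    and f: "\<And>n. continuous_on UNIV (f n)"
    and bd: "\<And>\<rho>. \<exists>C. \<forall>\<^sub>F n in sequentially. \<forall>r\<in>{0..\<rho>}. \<bar>f n r\<bar> \<le> C"
    and lim_f: "\<And>s. 0 \<le> s \<Longrightarrow> (\<lambda>n. f n s) \<longlonglongrightarrow> g s"
    and lim_F: "\<And>s. 0 \<le> s \<Longrightarrow> (\<lambda>n. F n s) \<longlonglongrightarrow> G s"
  shows "radial_solution d k {0..} g G"
proof -
  obtain c where c: "\<And>n s. s \<in> {0..b n} \<Longrightarrow> F n s = (\<Sum>i<k. c n i * s ^ i) + (inv_lap d ^^ k) (f n) s"
    using sol unfolding radial_solution_def by metis
  have lim: "(\<lambda>n. \<Sum>i<k. c n i * s ^ i) \<longlonglongrightarrow> G s - (inv_lap d ^^ k) g s" if s: "0 \<le> s" for s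
  proof (rule Lim_transform_eventually)
    show "(\<lambda>n. F n s - (inv_lap d ^^ k) (f n) s) \<longlonglongrightarrow> G s - (inv_lap d ^^ k) g s"
      by (intro tendsto_diff lim_F inv_lap_pow_convergence_eventually f bd lim_f s)
    have "\<forall>\<^sub>F n in sequentially. s \<le> b n" using b by (simp add: filterlim_at_top)
    then show "\<forall>\<^sub>F n in sequentially. F n s - (inv_lap d ^^ k) (f n) s = (\<Sum>i<k. c n i * s ^ i)"
      by eventually_elim (use c s in auto)
  qed
  have "convergent (\<lambda>n. c n i)" if "i < k" for i
    by (rule polynomial_coefficients_convergent[OF convergentI[OF lim] that]) simp
  then obtain e where e: "\<And>i. i < k \<Longrightarrow> (\<lambda>n. c n i) \<longlonglongrightarrow> e i" unfolding convergent_def by metis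
  have "G s - (inv_lap d ^^ k) g s = (\<Sum>i<k. e i * s ^ i)" if "0 \<le> s" for s
  proof (rule LIMSEQ_unique[OF lim[OF that]])
    show "(\<lambda>n. \<Sum>i<k. c n i * s ^ i) \<longlonglongrightarrow> (\<Sum>i<k. e i * s ^ i)" by (intro tendsto_intros e) auto
  qed
  then show ?thesis unfolding radial_solution_def by (intro exI[of _ e]) (auto simp: algebra_simps)
qed

text \<open>The compactness that usually comes from elliptic estimates. The integral parts are
  locally equi-Lipschitz by the bounds on \<open>f n\<close>; the polynomial parts are then bounded
  at each point, so they have bounded coefficients.\<close>

lemma radial_solution_subsequence:
  assumes sol: "\<And>n. radial_solution d (Suc k) {0..b n} (f n) (F n)" and b: "filterlim b at_top sequentially"
    and f: "\<And>n. continuous_on UNIV (f n)"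
    and bd: "\<And>\<rho>. \<exists>C. \<forall>\<^sub>F n in sequentially. \<forall>r\<in>{0..\<rho>}. \<bar>f n r\<bar> \<le> C"
    and bd_F: "\<And>s. 0 \<le> s \<Longrightarrow> \<exists>C. \<forall>\<^sub>F n in sequentially. \<bar>F n s\<bar> \<le> C"
  obtains \<phi> G where "strict_mono \<phi>" "\<And>s. 0 \<le> s \<Longrightarrow> (\<lambda>n. F (\<phi> n) s) \<longlonglongrightarrow> G s" "continuous_on {0..} G"
proof -
  obtain c where c: "\<And>n s. s \<in> {0..b n} \<Longrightarrow> F n s = (\<Sum>i<Suc k. c n i * s ^ i) + (inv_lap d ^^ Suc k) (f n) s"
    using sol unfolding radial_solution_def by metis
  define W where "W n = (inv_lap d ^^ Suc k) (f n)" for n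
  have bd_W: "\<exists>C. \<forall>\<^sub>F n in sequentially. \<forall>r\<in>{0..\<rho>}. \<bar>W n r\<bar> \<le> C" for \<rho>
  proof -
    obtain C where "\<forall>\<^sub>F n in sequentially. \<forall>r\<in>{0..\<rho>}. \<bar>f n r\<bar> \<le> C" using bd by blast
    then have "\<forall>\<^sub>F n in sequentially. \<forall>r\<in>{0..\<rho>}. \<bar>W n r\<bar> \<le> C * \<rho> ^ Suc k"
    proof eventually_elim
      case (elim n)
      show ?case unfolding W_def by (intro ballI inv_lap_pow_abs_le f) (use elim in auto)
    qed
    then show ?thesis by blast
  qed
  have lip_W: "\<exists>C. \<forall>\<^sub>F n in sequentially. \<forall>r\<in>{0..\<rho>}. \<forall>s\<in>{0..\<rho>}. \<bar>W n r - W n s\<bar> \<le> C * \<bar>r - s\<bar>" for \<rho>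
  proof -
    obtain C where "\<forall>\<^sub>F n in sequentially. \<forall>r\<in>{0..\<rho>}. \<bar>f n r\<bar> \<le> C" using bd by blast
    then have "\<forall>\<^sub>F n in sequentially. \<forall>r\<in>{0..\<rho>}. \<forall>s\<in>{0..\<rho>}. \<bar>W n r - W n s\<bar> \<le> (C * \<rho> ^ k) * \<bar>r - s\<bar>"
    proof eventually_elim
      case (elim n)
      show ?case unfolding W_def by (intro ballI inv_lap_pow_lipschitz f) (use elim in auto)
    qed
    then show ?thesis by blast
  qed
  obtain \<phi> w where \<phi>: "strict_mono \<phi>" and w: "\<And>s. 0 \<le> s \<Longrightarrow> (\<lambda>n. W (\<phi> n) s) \<longlonglongrightarrow> w s"
    and w_cont: "continuous_on {0..} w"
    using locally_lipschitz_convergent_subsequence[OF bd_W lip_W] by metis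
  have ev_b: "\<forall>\<^sub>F n in sequentially. s \<le> b n" for s using b by (simp add: filterlim_at_top)
  have "Bseq (\<lambda>n. \<Sum>i<Suc k. c n i * s ^ i)" if s: "0 < s" for s
  proof -
    obtain C D where "\<forall>\<^sub>F n in sequentially. \<bar>F n s\<bar> \<le> C" "\<forall>\<^sub>F n in sequentially. \<forall>r\<in>{0..s}. \<bar>W n r\<bar> \<le> D"
      using bd_F[of s] bd_W[of s] s by auto
    then have "\<forall>\<^sub>F n in sequentially. norm (\<Sum>i<Suc k. c n i * s ^ i) \<le> C + D"
      using ev_b[of s]
    proof eventually_elim
      case (elim n)
      have "(\<Sum>i<Suc k. c n i * s ^ i) = F n s - W n s" using c[of s n] elim(3) s by (simp add: W_def)
      moreover have "\<bar>W n s\<bar> \<le> D" using elim(2) s by auto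
      ultimately show ?case using elim(1) by (simp only: real_norm_def)
    qed
    then show ?thesis by (rule BfunI)
  qed
  then have "\<exists>K. \<forall>n. \<bar>c n i\<bar> \<le> K" if "i < Suc k" for i
    using polynomial_coefficients_Bseq[where k = "Suc k" and c = c and i = i] that by (auto simp: Bseq_def)
  then obtain K where K: "\<And>i n. i < Suc k \<Longrightarrow> \<bar>c n i\<bar> \<le> K i" by metis
  \<comment> \<open>Padding with zeros allows one bound for all indices.\<close>
  define z where "z n i = (if i < Suc k then c (\<phi> n) i else 0)" for n i
  have "\<bar>z n i\<bar> \<le> (\<Sum>j<Suc k. \<bar>K j\<bar>)" for n i
  proof (cases "i < Suc k")
    case True
    have "\<bar>z n i\<bar> \<le> \<bar>K i\<bar>" using K[OF True, of "\<phi> n"] True by (simp add: z_def)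
    also have "\<dots> \<le> (\<Sum>j<Suc k. \<bar>K j\<bar>)" using True by (intro member_le_sum) auto
    finally show ?thesis .
  qed (simp add: z_def sum_nonneg del: sum.lessThan_Suc)
  then obtain \<psi> e where \<psi>: "strict_mono \<psi>" and e: "\<And>i. (\<lambda>n. z (\<psi> n) i) \<longlonglongrightarrow> e i"
    using cube_convergent_subsequence by metis
  have \<phi>\<psi>: "strict_mono (\<phi> \<circ> \<psi>)" using \<phi> \<psi> by (rule strict_mono_o)
  show ?thesis
  proof (rule that[OF \<phi>\<psi>, of "\<lambda>s. (\<Sum>i<Suc k. e i * s ^ i) + w s"])
    show "continuous_on {0..} (\<lambda>s. (\<Sum>i<Suc k. e i * s ^ i) + w s)" by (intro continuous_intros w_cont)
    fix s :: real assume s: "0 \<le> s"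
    show "(\<lambda>n. F ((\<phi> \<circ> \<psi>) n) s) \<longlonglongrightarrow> (\<Sum>i<Suc k. e i * s ^ i) + w s"
    proof (rule Lim_transform_eventually)
      have "(\<lambda>n. W (\<phi> (\<psi> n)) s) \<longlonglongrightarrow> w s"
        using LIMSEQ_subseq_LIMSEQ[OF w[OF s] \<psi>] by (simp add: o_def)
      then show "(\<lambda>n. (\<Sum>i<Suc k. z (\<psi> n) i * s ^ i) + W (\<phi> (\<psi> n)) s) \<longlonglongrightarrow> (\<Sum>i<Suc k. e i * s ^ i) + w s"
        by (intro tendsto_add tendsto_sum tendsto_mult e tendsto_const)
      have "\<forall>\<^sub>F n in sequentially. s \<le> b ((\<phi> \<circ> \<psi>) n)" by (rule eventually_subseq[OF \<phi>\<psi> ev_b])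
      then show "\<forall>\<^sub>F n in sequentially. (\<Sum>i<Suc k. z (\<psi> n) i * s ^ i) + W (\<phi> (\<psi> n)) s = F ((\<phi> \<circ> \<psi>) n) s"
      proof eventually_elim
        case (elim n)
        then show ?case using c[of s "\<phi> (\<psi> n)"] s by (simp add: z_def W_def)
      qed
    qed
  qed
qed


lemma continuous_on_abs_powr [continuous_intros]:
  assumes "continuous_on A f" "0 < q"
  shows "continuous_on A (\<lambda>s. \<bar>f s\<bar> powr q :: real)"
  by (rule continuous_on_powr'[OF continuous_on_rabs[OF assms(1)] continuous_on_const]) (use assms in auto)

lemma tendsto_abs_powr:
  assumes "(f \<longlongrightarrow> l) F" "0 < (q::real)"
  shows "((\<lambda>n. \<bar>f n\<bar> powr q) \<longlongrightarrow> \<bar>l\<bar> powr q) F"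
  by (rule tendsto_powr2[OF tendsto_rabs[OF assms(1)] tendsto_const]) (use assms in auto)

lemma radial_solution_const_contradiction:
  assumes "radial_solution d k {0..} (\<lambda>_. 1) (\<lambda>_. 0)"
  shows False
proof -
  obtain a where a: "a \<noteq> 0" "(inv_lap d ^^ k) (\<lambda>_. 1) = (\<lambda>s. a * s ^ k)"
    using inv_lap_pow_one[of k d] by metis
  obtain c where c: "\<And>s. 0 \<le> s \<Longrightarrow> 0 = (\<Sum>i<k. c i * s ^ i) + a * s ^ k"
    using assms a(2) by (auto simp: radial_solution_def)
  have "(c(k := a)) k = 0"
  proof (rule polynomial_coefficients_zero[where k = "Suc k" and c = "c(k := a)" and i = k])
    show "(\<Sum>i<Suc k. (c(k := a)) i * s ^ i) = 0" if "0 < s" for s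
      using c[of s] that by simp
  qed simp
  then show False using a(1) by simp
qed

text \<open>The state after the blow-up: \<open>b n\<close> bounds s on the n-th ball and
  \<open>t n\<close> is the remaining perturbation. \<open>U n\<close> is normalised, while
  \<open>V n\<close> is only known to be largest at the centre; a bound on \<open>V n 0\<close> is
  what compactness still lacks.\<close>

locale approximating_solutions =
  fixes d \<alpha> \<beta> :: nat and p q :: real and b t :: "nat \<Rightarrow> real" and U V :: "nat \<Rightarrow> real \<Rightarrow> real"
  assumes pq: "0 < p" "0 < q" and b: "filterlim b at_top sequentially"
    and t_nonneg: "\<And>n. 0 \<le> t n" and t: "t \<longlonglongrightarrow> 0"
    and U: "\<And>n. unit_valued (U n)" and U0: "\<And>n. U n 0 = 1"
    and V_cont: "\<And>n. continuous_on UNIV (V n)"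
    and V: "\<And>n s. s \<in> {0..b n} \<Longrightarrow> 0 \<le> V n s \<and> V n s \<le> V n 0"
    and U_sol: "\<And>n. radial_solution d (Suc \<alpha>) {0..b n} (\<lambda>s. \<bar>V n s\<bar> powr q + t n) (U n)"
    and V_sol: "\<And>n. radial_solution d (Suc \<beta>) {0..b n} (\<lambda>s. \<bar>U n s\<bar> powr p) (V n)"
begin

lemma U_cont: "continuous_on UNIV (U n)" and U_range: "0 \<le> U n s" "U n s \<le> 1"
  using U[of n] by (auto simp: unit_valued_def)

lemma U_powr: "\<bar>\<bar>U n s\<bar> powr p\<bar> \<le> 1"
  using powr_le1[of p "\<bar>U n s\<bar>"] U_range[of n s] pq by simp

lemma eventually_in: "\<forall>\<^sub>F n in sequentially. \<forall>s\<in>{0..\<rho>}. s \<in> {0..b n}"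
proof -
  have "\<forall>\<^sub>F n in sequentially. \<rho> \<le> b n" using b by (simp add: filterlim_at_top)
  then show ?thesis by eventually_elim auto
qed

lemma subseq:
  assumes "strict_mono \<phi>"
  shows "approximating_solutions d \<alpha> \<beta> p q (b \<circ> \<phi>) (t \<circ> \<phi>) (U \<circ> \<phi>) (V \<circ> \<phi>)"
  using pq t_nonneg U U0 V_cont V U_sol V_sol LIMSEQ_subseq_LIMSEQ[OF t assms]
    filterlim_compose[OF b filterlim_subseq[OF assms]]
  by unfold_locales (auto simp: o_def)

text \<open>
  If \<open>M n = V n 0\<close> tends to infinity, \<open>V n / M n\<close> tends to a bounded polynomial, that is to \<open>1\<close>, so that
  \<open>U n / M n powr q\<close> tends to a solution with right-hand side \<open>1\<close>; but \<open>0 \<le> U n \<le> 1\<close>.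
\<close>

lemma V0_not_divergent: "\<not> filterlim (\<lambda>n. V n 0) at_top sequentially"
proof
  assume div: "filterlim (\<lambda>n. V n 0) at_top sequentially"
  \<comment> \<open>The maximum with 1 permits division for every index; eventually
    \<open>M n\<close> is \<open>V n 0\<close>.\<close>
  define M where "M n = max 1 (V n 0)" for n
  have M: "1 \<le> M n" for n by (simp add: M_def)
  have M_eq: "\<forall>\<^sub>F n in sequentially. M n = V n 0"
  proof -
    have "\<forall>\<^sub>F n in sequentially. 1 \<le> V n 0" using div by (simp add: filterlim_at_top)
    then show ?thesis by eventually_elim (simp add: M_def)
  qed
  have M_top: "filterlim M at_top sequentially"
    by (rule filterlim_at_top_mono[OF div]) (simp add: M_def)
  define X where "X n s = (1 / M n) * V n s" for n s
  define g where "g n s = (1 / M n) * \<bar>U n s\<bar> powr p" for n s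
  have X_sol: "radial_solution d (Suc \<beta>) {0..b n} (g n) (X n)" for n
    unfolding X_def[abs_def] g_def[abs_def] by (rule radial_solution_cmult[OF V_sol])
  have g_cont: "continuous_on UNIV (g n)" for n
    unfolding g_def[abs_def] by (intro continuous_intros U_cont pq)
  have g_le: "\<bar>g n s\<bar> \<le> 1 / M n" for n s
    using mult_left_mono[OF U_powr[of n s], of "1 / M n"] M[of n] by (simp add: g_def abs_mult)
  have inv_M: "(\<lambda>n. 1 / M n) \<longlonglongrightarrow> 0"
    using tendsto_inverse_0_at_top[OF M_top] by (simp add: inverse_eq_divide)
  have X_range: "0 \<le> X n s \<and> X n s \<le> 1" if "s \<in> {0..b n}" for n s
  proof -
    have "V n s \<le> M n" using V[OF that] by (simp add: M_def le_max_iff_disj)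
    then show ?thesis using V[OF that] M[of n] by (simp add: X_def divide_le_eq)
  qed
  have g_bd: "\<exists>C. \<forall>\<^sub>F n in sequentially. \<forall>r\<in>{0..\<rho>}. \<bar>g n r\<bar> \<le> C" for \<rho>
  proof (intro exI always_eventually allI ballI)
    fix n r
    have "1 / M n \<le> 1" using M[of n] by simp
    with g_le[of n r] show "\<bar>g n r\<bar> \<le> 1" by (rule order_trans)
  qed
  have X_bd: "\<exists>C. \<forall>\<^sub>F n in sequentially. \<bar>X n s\<bar> \<le> C" if "0 \<le> s" for s
  proof -
    have "\<forall>\<^sub>F n in sequentially. \<bar>X n s\<bar> \<le> 1"
      using eventually_in[of s]
    proof eventually_elim
      case (elim n)
      then have "s \<in> {0..b n}" using that by auto
      from X_range[OF this] show ?case by simp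
    qed
    then show ?thesis by blast
  qed
  obtain \<phi> G where \<phi>: "strict_mono \<phi>" and G: "\<And>s. 0 \<le> s \<Longrightarrow> (\<lambda>n. X (\<phi> n) s) \<longlonglongrightarrow> G s"
    using radial_solution_subsequence[OF X_sol b g_cont g_bd X_bd] by metis
  interpret sub: approximating_solutions d \<alpha> \<beta> p q "b \<circ> \<phi>" "t \<circ> \<phi>" "U \<circ> \<phi>" "V \<circ> \<phi>"
    by (rule subseq[OF \<phi>])
  have inv_M': "(\<lambda>n. 1 / M (\<phi> n)) \<longlonglongrightarrow> 0"
    using LIMSEQ_subseq_LIMSEQ[OF inv_M \<phi>] by (simp add: o_def)
  have "radial_solution d (Suc \<beta>) {0..} (\<lambda>_. 0) G"
  proof (rule radial_solution_limit[OF _ sub.b _ _ _ G])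
    show "radial_solution d (Suc \<beta>) {0..(b \<circ> \<phi>) n} (g (\<phi> n)) (X (\<phi> n))" for n
      using X_sol by simp
    show "\<exists>C. \<forall>\<^sub>F n in sequentially. \<forall>r\<in>{0..\<rho>}. \<bar>g (\<phi> n) r\<bar> \<le> C" for \<rho>
      using eventually_subseq[OF \<phi>] g_bd[of \<rho>] by blast
    show "(\<lambda>n. g (\<phi> n) s) \<longlonglongrightarrow> 0" for s
      by (rule Lim_null_comparison[OF always_eventually inv_M']) (simp add: g_le)
  qed (use g_cont in auto)
  then obtain c where c: "\<And>s. 0 \<le> s \<Longrightarrow> G s = (\<Sum>i<Suc \<beta>. c i * s ^ i)"
    using inv_lap_pow_cmult[where d = d and k = "Suc \<beta>" and c = 0 and f = "\<lambda>_. 0"] by (auto simp: radial_solution_def simp del: sum.lessThan_Suc funpow.simps)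
  have G01: "0 \<le> G s \<and> G s \<le> 1" if "0 \<le> s" for s
  proof -
    have "\<forall>\<^sub>F n in sequentially. 0 \<le> X (\<phi> n) s \<and> X (\<phi> n) s \<le> 1"
      using sub.eventually_in[of s]
    proof eventually_elim
      case (elim n)
      then have "s \<in> {0..b (\<phi> n)}" using that by auto
      then show ?case by (rule X_range)
    qed
    then have "\<forall>\<^sub>F n in sequentially. 0 \<le> X (\<phi> n) s" "\<forall>\<^sub>F n in sequentially. X (\<phi> n) s \<le> 1"
      by (simp_all add: eventually_conj_iff)
    then show ?thesis
      using tendsto_lowerbound[OF G[OF that]] tendsto_upperbound[OF G[OF that]] by simp
  qed
  have "\<bar>\<Sum>i<Suc \<beta>. c i * s ^ i\<bar> \<le> 1" if "0 < s" for s
    using c[of s] G01[of s] that by (simp del: sum.lessThan_Suc)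
  then have "c i = 0" if "i < Suc \<beta>" "0 < i" for i
    by (rule bounded_polynomial_constant[OF _ that])
  then have G_const: "G s = c 0" if "0 \<le> s" for s
    unfolding c[OF that] sum.lessThan_Suc_shift by simp
  have G_one: "G s = 1" if "0 \<le> s" for s
  proof -
    have "(\<lambda>n. X (\<phi> n) 0) \<longlonglongrightarrow> 1"
    proof (rule Lim_transform_eventually[OF tendsto_const])
      have "\<forall>\<^sub>F n in sequentially. M (\<phi> n) = V (\<phi> n) 0" by (rule eventually_subseq[OF \<phi> M_eq])
      then show "\<forall>\<^sub>F n in sequentially. 1 = X (\<phi> n) 0"
        by eventually_elim (use M in \<open>auto simp: X_def\<close>, metis not_one_le_zero)
    qed
    then have "G 0 = 1" using G[of 0] LIMSEQ_unique by auto
    then show ?thesis using G_const[of 0] G_const[OF that] by simp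
  qed
  \<comment> \<open>The factor that turns |V|^q into |X|^q when the first equation is multiplied by
    it.\<close>
  define a where "a n = 1 / M n powr q" for n
  have a: "0 \<le> a n" "a n \<le> 1" for n
    using M[of n] pq by (auto simp: a_def divide_le_eq ge_one_powr_ge_zero)
  have a_lim: "(\<lambda>n. a (\<phi> n)) \<longlonglongrightarrow> 0"
  proof -
    have "(\<lambda>n. (1 / M (\<phi> n)) powr q) \<longlonglongrightarrow> 0 powr q"
    proof (rule tendsto_powr2[OF inv_M' tendsto_const])
      show "\<forall>\<^sub>F n in sequentially. 0 \<le> 1 / M (\<phi> n)" using M by (intro always_eventually allI) (simp add: order_trans[OF zero_le_one])
    qed (use pq in auto)
    moreover have "(1 / M (\<phi> n)) powr q = a (\<phi> n)" for n
      using M[of "\<phi> n"] by (simp add: a_def powr_divide)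
    ultimately show ?thesis using pq by simp
  qed
  define h where "h n s = a n * (\<bar>V n s\<bar> powr q + t n)" for n s
  have h: "h n s = \<bar>X n s\<bar> powr q + a n * t n" for n s
    using M[of n] by (simp add: h_def a_def X_def abs_mult powr_mult distrib_left powr_divide)
  have "radial_solution d (Suc \<alpha>) {0..} (\<lambda>_. 1) (\<lambda>_. 0)"
  proof (rule radial_solution_limit[OF _ sub.b])
    show "radial_solution d (Suc \<alpha>) {0..(b \<circ> \<phi>) n} (h (\<phi> n)) (\<lambda>s. a (\<phi> n) * U (\<phi> n) s)" for n
      unfolding h_def[abs_def] o_def by (rule radial_solution_cmult[OF U_sol])
    show "continuous_on UNIV (h (\<phi> n))" for n
      unfolding h_def[abs_def] by (intro continuous_intros V_cont pq)
    have at: "(\<lambda>n. a (\<phi> n) * t (\<phi> n)) \<longlonglongrightarrow> 0"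
      using tendsto_mult[OF a_lim LIMSEQ_subseq_LIMSEQ[OF t \<phi>]] by (simp add: o_def)
    have "\<forall>\<^sub>F n in sequentially. a (\<phi> n) * t (\<phi> n) < 1" by (rule order_tendstoD[OF at]) simp
    then show "\<exists>C. \<forall>\<^sub>F n in sequentially. \<forall>r\<in>{0..\<rho>}. \<bar>h (\<phi> n) r\<bar> \<le> C" for \<rho>
    proof (intro exI)
      show "\<forall>\<^sub>F n in sequentially. \<forall>r\<in>{0..\<rho>}. \<bar>h (\<phi> n) r\<bar> \<le> 2"
        using \<open>\<forall>\<^sub>F n in sequentially. a (\<phi> n) * t (\<phi> n) < 1\<close> sub.eventually_in[of \<rho>]
      proof eventually_elim
        case (elim n)
        show ?case
        proof
          fix r assume "r \<in> {0..\<rho>}"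
          then have "0 \<le> X (\<phi> n) r \<and> X (\<phi> n) r \<le> 1" using elim(2) X_range by auto
          then have "\<bar>X (\<phi> n) r\<bar> powr q \<le> 1" using pq by (intro powr_le1) auto
          moreover have "0 \<le> a (\<phi> n) * t (\<phi> n)" using a t_nonneg by simp
          ultimately show "\<bar>h (\<phi> n) r\<bar> \<le> 2" using elim(1) unfolding h by simp
        qed
      qed
    qed
    show "(\<lambda>n. h (\<phi> n) s) \<longlonglongrightarrow> 1" if "0 \<le> s" for s
      using tendsto_add[OF tendsto_abs_powr[OF G[OF that] pq(2)] at] G_one[OF that] by (simp add: h)
    show "(\<lambda>n. a (\<phi> n) * U (\<phi> n) s) \<longlonglongrightarrow> 0" for s
    proof (rule Lim_null_comparison[OF always_eventually a_lim], rule allI)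
      fix n
      show "norm (a (\<phi> n) * U (\<phi> n) s) \<le> a (\<phi> n)"
        using a(1)[of "\<phi> n"] U_range[of "\<phi> n" s] by (simp add: abs_mult mult_left_le)
    qed
  qed
  then show False by (rule radial_solution_const_contradiction)
qed

text \<open>The bound at the centre bounds both right-hand sides locally, so compactness applies to
  \<open>U n\<close> and then, along that subsequence, to \<open>V n\<close>. Both equations are
  passed to the limit along the common subsequence.\<close>

lemma limit_of_bounded:
  assumes K: "\<And>n. V n 0 \<le> K"
  obtains u v where "continuous_on UNIV u" "continuous_on UNIV v" "u 0 = 1"
    "radial_solution d (Suc \<alpha>) {0..} (\<lambda>s. \<bar>v s\<bar> powr q) u"
    "radial_solution d (Suc \<beta>) {0..} (\<lambda>s. \<bar>u s\<bar> powr p) v"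
proof -
  have V_le: "\<forall>\<^sub>F n in sequentially. \<forall>s\<in>{0..\<rho>}. 0 \<le> V n s \<and> V n s \<le> K" for \<rho>
    using eventually_in[of \<rho>]
  proof eventually_elim
    case (elim n)
    show ?case
    proof
      fix s assume "s \<in> {0..\<rho>}"
      then have "0 \<le> V n s \<and> V n s \<le> V n 0" using elim by (intro V) auto
      then show "0 \<le> V n s \<and> V n s \<le> K" using K[of n] by linarith
    qed
  qed
  define f where "f n s = \<bar>V n s\<bar> powr q + t n" for n s
  have f_cont: "continuous_on UNIV (f n)" for n
    unfolding f_def[abs_def] by (intro continuous_intros V_cont pq)
  have f_bd: "\<exists>C. \<forall>\<^sub>F n in sequentially. \<forall>r\<in>{0..\<rho>}. \<bar>f n r\<bar> \<le> C" for \<rho>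
  proof -
    have "\<forall>\<^sub>F n in sequentially. t n < 1" by (rule order_tendstoD[OF t]) simp
    then have "\<forall>\<^sub>F n in sequentially. \<forall>r\<in>{0..\<rho>}. \<bar>f n r\<bar> \<le> K powr q + 1"
      using V_le[of \<rho>]
    proof eventually_elim
      case (elim n)
      show ?case
      proof
        fix r assume "r \<in> {0..\<rho>}"
        then have "0 \<le> V n r" "V n r \<le> K" using elim(2) by auto
        then have "\<bar>V n r\<bar> powr q \<le> K powr q" using pq by (intro powr_mono2) auto
        then show "\<bar>f n r\<bar> \<le> K powr q + 1" using elim(1) t_nonneg[of n] by (simp add: f_def)
      qed
    qed
    then show ?thesis by blast
  qed
  have U_bd: "\<exists>C. \<forall>\<^sub>F n in sequentially. \<bar>U n s\<bar> \<le> C" for s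
    using U_range[of _ s] by (intro exI[of _ 1] always_eventually allI) simp
  obtain \<phi> u where \<phi>: "strict_mono \<phi>" and u: "\<And>s. 0 \<le> s \<Longrightarrow> (\<lambda>n. U (\<phi> n) s) \<longlonglongrightarrow> u s"
    and u_cont: "continuous_on {0..} u"
    using radial_solution_subsequence[OF U_sol[folded f_def] b f_cont f_bd U_bd] by metis
  define g where "g n s = \<bar>U (\<phi> n) s\<bar> powr p" for n s
  have g_cont: "continuous_on UNIV (g n)" for n
    unfolding g_def[abs_def] by (intro continuous_intros U_cont pq)
  have g_bd: "\<exists>C. \<forall>\<^sub>F n in sequentially. \<forall>r\<in>{0..\<rho>}. \<bar>g n r\<bar> \<le> C" for \<rho>
    unfolding g_def by (intro exI[of _ 1] always_eventually allI ballI U_powr)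
  have V_bd: "\<exists>C. \<forall>\<^sub>F n in sequentially. \<bar>V (\<phi> n) s\<bar> \<le> C" if "0 \<le> s" for s
  proof -
    have "\<forall>\<^sub>F n in sequentially. \<forall>r\<in>{0..s}. 0 \<le> V (\<phi> n) r \<and> V (\<phi> n) r \<le> K"
      by (rule eventually_subseq[OF \<phi> V_le])
    then have "\<forall>\<^sub>F n in sequentially. \<bar>V (\<phi> n) s\<bar> \<le> K" by eventually_elim (use that in auto)
    then show ?thesis by blast
  qed
  have b\<phi>: "filterlim (\<lambda>n. b (\<phi> n)) at_top sequentially"
    using filterlim_compose[OF b filterlim_subseq[OF \<phi>]] .
  have V_sol\<phi>: "radial_solution d (Suc \<beta>) {0..b (\<phi> n)} (g n) (V (\<phi> n))" for n
    unfolding g_def[abs_def] by (rule V_sol)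
  obtain \<psi> v where \<psi>: "strict_mono \<psi>" and v: "\<And>s. 0 \<le> s \<Longrightarrow> (\<lambda>n. V (\<phi> (\<psi> n)) s) \<longlonglongrightarrow> v s"
    and v_cont: "continuous_on {0..} v"
    using radial_solution_subsequence[OF V_sol\<phi> b\<phi> g_cont g_bd V_bd] by metis
  have u': "(\<lambda>n. U (\<phi> (\<psi> n)) s) \<longlonglongrightarrow> u s" if "0 \<le> s" for s
    using LIMSEQ_subseq_LIMSEQ[OF u[OF that] \<psi>] by (simp add: o_def)
  have \<phi>\<psi>: "strict_mono (\<lambda>n. \<phi> (\<psi> n))" using strict_mono_o[OF \<phi> \<psi>] by (simp add: o_def)
  have b': "filterlim (\<lambda>n. b (\<phi> (\<psi> n))) at_top sequentially"
    using filterlim_compose[OF b filterlim_subseq[OF \<phi>\<psi>]] .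
  have t': "(\<lambda>n. t (\<phi> (\<psi> n))) \<longlonglongrightarrow> 0"
    using LIMSEQ_subseq_LIMSEQ[OF t \<phi>\<psi>] by (simp add: o_def)
  have sol_u: "radial_solution d (Suc \<alpha>) {0..} (\<lambda>s. \<bar>v s\<bar> powr q) u"
  proof (rule radial_solution_limit[OF _ b' f_cont _ _ u'])
    show "radial_solution d (Suc \<alpha>) {0..b (\<phi> (\<psi> n))} (f (\<phi> (\<psi> n))) (U (\<phi> (\<psi> n)))" for n
      unfolding f_def[abs_def] by (rule U_sol)
    show "\<exists>C. \<forall>\<^sub>F n in sequentially. \<forall>r\<in>{0..\<rho>}. \<bar>f (\<phi> (\<psi> n)) r\<bar> \<le> C" for \<rho>
      using eventually_subseq[OF \<phi>\<psi>] f_bd[of \<rho>] by blast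
    show "(\<lambda>n. f (\<phi> (\<psi> n)) s) \<longlonglongrightarrow> \<bar>v s\<bar> powr q" if "0 \<le> s" for s
      unfolding f_def using tendsto_add[OF tendsto_abs_powr[OF v[OF that] pq(2)] t'] by simp
  qed
  have sol_v: "radial_solution d (Suc \<beta>) {0..} (\<lambda>s. \<bar>u s\<bar> powr p) v"
  proof (rule radial_solution_limit[OF _ b' g_cont _ _ v])
    show "radial_solution d (Suc \<beta>) {0..b (\<phi> (\<psi> n))} (g (\<psi> n)) (V (\<phi> (\<psi> n)))" for n
      by (rule V_sol\<phi>)
    show "\<exists>C. \<forall>\<^sub>F n in sequentially. \<forall>r\<in>{0..\<rho>}. \<bar>g (\<psi> n) r\<bar> \<le> C" for \<rho>
      using eventually_subseq[OF \<psi>] g_bd[of \<rho>] by blast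
    show "(\<lambda>n. g (\<psi> n) s) \<longlonglongrightarrow> \<bar>u s\<bar> powr p" if "0 \<le> s" for s
      unfolding g_def by (rule tendsto_abs_powr[OF u'[OF that] pq(1)])
  qed
  \<comment> \<open>The limits are controlled for s \<ge> 0 only. Freezing them at 0 gives
    continuity on the line and leaves the integrals over s \<ge> 0 unchanged.\<close>
  have extend: "continuous_on UNIV (\<lambda>s. w (max 0 s))" if "continuous_on {0..} w" for w :: "real \<Rightarrow> real"
    by (rule continuous_on_compose2[OF that]) (auto intro: continuous_intros)
  have radial_cong: "radial_solution d k {0..} f' F'"
    if "radial_solution d k {0..} f F" "\<And>s. 0 \<le> s \<Longrightarrow> f s = f' s" "\<And>s. 0 \<le> s \<Longrightarrow> F s = F' s" for k f f' F F'
  proof -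
    have "(inv_lap d ^^ k) f s = (inv_lap d ^^ k) f' s" if "0 \<le> s" for s
      by (rule inv_lap_pow_cong[OF that]) (simp add: \<open>\<And>s. 0 \<le> s \<Longrightarrow> f s = f' s\<close>)
    then show ?thesis using that(1,3) by (simp add: radial_solution_def)
  qed
  have u0: "u 0 = 1"
    using u'[of 0] U0 by (simp add: LIMSEQ_const_iff)
  show ?thesis
  proof (rule that[of "\<lambda>s. u (max 0 s)" "\<lambda>s. v (max 0 s)"])
    show "radial_solution d (Suc \<alpha>) {0..} (\<lambda>s. \<bar>v (max 0 s)\<bar> powr q) (\<lambda>s. u (max 0 s))"
      by (rule radial_cong[OF sol_u]) auto
    show "radial_solution d (Suc \<beta>) {0..} (\<lambda>s. \<bar>u (max 0 s)\<bar> powr p) (\<lambda>s. v (max 0 s))"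
      by (rule radial_cong[OF sol_v]) auto
  qed (use extend u_cont v_cont u0 in auto)
qed

theorem limit_solution:
  obtains u v where "continuous_on UNIV u" "continuous_on UNIV v" "u 0 = 1"
    "radial_solution d (Suc \<alpha>) {0..} (\<lambda>s. \<bar>v s\<bar> powr q) u"
    "radial_solution d (Suc \<beta>) {0..} (\<lambda>s. \<bar>u s\<bar> powr p) v"
proof -
  obtain K where "\<not> (\<forall>\<^sub>F n in sequentially. K \<le> V n 0)"
    using V0_not_divergent by (auto simp: filterlim_at_top)
  from not_eventually_sequentiallyD[OF this]
  obtain \<phi> :: "nat \<Rightarrow> nat" where \<phi>: "strict_mono \<phi>" "\<forall>n. \<not> K \<le> V (\<phi> n) 0" by blast
  interpret sub: approximating_solutions d \<alpha> \<beta> p q "b \<circ> \<phi>" "t \<circ> \<phi>" "U \<circ> \<phi>" "V \<circ> \<phi>"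
    by (rule subseq[OF \<phi>(1)])
  have "(V \<circ> \<phi>) n 0 \<le> K" for n using \<phi>(2) by (simp add: not_le less_imp_le)
  then show ?thesis by (rule sub.limit_of_bounded) (rule that)
qed

end

section \<open>The normalised fixed-point problem\<close>

lemma avg_iter_add:
  assumes f: "continuous_on UNIV f" and g: "continuous_on UNIV g"
  shows "avg_iter d k (\<lambda>s. f s + g s) = (\<lambda>s. avg_iter d k f s + avg_iter d k g s)"
proof (induction k)
  case (Suc k)
  show ?case by (rule ext) (simp add: Suc avg_add avg_iter_continuous f g)
qed simp

lemma backint_pow_add:
  assumes f: "continuous_on UNIV f" and g: "continuous_on UNIV g"
  shows "(backint b ^^ k) (\<lambda>s. f s + g s) = (\<lambda>s. (backint b ^^ k) f s + (backint b ^^ k) g s)"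
proof (induction k)
  case (Suc k)
  have "backint b (\<lambda>s. (backint b ^^ k) f s + (backint b ^^ k) g s) s
      = backint b ((backint b ^^ k) f) s + backint b ((backint b ^^ k) g) s" for s
    unfolding backint_def[of b "\<lambda>s. (backint b ^^ k) f s + (backint b ^^ k) g s"]
      backint_def[of b "(backint b ^^ k) f"] backint_def[of b "(backint b ^^ k) g"]
    by (simp add: antideriv_add backint_pow_continuous f g)
  then show ?case by (simp add: Suc fun_eq_iff)
qed simp

lemma green_add:
  assumes f: "continuous_on UNIV f" and g: "continuous_on UNIV g"
  shows "green d b k (\<lambda>s. f s + g s) = (\<lambda>s. green d b k f s + green d b k g s)"
  unfolding green_def by (simp add: avg_iter_add[OF f g] backint_pow_add avg_iter_continuous f g)

lemma green_radial_solution: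
  assumes "continuous_on UNIV f"
  shows "radial_solution d k S f (green d b k f)"
  using green_eq[OF assms] unfolding radial_solution_def by blast

lemma radial_solution_cong:
  "radial_solution d k S f F \<Longrightarrow> (\<And>s. s \<in> S \<Longrightarrow> F s = G s) \<Longrightarrow> radial_solution d k S f G"
  unfolding radial_solution_def by simp

context
  fixes d \<alpha> \<beta> :: nat and p q :: real
  assumes pq: "0 < p" "0 < q"
begin

definition green_v :: "(real \<Rightarrow> real) \<Rightarrow> real \<Rightarrow> real" where
  "green_v u = green d (1/2) (Suc \<beta>) (\<lambda>s. \<bar>u s\<bar> powr p)"

text \<open>The factor \<mu> does not appear: dividing the result by its value at 0 makes \<mu> the
  reciprocal of that value. The radius 1/2 in s is the unit sphere.\<close>

definition green_u :: "real \<Rightarrow> (real \<Rightarrow> real) \<Rightarrow> real \<Rightarrow> real" where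
  "green_u t u = green d (1/2) (Suc \<alpha>) (\<lambda>s. \<bar>green_v u s\<bar> powr q + t)"

lemma powr_cont: "continuous_on UNIV u \<Longrightarrow> continuous_on UNIV (\<lambda>s. \<bar>u s\<bar> powr p)"
  by (intro continuous_intros pq)

lemma green_v_cont: "continuous_on UNIV u \<Longrightarrow> continuous_on A (green_v u)"
  unfolding green_v_def by (intro green_continuous powr_cont)

lemma rhs_cont: "continuous_on UNIV u \<Longrightarrow> continuous_on A (\<lambda>s. \<bar>green_v u s\<bar> powr q + t)"
  by (intro continuous_intros green_v_cont pq)

lemma unit_valued_cont: "unit_valued u \<Longrightarrow> continuous_on UNIV u"
  by (simp add: unit_valued_def)

lemma unit_valued_powr:
  assumes "unit_valued u"
  shows "\<bar>\<bar>u s\<bar> powr p\<bar> \<le> 1"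
proof -
  have "0 \<le> u s \<and> u s \<le> 1" using assms by (simp add: unit_valued_def)
  then show ?thesis using powr_le1[of p "\<bar>u s\<bar>"] pq by simp
qed

lemma green_v_nonneg: "continuous_on UNIV u \<Longrightarrow> s \<in> {0..1/2} \<Longrightarrow> 0 \<le> green_v u s"
  unfolding green_v_def by (rule green_nonneg[OF powr_cont]) simp_all

lemma green_v_antimono: "continuous_on UNIV u \<Longrightarrow> s \<in> {0..1/2} \<Longrightarrow> green_v u s \<le> green_v u 0"
  unfolding green_v_def by (rule green_antimono[OF powr_cont]) simp_all

lemma green_v_abs_le: 
  assumes u: "unit_valued u" and s: "s \<in> {0..1/2}"
  shows "\<bar>green_v u s\<bar> \<le> 1"
proof -
  have "\<bar>green_v u s\<bar> \<le> 1 * (1/2) ^ Suc \<beta>"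
    unfolding green_v_def by (rule green_abs_le[OF powr_cont[OF unit_valued_cont[OF u]] unit_valued_powr[OF u] s])
  also have "\<dots> \<le> 1" using power_le_one[of "1/2::real" "Suc \<beta>"] by (simp del: power_Suc)
  finally show ?thesis .
qed

lemma green_v_convergence:
  assumes U: "\<And>k::nat. unit_valued (U k)" and lim: "\<And>s. s \<in> {0..1/2} \<Longrightarrow> (\<lambda>k. U k s) \<longlonglongrightarrow> u s"
    and s: "s \<in> {0..1/2}"
  shows "(\<lambda>k. green_v (U k) s) \<longlonglongrightarrow> green_v u s"
  unfolding green_v_def
  by (rule green_convergence[OF powr_cont[OF unit_valued_cont[OF U]] unit_valued_powr[OF U]
        tendsto_abs_powr[OF lim pq(1)] s])

lemma rhs_abs_le:
  assumes "unit_valued u" "s \<in> {0..1/2}" "0 \<le> t"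
  shows "\<bar>\<bar>green_v u s\<bar> powr q + t\<bar> \<le> 1 + t"
  using green_v_abs_le[OF assms(1,2)] powr_le1[of q "\<bar>green_v u s\<bar>"] pq assms(3) by simp

lemma green_u_convergence:
  assumes U: "\<And>k::nat. unit_valued (U k)" and lim: "\<And>s. s \<in> {0..1/2} \<Longrightarrow> (\<lambda>k. U k s) \<longlonglongrightarrow> u s"
    and t: "\<And>k. 0 \<le> t k" "\<And>k. t k \<le> 1" "t \<longlonglongrightarrow> t0" and s: "s \<in> {0..1/2}"
  shows "(\<lambda>k. green_u (t k) (U k) s) \<longlonglongrightarrow> green_u t0 u s"
  unfolding green_u_def
proof (rule green_convergence[OF rhs_cont[OF unit_valued_cont[OF U]] _ _ s])
  fix k r assume r: "r \<in> {0..1/2::real}"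
  show "\<bar>\<bar>green_v (U k) r\<bar> powr q + t k\<bar> \<le> 2"
    using rhs_abs_le[OF U r t(1)[of k], of k] t(2)[of k] by linarith
  show "(\<lambda>k. \<bar>green_v (U k) r\<bar> powr q + t k) \<longlonglongrightarrow> \<bar>green_v u r\<bar> powr q + t0"
    by (intro tendsto_add t tendsto_abs_powr pq green_v_convergence[OF U lim r])
qed

text \<open>By linearity the constant \<open>t\<close> contributes exactly \<open>t\<close> times
  the solution with right-hand side 1, and the rest is nonnegative. For fixed \<open>t\<close> this
  keeps the denominator away from 0; in the blow-up it bounds \<mu> t.\<close>

lemma green_u_lower:
  assumes u: "continuous_on UNIV u" and t: "0 \<le> t"
  shows "t * green d (1/2) (Suc \<alpha>) (\<lambda>_. 1) 0 \<le> green_u t u 0"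
proof -
  have "green_u t u = (\<lambda>s. green d (1/2) (Suc \<alpha>) (\<lambda>s. \<bar>green_v u s\<bar> powr q) s + green d (1/2) (Suc \<alpha>) (\<lambda>s. t * 1) s)"
    unfolding green_u_def mult_1_right by (rule green_add) (intro continuous_intros green_v_cont u pq)+
  moreover have "0 \<le> green d (1/2) (Suc \<alpha>) (\<lambda>s. \<bar>green_v u s\<bar> powr q) 0"
    by (rule green_nonneg) (auto intro!: continuous_intros green_v_cont u pq)
  ultimately show ?thesis by (simp only: green_cmult)
qed

lemma green_one_pos: "0 < green d (1/2) k (\<lambda>_. 1) 0"
  by (rule green_pos[where c = 1]) auto

lemma green_u_nonneg: "continuous_on UNIV u \<Longrightarrow> 0 \<le> t \<Longrightarrow> s \<in> {0..1/2} \<Longrightarrow> 0 \<le> green_u t u s"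
  unfolding green_u_def by (rule green_nonneg[OF rhs_cont]) simp_all

lemma green_u_antimono: "continuous_on UNIV u \<Longrightarrow> 0 \<le> t \<Longrightarrow> s \<in> {0..1/2} \<Longrightarrow> green_u t u s \<le> green_u t u 0"
  unfolding green_u_def by (rule green_antimono[OF rhs_cont]) simp_all

lemma green_u_lipschitz:
  assumes u: "unit_valued u" and t: "0 \<le> t" and rs: "r \<in> {0..1/2}" "s \<in> {0..1/2}"
  shows "\<bar>green_u t u r - green_u t u s\<bar> \<le> (1 + t) * \<bar>r - s\<bar>"
proof -
  have "\<bar>green_u t u r - green_u t u s\<bar> \<le> (1 + t) * (1/2) ^ \<alpha> * \<bar>r - s\<bar>"
    unfolding green_u_def by (rule green_lipschitz[OF rhs_cont[OF unit_valued_cont[OF u]] rhs_abs_le[OF u _ t] rs])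
  also have "\<dots> \<le> (1 + t) * 1 * \<bar>r - s\<bar>"
    using t by (intro mult_right_mono mult_left_mono power_le_one) auto
  finally show ?thesis by simp
qed

text \<open>Values stay in [0, 1] because the maximum is at the centre, and the lower bound
  \<open>e\<close> on the denominators makes the images equi-Lipschitz. Since \<open>e\<close> is
  proportional to \<open>t\<close>, these bounds degenerate as \<open>t\<close> tends to 0.\<close>

lemma normalized_fixed_point:
  assumes t: "0 < t"
  obtains u where "unit_valued u" "\<And>s. s \<in> {0..1/2} \<Longrightarrow> u s = green_u t u s / green_u t u 0" "0 < green_u t u 0"
proof -
  define e where "e = t * green d (1/2) (Suc \<alpha>) (\<lambda>_. 1) 0"
  have e: "0 < e" unfolding e_def using t green_one_pos by simp
  have e_le: "e \<le> green_u t u 0" if "unit_valued u" for u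
    unfolding e_def using green_u_lower[OF unit_valued_cont[OF that]] t by simp
  obtain u where u: "unit_valued u" "\<And>s. s \<in> {0..1/2} \<Longrightarrow> u s = green_u t u s / green_u t u 0"
  proof (rule schauder_interval[of "1/2" "\<lambda>u s. green_u t u s / green_u t u 0" "(1 + t) / e"])
    show "green_u t u s / green_u t u 0 \<in> {0..1}" if "unit_valued u" "s \<in> {0..1/2}" for u s
    proof -
      note c = unit_valued_cont[OF that(1)]
      show ?thesis
        using green_u_nonneg[OF c _ that(2), of t] green_u_antimono[OF c _ that(2), of t] e e_le[OF that(1)] t
        by (simp add: divide_le_eq)
    qed
    show "\<bar>green_u t u r / green_u t u 0 - green_u t u s / green_u t u 0\<bar> \<le> (1 + t) / e * \<bar>r - s\<bar>"
      if u: "unit_valued u" and rs: "r \<in> {0..1/2}" "s \<in> {0..1/2}" for u r s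
    proof -
      have "\<bar>green_u t u r / green_u t u 0 - green_u t u s / green_u t u 0\<bar> = \<bar>green_u t u r - green_u t u s\<bar> / green_u t u 0"
        using e e_le[OF u] by (simp add: diff_divide_distrib[symmetric] abs_divide)
      also have "\<dots> \<le> ((1 + t) * \<bar>r - s\<bar>) / e"
        using green_u_lipschitz[OF u _ rs, of t] t e e_le[OF u] by (intro frac_le) auto
      finally show ?thesis by simp
    qed
    show "(\<lambda>k. green_u t (U k) s / green_u t (U k) 0) \<longlonglongrightarrow> green_u t u s / green_u t u 0"
      if U: "\<And>k::nat. unit_valued (U k)" and u: "unit_valued u" and lim: "\<And>s. (\<lambda>k. U k s) \<longlonglongrightarrow> u s"
        and s: "s \<in> {0..1/2}" for U u s
    proof -
      have "(\<lambda>k. green d (1/2) (Suc \<alpha>) (\<lambda>s. \<bar>green_v (U k) s\<bar> powr q + t) r)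
          \<longlonglongrightarrow> green d (1/2) (Suc \<alpha>) (\<lambda>s. \<bar>green_v u s\<bar> powr q + t) r" if r: "r \<in> {0..1/2}" for r
        by (rule green_convergence[OF rhs_cont[OF unit_valued_cont[OF U]] rhs_abs_le[OF U] _ r])
           (use t in \<open>auto intro!: tendsto_intros tendsto_abs_powr pq green_v_convergence[OF U lim]\<close>)
      then have "(\<lambda>k. green_u t (U k) r) \<longlonglongrightarrow> green_u t u r" if "r \<in> {0..1/2}" for r
        using that unfolding green_u_def by blast
      then show ?thesis using s e e_le[OF u] by (intro tendsto_divide) auto
    qed
  qed auto
  then show ?thesis using that[OF u] e e_le[OF u(1)] by simp
qed

text \<open>
  The factors \<open>a\<close> and \<open>c\<close> of \<open>u\<close> and \<open>v\<close> solve \<open>c = a\<^sup>p\<close> and \<open>a / w0 = c\<^sup>q\<close>.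
\<close>

lemma dirichlet_of_fixed_point:
  assumes u: "continuous_on UNIV u" and u0: "u 0 = 1" and w0: "0 < w0"
    and fixpoint: "\<And>s. s \<in> {0..1/2} \<Longrightarrow> u s * w0 = green_u 0 u s" and pq1: "p * q > 1"
    and dim: "DIM('a::euclidean_space) = Suc d"
  obtains U V :: "'a::euclidean_space \<Rightarrow> real" where "dirichlet_solution (Suc \<alpha>) (Suc \<beta>) p q U V" "U 0 \<noteq> 0"
proof -
  \<comment> \<open>Inserting c = a^p into a / w0 = c^q leaves a^(p q - 1) = 1 / w0.\<close>
  define a where "a = (1 / w0) powr (1 / (p * q - 1))"
  define c where "c = a powr p"
  have a: "0 < a" using w0 by (simp add: a_def)
  then have c: "0 < c" by (simp add: c_def)
  have ac: "a / w0 = c powr q"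
  proof -
    have "c powr q = a powr (1 + (p * q - 1))" by (simp add: c_def powr_powr)
    also have "\<dots> = a * a powr (p * q - 1)" using powr_add[of a 1 "p * q - 1"] a by simp
    also have "a powr (p * q - 1) = 1 / w0" using w0 pq1 by (simp add: a_def powr_powr)
    finally show ?thesis by simp
  qed
  \<comment> \<open>Defined through \<open>green\<close>, which is smooth on the whole space; the
    multiple of \<open>u\<close> agrees with it on the closed ball, where the fixed-point equation
    holds.\<close>
  define U where "U = (\<lambda>x::'a. (a / w0) * green d (1/2) (Suc \<alpha>) (\<lambda>s. \<bar>green_v u s\<bar> powr q) (hsq x))"
  define V where "V = (\<lambda>x::'a. c * green_v u (hsq x))"
  have rhs: "continuous_on UNIV (\<lambda>s. \<bar>green_v u s\<bar> powr q)" by (intro continuous_intros green_v_cont u pq)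
  have U_eq: "U x = a * u (hsq x)" if "hsq x \<le> 1/2" for x
    using fixpoint[of "hsq x"] that w0 by (simp add: U_def green_u_def field_simps)
  have ball: "convex (cball (0::'a) 1)" "interior (cball (0::'a) 1) \<noteq> {}" by auto
  have "dirichlet_solution (Suc \<alpha>) (Suc \<beta>) p q U V"
    unfolding dirichlet_solution_def
  proof (intro conjI ballI allI impI)
    show "Ck_on (2 * Suc \<alpha>) U (cball 0 1)"
      unfolding U_def by (rule Ck_on_convex[OF ball green_Ck_on[OF rhs]])
    show "Ck_on (2 * Suc \<beta>) V (cball 0 1)"
      unfolding V_def green_v_def by (rule Ck_on_convex[OF ball green_Ck_on[OF powr_cont[OF u]]])
    show "normal_deriv r U x = 0" if "x \<in> sphere 0 1" "r < Suc \<alpha>" for x r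
      unfolding U_def by (rule green_normal_deriv[OF rhs that(2,1)])
    show "normal_deriv r V x = 0" if "x \<in> sphere 0 1" "r < Suc \<beta>" for x r
      unfolding V_def green_v_def by (rule green_normal_deriv[OF powr_cont[OF u] that(2,1)])
    show "system_on (ball 0 1) (Suc \<alpha>) (Suc \<beta>) p q U V"
      unfolding system_on_def
    proof (intro ballI conjI)
      fix x :: 'a assume x: "x \<in> ball 0 1"
      have "(norm x)\<^sup>2 \<le> 1" using x by (simp add: power_le_one)
      then have hx: "hsq x \<le> 1/2" by (simp add: hsq_norm)
      have "polyharmonic (ball 0 1) (Suc \<alpha>) U x = polyharmonic UNIV (Suc \<alpha>) U x"
        by (rule polyharmonic_open[OF open_ball x])
      also have "\<dots> = (a / w0) * \<bar>green_v u (hsq x)\<bar> powr q"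
        unfolding U_def green_polyharmonic[OF rhs dim] ..
      also have "\<dots> = \<bar>V x\<bar> powr q"
        using c by (simp add: ac V_def abs_mult powr_mult)
      finally show "polyharmonic (ball 0 1) (Suc \<alpha>) U x = \<bar>V x\<bar> powr q" .
      have "polyharmonic (ball 0 1) (Suc \<beta>) V x = polyharmonic UNIV (Suc \<beta>) V x"
        by (rule polyharmonic_open[OF open_ball x])
      also have "\<dots> = c * \<bar>u (hsq x)\<bar> powr p"
        unfolding V_def green_v_def green_polyharmonic[OF powr_cont[OF u] dim] ..
      also have "\<dots> = \<bar>U x\<bar> powr p"
        using a by (simp add: c_def U_eq[OF hx] abs_mult powr_mult)
      finally show "polyharmonic (ball 0 1) (Suc \<beta>) V x = \<bar>U x\<bar> powr p" .
    qed
  qed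
  moreover have "U 0 \<noteq> 0" using U_eq[of 0] u0 a by simp
  ultimately show ?thesis using that by blast
qed

text \<open>Along a subsequence the denominators stay above some \<open>e\<close>, so the fixed
  points have the common Lipschitz constant 2 / e and converge along a further subsequence. The
  equation is passed to the limit in product form.\<close>

lemma fixed_point_of_non_vanishing:
  assumes U: "\<And>n::nat. unit_valued (U n)" and t: "\<And>n. 0 \<le> t n" "\<And>n. t n \<le> 1" "t \<longlonglongrightarrow> 0"
    and fixpoint: "\<And>n s. s \<in> {0..1/2} \<Longrightarrow> U n s = green_u (t n) (U n) s / green_u (t n) (U n) 0"
    and w0: "\<And>n. 0 < green_u (t n) (U n) 0" and no_limit: "\<not> (\<lambda>n. green_u (t n) (U n) 0) \<longlonglongrightarrow> 0"
  obtains u w where "continuous_on UNIV u" "u 0 = 1" "0 < w" "\<And>s. s \<in> {0..1/2} \<Longrightarrow> u s * w = green_u 0 u s"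
proof -
  define W where "W n = green_u (t n) (U n) 0" for n
  obtain e where e: "0 < e" "\<not> (\<forall>\<^sub>F n in sequentially. W n < e)"
    using no_limit w0 by (auto simp: tendsto_iff W_def dist_real_def less_imp_le)
  from not_eventually_sequentiallyD[OF this(2)]
  obtain \<phi> :: "nat \<Rightarrow> nat" where \<phi>: "strict_mono \<phi>" "\<And>n. e \<le> W (\<phi> n)" by (auto simp: not_less)
  define F where "F n s = U (\<phi> n) (clamp_to (1/2) s)" for n s
  have cl: "clamp_to (1/2) s \<in> {0..1/2}" for s by (rule clamp_to_in) simp
  have F_range: "\<bar>F n s\<bar> \<le> 1" for n s
    using U[of "\<phi> n"] by (simp add: F_def unit_valued_def)
  have F_lip: "\<bar>F n r - F n s\<bar> \<le> 2 / e * \<bar>r - s\<bar>" for n r s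
  proof -
    let ?n = "\<phi> n" and ?r = "clamp_to (1/2) r" and ?s = "clamp_to (1/2) s"
    have "\<bar>F n r - F n s\<bar> = \<bar>green_u (t ?n) (U ?n) ?r - green_u (t ?n) (U ?n) ?s\<bar> / W ?n"
      using w0[of ?n] unfolding F_def fixpoint[OF cl] W_def
      by (simp add: diff_divide_distrib[symmetric] abs_divide)
    also have "\<dots> \<le> (2 * \<bar>r - s\<bar>) / e"
    proof (intro frac_le)
      have "\<bar>green_u (t ?n) (U ?n) ?r - green_u (t ?n) (U ?n) ?s\<bar> \<le> (1 + t ?n) * \<bar>?r - ?s\<bar>"
        by (rule green_u_lipschitz[OF U t(1) cl cl])
      also have "\<dots> \<le> 2 * \<bar>r - s\<bar>"
        using t(2)[of ?n] by (intro mult_mono clamp_to_lipschitz) auto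
      finally show "\<bar>green_u (t ?n) (U ?n) ?r - green_u (t ?n) (U ?n) ?s\<bar> \<le> 2 * \<bar>r - s\<bar>" .
    qed (use e \<phi>(2) in auto)
    finally show ?thesis by simp
  qed
  obtain \<psi> f where \<psi>: "strict_mono \<psi>" and f: "\<And>s. 0 \<le> s \<Longrightarrow> (\<lambda>n. F (\<psi> n) s) \<longlonglongrightarrow> f s"
    and f_cont: "continuous_on {0..} f"
  proof (rule locally_lipschitz_convergent_subsequence[of F])
    show "\<exists>C. \<forall>\<^sub>F n in sequentially. \<forall>r\<in>{0..\<rho>}. \<bar>F n r\<bar> \<le> C" for \<rho>
      by (intro exI[of _ 1] always_eventually allI ballI F_range)
    show "\<exists>C. \<forall>\<^sub>F n in sequentially. \<forall>r\<in>{0..\<rho>}. \<forall>s\<in>{0..\<rho>}. \<bar>F n r - F n s\<bar> \<le> C * \<bar>r - s\<bar>" for \<rho>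
      by (intro exI[of _ "2 / e"] always_eventually allI ballI F_lip)
  qed blast
  define u where "u s = f (clamp_to (1/2) s)" for s
  have u_cont: "continuous_on UNIV u"
    unfolding u_def[abs_def]
    by (rule continuous_on_compose2[OF f_cont clamp_to_continuous]) (use cl in force)
  have lim: "(\<lambda>n. U (\<phi> (\<psi> n)) s) \<longlonglongrightarrow> u s" if "s \<in> {0..1/2}" for s
    using f[of s] that clamp_to_id[OF that] by (simp add: F_def u_def)
  have t': "(\<lambda>n. t (\<phi> (\<psi> n))) \<longlonglongrightarrow> 0"
    using LIMSEQ_subseq_LIMSEQ[OF LIMSEQ_subseq_LIMSEQ[OF t(3) \<phi>(1)] \<psi>] by (simp add: o_def)
  have wlim: "(\<lambda>n. green_u (t (\<phi> (\<psi> n))) (U (\<phi> (\<psi> n))) s) \<longlonglongrightarrow> green_u 0 u s" if "s \<in> {0..1/2}" for s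
    by (rule green_u_convergence[OF U lim t(1,2) t' that])
  \<comment> \<open>The lower bound survives the limit, so the limiting denominator is
    positive.\<close>
  have "e \<le> green_u 0 u 0"
    by (rule LIMSEQ_le_const[OF wlim]) (use \<phi>(2) in \<open>auto simp: W_def\<close>)
  then have w: "0 < green_u 0 u 0" using e by simp
  have fix_u: "u s * green_u 0 u 0 = green_u 0 u s" if "s \<in> {0..1/2}" for s
  proof (rule LIMSEQ_unique)
    show "(\<lambda>n. U (\<phi> (\<psi> n)) s * green_u (t (\<phi> (\<psi> n))) (U (\<phi> (\<psi> n))) 0) \<longlonglongrightarrow> u s * green_u 0 u 0"
      by (intro tendsto_mult lim wlim that) auto
    have "U n s * green_u (t n) (U n) 0 = green_u (t n) (U n) s" for n
      using fixpoint[OF that, of n] w0[of n] by simp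
    then show "(\<lambda>n. U (\<phi> (\<psi> n)) s * green_u (t (\<phi> (\<psi> n))) (U (\<phi> (\<psi> n))) 0) \<longlonglongrightarrow> green_u 0 u s"
      using wlim[OF that] by simp
  qed
  have "u 0 = 1" using fix_u[of 0] w by simp
  then show ?thesis using that u_cont w fix_u by blast
qed

text \<open>
  The blow-up \<open>U(s / l)\<close>, \<open>l\<^sup>\<beta> V(s / l)\<close> in the variable \<open>s\<close> absorbs \<open>\<mu> = 1 / green_u t U 0\<close> when
  \<open>l\<^bsup>\<alpha> + \<beta> q\<^esup> = \<mu>\<close>, with \<open>Suc \<alpha>\<close> and \<open>Suc \<beta>\<close> for \<open>\<alpha>\<close> and \<open>\<beta>\<close>; the perturbation then tends to \<open>0\<close> because
  \<open>\<mu> t\<close> is bounded.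
\<close>

lemma entire_profile_of_vanishing:
  assumes U: "\<And>n::nat. unit_valued (U n)" and t: "\<And>n. 0 \<le> t n"
    and fixpoint: "\<And>n s. s \<in> {0..1/2} \<Longrightarrow> U n s = green_u (t n) (U n) s / green_u (t n) (U n) 0"
    and w0: "\<And>n. 0 < green_u (t n) (U n) 0" and limit: "(\<lambda>n. green_u (t n) (U n) 0) \<longlonglongrightarrow> 0"
  obtains u v where "continuous_on UNIV u" "continuous_on UNIV v" "u 0 = 1"
    "radial_solution d (Suc \<alpha>) {0..} (\<lambda>s. \<bar>v s\<bar> powr q) u"
    "radial_solution d (Suc \<beta>) {0..} (\<lambda>s. \<bar>u s\<bar> powr p) v"
proof -
  define \<gamma> where "\<gamma> = real (Suc \<alpha>) + real (Suc \<beta>) * q"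
  have \<gamma>: "0 < \<gamma>" unfolding \<gamma>_def using pq by (intro add_pos_pos mult_pos_pos) auto
  define \<mu> where "\<mu> n = 1 / green_u (t n) (U n) 0" for n
  define l where "l n = \<mu> n powr (1 / \<gamma>)" for n
  have \<mu>: "0 < \<mu> n" and l: "0 < l n" for n using w0[of n] by (simp_all add: \<mu>_def l_def)
  have l\<mu>: "\<mu> n / l n ^ Suc \<alpha> = (l n ^ Suc \<beta>) powr q" for n
  proof -
    have "\<mu> n = l n powr \<gamma>" using \<mu>[of n] \<gamma> by (simp add: l_def powr_powr)
    also have "\<dots> = l n powr real (Suc \<alpha>) * l n powr (real (Suc \<beta>) * q)"
      unfolding \<gamma>_def by (rule powr_add)
    also have "\<dots> = l n ^ Suc \<alpha> * (l n ^ Suc \<beta>) powr q"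
      using l[of n] by (simp add: powr_realpow[symmetric] powr_powr del: of_nat_Suc power_Suc)
    finally show ?thesis using l[of n] by simp
  qed
  have \<mu>_top: "filterlim \<mu> at_top sequentially"
  proof -
    have "filterlim (\<lambda>n. inverse (green_u (t n) (U n) 0)) at_top sequentially"
      by (rule filterlim_inverse_at_top[OF limit]) (use w0 in auto)
    then show ?thesis by (simp add: \<mu>_def[abs_def] inverse_eq_divide)
  qed
  have l_top: "filterlim l at_top sequentially"
    unfolding filterlim_at_top_gt[of _ _ 0]
  proof (intro allI impI)
    fix Z :: real assume Z: "0 < Z"
    have "\<forall>\<^sub>F n in sequentially. Z powr \<gamma> \<le> \<mu> n" using \<mu>_top by (simp add: filterlim_at_top)
    then show "\<forall>\<^sub>F n in sequentially. Z \<le> l n"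
    proof eventually_elim
      case (elim n)
      have "(Z powr \<gamma>) powr (1 / \<gamma>) \<le> l n" unfolding l_def using elim \<gamma> by (intro powr_mono2) auto
      then show ?case using Z \<gamma> by (simp add: powr_powr)
    qed
  qed
  define e where "e = green d (1/2) (Suc \<alpha>) (\<lambda>_. 1) 0"
  have e: "0 < e" unfolding e_def by (rule green_one_pos)
  define t' where "t' n = \<mu> n * t n / l n ^ Suc \<alpha>" for n
  have t'_nonneg: "0 \<le> t' n" for n unfolding t'_def using \<mu>[of n] l[of n] t[of n] by simp
  have t'_le: "t' n \<le> (1 / e) * inverse (l n ^ Suc \<alpha>)" for n
  proof -
    have "t n * e \<le> green_u (t n) (U n) 0"
      unfolding e_def by (rule green_u_lower[OF unit_valued_cont[OF U] t])
    then have "\<mu> n * t n \<le> 1 / e" using w0[of n] e by (simp add: \<mu>_def field_simps)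
    then show ?thesis using l[of n] unfolding t'_def by (simp add: divide_inverse mult_right_mono)
  qed
  have t'_lim: "t' \<longlonglongrightarrow> 0"
  proof (rule tendsto_sandwich[OF always_eventually always_eventually tendsto_const])
    have "filterlim (\<lambda>n. l n ^ Suc \<alpha>) at_top sequentially"
      by (rule filterlim_pow_at_top[OF _ l_top]) simp
    from tendsto_mult[OF tendsto_const tendsto_inverse_0_at_top[OF this], of "1 / e"]
    show "(\<lambda>n. (1 / e) * inverse (l n ^ Suc \<alpha>)) \<longlonglongrightarrow> 0" by simp
  qed (use t'_nonneg t'_le in auto)
  define X where "X n s = U n (s / l n)" for n s
  \<comment> \<open>The factor cancels the power of 1 / l that rescaling puts on the right-hand side
    of the second equation.\<close>
  define Y where "Y n s = l n ^ Suc \<beta> * green_v (U n) (s / l n)" for n s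
  have scale_cont: "continuous_on UNIV (\<lambda>s. f (s / l n))" if "continuous_on UNIV f" for f :: "real \<Rightarrow> real" and n
    using l[of n] by (intro continuous_on_compose2[OF that] continuous_intros) auto
  have "approximating_solutions d \<alpha> \<beta> p q (\<lambda>n. 1/2 * l n) t' X Y"
  proof unfold_locales
    show "0 < p" "0 < q" by (fact pq)+
    show "filterlim (\<lambda>n. 1/2 * l n) at_top sequentially"
      by (rule filterlim_tendsto_pos_mult_at_top[OF tendsto_const _ l_top]) simp
    show "0 \<le> t' n" for n by (rule t'_nonneg)
    show "t' \<longlonglongrightarrow> 0" by (rule t'_lim)
    show "unit_valued (X n)" for n
      using scale_cont[OF unit_valued_cont[OF U], of n] U[of n] by (simp add: unit_valued_def X_def[abs_def])
    show "X n 0 = 1" for n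
      using fixpoint[of 0 n] w0[of n] by (simp add: X_def)
    show "continuous_on UNIV (Y n)" for n
      unfolding Y_def[abs_def] by (intro continuous_intros scale_cont green_v_cont unit_valued_cont U)
    show "0 \<le> Y n s \<and> Y n s \<le> Y n 0" if "s \<in> {0..1/2 * l n}" for n s
    proof -
      have "s / l n \<in> {0..1/2}" using that l[of n] by (simp add: divide_le_eq)
      then show ?thesis
        using green_v_nonneg[OF unit_valued_cont[OF U]] green_v_antimono[OF unit_valued_cont[OF U]] l[of n]
        by (simp add: Y_def del: power_Suc)
    qed
    show "radial_solution d (Suc \<alpha>) {0..1/2 * l n} (\<lambda>s. \<bar>Y n s\<bar> powr q + t' n) (X n)" for n
    proof -
      have "radial_solution d (Suc \<alpha>) {0..1/2} (\<lambda>s. \<mu> n * (\<bar>green_v (U n) s\<bar> powr q + t n)) (\<lambda>s. \<mu> n * green_u (t n) (U n) s)"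
        unfolding green_u_def
        by (intro radial_solution_cmult green_radial_solution rhs_cont unit_valued_cont U)
      then have "radial_solution d (Suc \<alpha>) {0..1/2} (\<lambda>s. \<mu> n * (\<bar>green_v (U n) s\<bar> powr q + t n)) (U n)"
        by (rule radial_solution_cong) (simp add: \<mu>_def fixpoint[of _ n])
      from radial_solution_scale[OF this l]
      have "radial_solution d (Suc \<alpha>) {0..1/2 * l n}
          (\<lambda>s. \<mu> n * (\<bar>green_v (U n) (s / l n)\<bar> powr q + t n) / l n ^ Suc \<alpha>) (X n)"
        unfolding X_def[abs_def] .
      moreover have "\<mu> n * (\<bar>green_v (U n) (s / l n)\<bar> powr q + t n) / l n ^ Suc \<alpha> = \<bar>Y n s\<bar> powr q + t' n" for s
      proof -
        have "\<bar>Y n s\<bar> powr q = (l n ^ Suc \<beta>) powr q * \<bar>green_v (U n) (s / l n)\<bar> powr q"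
          using l[of n] by (simp add: Y_def abs_mult powr_mult del: power_Suc)
        then show ?thesis unfolding l\<mu>[symmetric] t'_def by (simp add: algebra_simps add_divide_distrib)
      qed
      ultimately show ?thesis by simp
    qed
    show "radial_solution d (Suc \<beta>) {0..1/2 * l n} (\<lambda>s. \<bar>X n s\<bar> powr p) (Y n)" for n
    proof -
      have "radial_solution d (Suc \<beta>) {0..1/2} (\<lambda>s. \<bar>U n s\<bar> powr p) (green_v (U n))"
        unfolding green_v_def by (intro green_radial_solution powr_cont unit_valued_cont U)
      from radial_solution_cmult[OF radial_solution_scale[OF this l[of n]], where a = "l n ^ Suc \<beta>"]
      show ?thesis using l[of n] by (simp add: X_def[abs_def] Y_def[abs_def])
    qed
  qed
  then interpret approximating_solutions d \<alpha> \<beta> p q "\<lambda>n. 1/2 * l n" t' X Y .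
  show ?thesis by (rule limit_solution) (rule that)
qed

end

section \<open>From radial profiles to solutions on the whole space\<close>

lemma entire_solution_of_profile:
  assumes "continuous_on UNIV u" "continuous_on UNIV v" "u 0 = 1" "0 < p" "0 < q"
    and u: "radial_solution d \<alpha> {0..} (\<lambda>s. \<bar>v s\<bar> powr q) u"
    and v: "radial_solution d \<beta> {0..} (\<lambda>s. \<bar>u s\<bar> powr p) v"
    and dim: "DIM('a::euclidean_space) = Suc d"
  obtains U V :: "'a::euclidean_space \<Rightarrow> real" where "entire_solution \<alpha> \<beta> p q U V" "U 0 \<noteq> 0"
    "radially_symmetric U" "radially_symmetric V"
proof -
  have smooth: "Ck_on (2 * k) (\<lambda>x::'a. F (hsq x)) UNIV \<and> polyharmonic UNIV k (\<lambda>x::'a. F (hsq x)) = (\<lambda>x. f (hsq x))"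
    if sol: "radial_solution d k {0..} f F" and f: "continuous_on UNIV f" for k f F
  proof -
    obtain c where "\<And>s. 0 \<le> s \<Longrightarrow> F s = (\<Sum>i<k. c i * s ^ i) + (inv_lap d ^^ k) f s"
      using sol by (auto simp: radial_solution_def)
    then have "(\<lambda>x::'a. F (hsq x)) = (\<lambda>x. (\<Sum>i<k. c i * hsq x ^ i) + (inv_lap d ^^ k) f (hsq x))"
      by simp
    then show ?thesis
      using Ck_on_radial_solution[OF f, where k = k and c = c and d = d and 'a = 'a]
        polyharmonic_radial_solution[OF f dim, of k c] by simp
  qed
  have "entire_solution \<alpha> \<beta> p q (\<lambda>x::'a. u (hsq x)) (\<lambda>x. v (hsq x))"
    using smooth[OF u continuous_on_abs_powr[OF assms(2,5)]] smooth[OF v continuous_on_abs_powr[OF assms(1,4)]]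
    by (simp add: entire_solution_def system_on_def)
  moreover have "radially_symmetric (\<lambda>x::'a. F (hsq x))" for F :: "real \<Rightarrow> real"
    by (auto simp: radially_symmetric_def hsq_norm)
  ultimately show ?thesis using that[of "\<lambda>x. u (hsq x)" "\<lambda>x. v (hsq x)"] assms(3) by simp
qed

theorem theorem1:
  fixes \<alpha> \<beta> :: nat and p q :: real
  assumes "\<alpha> \<ge> 1" and "\<beta> \<ge> 1"
    and "CARD('n::finite) > max (2 * \<alpha>) (2 * \<beta>)"
    and "p > 0" and "q > 0" and "p * q > 1"
    and "\<And>u v :: real ^ 'n \<Rightarrow> real. dirichlet_solution \<alpha> \<beta> p q u v \<Longrightarrow>
           \<forall>x\<in>cball 0 1. u x = 0 \<and> v x = 0"
  shows "\<exists>u v :: real ^ 'n \<Rightarrow> real.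
           entire_solution \<alpha> \<beta> p q u v \<and> (\<exists>x. u x \<noteq> 0 \<or> v x \<noteq> 0) \<and>
           radially_symmetric u \<and> radially_symmetric v"
proof -
  \<comment> \<open>The orders are written as successors because the outermost backward integration
    supplies monotonicity and the Lipschitz bounds.\<close>
  obtain a b where ab: "\<alpha> = Suc a" "\<beta> = Suc b"
    using assms(1,2) by (metis Suc_le_D One_nat_def)
  obtain d where d: "DIM(real ^ 'n) = Suc d"
    using assms(3) by (cases "CARD('n)") auto
  define t :: "nat \<Rightarrow> real" where "t n = inverse (real (Suc n))" for n
  have t: "0 < t n" "t n \<le> 1" for n by (auto simp: t_def inverse_eq_divide)
  have t_lim: "t \<longlonglongrightarrow> 0" using LIMSEQ_inverse_real_of_nat by (simp add: t_def[abs_def])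
  have "\<exists>u. unit_valued u \<and> (\<forall>s\<in>{0..1/2}. u s = green_u d a b p q (t n) u s / green_u d a b p q (t n) u 0)
      \<and> 0 < green_u d a b p q (t n) u 0" for n
    by (rule normalized_fixed_point[OF assms(4,5) t(1)[of n]]) blast
  then obtain U where U: "\<And>n. unit_valued (U n)"
    and fixpoint: "\<And>n s. s \<in> {0..1/2} \<Longrightarrow> U n s = green_u d a b p q (t n) (U n) s / green_u d a b p q (t n) (U n) 0"
    and w0: "\<And>n. 0 < green_u d a b p q (t n) (U n) 0"
    by metis
  show ?thesis
  proof (cases "(\<lambda>n. green_u d a b p q (t n) (U n) 0) \<longlonglongrightarrow> 0")
    case True
    obtain u v where uv: "continuous_on UNIV u" "continuous_on UNIV v" "u 0 = 1"
      "radial_solution d (Suc a) {0..} (\<lambda>s. \<bar>v s\<bar> powr q) u"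
      "radial_solution d (Suc b) {0..} (\<lambda>s. \<bar>u s\<bar> powr p) v"
      using entire_profile_of_vanishing[OF assms(4,5) U less_imp_le[OF t(1)] fixpoint w0 True] by blast
    show ?thesis
      by (rule entire_solution_of_profile[OF uv(1-3) assms(4,5) uv(4,5) d]) (auto simp: ab)
  next
    case False
    obtain u w where "continuous_on UNIV u" "u 0 = 1" "0 < w" "\<And>s. s \<in> {0..1/2} \<Longrightarrow> u s * w = green_u d a b p q 0 u s"
      using fixed_point_of_non_vanishing[OF assms(4,5) U less_imp_le[OF t(1)] t(2) t_lim fixpoint w0 False] by blast
    from dirichlet_of_fixed_point[OF assms(4,5) this assms(6) d]
    obtain u v :: "real ^ 'n \<Rightarrow> real" where "dirichlet_solution \<alpha> \<beta> p q u v" "u 0 \<noteq> 0"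
      unfolding ab by blast
    with assms(7)[of u v] show ?thesis by auto
  qed
qed

end
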